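(* Let $R_2=\mathbb{F}_2[u,v]/\langle u^2,v^2,uv-vu\rangle$, let $\phi:R_2^{16}\to\mathbb{F}_2^{64}$ be the Gray map, and let $\mathcal{D}$ be the binary self-dual $[16,8,4]$ code generated by $[I_8\,|\,A_2]$, where $$A_2=\begin{bmatrix} 1&0&0&1&1&1&1&0\\ 0&1&0&1&1&1&1&0\\ 0&0&1&1&1&1&1&0\\ 0&0&0&1&0&0&1&1\\ 0&0&0&0&1&0&1&1\\ 0&0&0&0&0&1&1&1\\ 1&1&1&1&1&1&0&1\\ 1&1&1&0&0&0&1&1 \end{bmatrix}.$$ Then: (1) for each $\beta\in\{16,20,24,26,28,30,34,38\}$ there exists a linear code $\mathcal{L}$ of length $16$ over $R_2$, generated by a matrix of the form $[I_8\,|\,L]$ with $L$ an $8\times 8$ matrix over $R_2$, such that $\mathcal{L}$ is a lift of $\mathcal{D}$ and $\phi(\mathcal{L})$ is an extremal binary self-dual Type I $[64,32,12]$ code with weight enumerator $W_{64,1}$ with parameter $\beta$; (2) for each $\beta\in\{3,7,11,15,26,27,35\}$ there exists a linear code $\mathcal{L}$ of length $16$ over $R_2$, generated by a matrix of the form $[I_8\,|\,L]$ with $L$ an $8\times 8$ matrix over $R_2$, such that $\mathcal{L}$ is a lift of $\mathcal{D}$ and $\phi(\mathcal{L})$ is an extremal binary self-dual Type I $[64,32,12]$ code with weight enumerator $W_{64,2}$ with parameter $\beta$.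
   Context: A linear code of length $n$ over a commutative ring $R$ is an $R$-submodule of $R^n$; it is self-dual if it equals its dual with respect to the standard inner product $\sum_i a_ib_i$. A binary $[n,k,d]$ code is a $k$-dimensional subspace of $\mathbb{F}_2^n$ with minimum Hamming distance $d$. A binary self-dual code is Type II if all its codeword weights are divisible by $4$ and Type I (singly-even) otherwise. A binary self-dual code of length $n$ has minimum distance $d\le 4\lfloor n/24\rfloor+6$ if $n\equiv 22\pmod{24}$ and $d\le 4\lfloor n/24\rfloor+4$ otherwise, and it is called extremal if it meets this bound; for $n=64$ this means $d=12$. Every element of $R_2^n$ is uniquely $\bar a+u\bar b+v\bar c+uv\bar d$ with $\bar a,\bar b,\bar c,\bar d\in\mathbb{F}_2^n$. The Gray map $\phi:R_2^n\to\mathbb{F}_2^{4n}$ is $\phi(\bar a+u\bar b+v\bar c+uv\bar d)=(\bar d,\ \bar c+\bar d,\ \bar b+\bar d,\ \bar a+\bar b+\bar c+\bar d)$. The projection $\pi:R_2^n\to\mathbb{F}_2^n$ is $\pi(\bar a+u\bar b+v\bar c+uv\bar d)=\bar a$. A code $\mathcal{L}$ over $R_2$ is a lift of a binary self-dual code $\mathcal{D}$ if $\pi(\mathcal{L})=\mathcal{D}$. The weight enumerator of a binary code is $\sum_i A_iy^i$, where $A_i$ is the number of codewords of Hamming weight $i$. An extremal singly-even self-dual $[64,32,12]$ code has a weight enumerator of one of the two forms $W_{64,1}=1+(1312+16\beta)y^{12}+(22016-64\beta)y^{14}+\cdots$ with $14\le\beta\le 284$, or $W_{64,2}=1+(1312+16\beta)y^{12}+(23040-64\beta)y^{14}+\cdots$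 with $0\le\beta\le 277$. Having weight enumerator $W_{64,1}$ (resp. $W_{64,2}$) with parameter $\beta$ means that the numbers of codewords of weights $12$ and $14$ are the displayed coefficients for that $\beta$. *)

theory Defs
  imports
    "HOL-Library.Z2"
    "HOL-Computational_Algebra.Polynomial"
    "Jordan_Normal_Form.Matrix"
    "Jordan_Normal_Form.VS_Connect"
begin

section \<open>The ring \<open>R\<^sub>2 = F\<^sub>2[u,v]/(u\<^sup>2, v\<^sup>2, uv - vu)\<close>\<close>

text \<open>\<open>F\<^sub>2[u,v]\<close> is taken to be \<open>F\<^sub>2[u][v]\<close>, so \<open>coeff (coeff p j) i\<close> is the coefficient of
  \<open>u\<^sup>i v\<^sup>j\<close>. As this polynomial ring is already commutative, the generator \<open>uv - vu\<close> is zero in it.\<close>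

definition poly_u :: "bit poly poly" where "poly_u = [:[:0, 1:]:]"
definition poly_v :: "bit poly poly" where "poly_v = [:0, 1:]"

definition R2_ideal :: "bit poly poly set" where
  "R2_ideal = {a * poly_u^2 + b * poly_v^2 + c * (poly_u * poly_v - poly_v * poly_u) | a b c. True}"

lemma R2_ideal_iff:
  "p \<in> R2_ideal \<longleftrightarrow>
     coeff (coeff p 0) 0 = 0 \<and> coeff (coeff p 0) 1 = 0 \<and>
     coeff (coeff p 1) 0 = 0 \<and> coeff (coeff p 1) 1 = 0"
  (is "?L \<longleftrightarrow> ?R")
proof
  have U2: "a * poly_u^2 = Polynomial.smult [:0, 0, 1:] a" for a
    by (simp add: poly_u_def power2_eq_square)
  have V2: "b * poly_v^2 = pCons 0 (pCons 0 b)" for b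
    by (simp add: poly_v_def power2_eq_square)
  {
    assume ?L
    then obtain a b where "p = a * poly_u^2 + b * poly_v^2"
      by (auto simp: R2_ideal_def mult.commute)
    then show ?R unfolding U2 V2 by simp
  next
    assume R: ?R
    obtain p0 p1 q where p: "p = pCons p0 (pCons p1 q)"
      by (metis pCons_cases)
    obtain a0 b0 r0 where p0: "p0 = pCons a0 (pCons b0 r0)"
      by (metis pCons_cases)
    obtain a1 b1 r1 where p1: "p1 = pCons a1 (pCons b1 r1)"
      by (metis pCons_cases)
    have z: "a0 = 0" "b0 = 0" "a1 = 0" "b1 = 0"
      using R by (simp_all add: p p0 p1)
    have "p = [:r0, r1:] * poly_u^2 + q * poly_v^2 + 0 * (poly_u * poly_v - poly_v * poly_u)"
      unfolding U2 V2 by (simp add: p p0 p1 z)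
    then show ?L unfolding R2_ideal_def by blast
  }
qed

definition R2_cong :: "bit poly poly \<Rightarrow> bit poly poly \<Rightarrow> bool" where
  "R2_cong p q \<longleftrightarrow> p - q \<in> R2_ideal"

lemma R2_cong_iff:
  "R2_cong p q \<longleftrightarrow>
     coeff (coeff p 0) 0 = coeff (coeff q 0) 0 \<and> coeff (coeff p 0) 1 = coeff (coeff q 0) 1 \<and>
     coeff (coeff p 1) 0 = coeff (coeff q 1) 0 \<and> coeff (coeff p 1) 1 = coeff (coeff q 1) 1"
  unfolding R2_cong_def R2_ideal_iff coeff_diff right_minus_eq ..

quotient_type R2 = "bit poly poly" / R2_cong
  by (rule equivpI) (auto simp: reflp_def symp_def transp_def R2_cong_iff)

lemma coeff_mult_01:
  fixes p q :: "'a::comm_semiring_0 poly"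
  shows "coeff (p * q) 0 = coeff p 0 * coeff q 0"
    and "coeff (p * q) 1 = coeff p 0 * coeff q 1 + coeff p 1 * coeff q 0"
  by (simp_all add: coeff_mult)

instantiation R2 :: comm_ring_1
begin

lift_definition zero_R2 :: R2 is 0 .
lift_definition one_R2 :: R2 is 1 .
lift_definition plus_R2 :: "R2 \<Rightarrow> R2 \<Rightarrow> R2" is "(+)"
  by (simp add: R2_cong_iff)
lift_definition minus_R2 :: "R2 \<Rightarrow> R2 \<Rightarrow> R2" is "(-)"
  by (simp only: R2_cong_iff coeff_diff)
lift_definition uminus_R2 :: "R2 \<Rightarrow> R2" is uminus
  by (simp only: R2_cong_iff coeff_minus)
lift_definition times_R2 :: "R2 \<Rightarrow> R2 \<Rightarrow> R2" is "(*)"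
  by (simp only: R2_cong_iff coeff_mult_01 coeff_add)

instance
proof
  show "(0::R2) \<noteq> 1"
    by transfer (simp add: R2_cong_iff)
qed (transfer; simp add: R2_cong_iff algebra_simps; fail)+

end

lift_definition R2_of_bit :: "bit \<Rightarrow> R2" is "\<lambda>a. [:[:a:]:]" .
lift_definition R2_u :: R2 is poly_u .
lift_definition R2_v :: R2 is poly_v .

text \<open>The coordinates of an element of \<open>R\<^sub>2\<close> in the basis \<open>1, u, v, uv\<close>.\<close>

lift_definition cf_1 :: "R2 \<Rightarrow> bit" is "\<lambda>p. coeff (coeff p 0) 0"
  by (simp add: R2_cong_iff)
lift_definition cf_u :: "R2 \<Rightarrow> bit" is "\<lambda>p. coeff (coeff p 0) 1"
  by (simp add: R2_cong_iff)
lift_definition cf_v :: "R2 \<Rightarrow> bit" is "\<lambda>p. coeff (coeff p 1) 0"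
  by (simp add: R2_cong_iff)
lift_definition cf_uv :: "R2 \<Rightarrow> bit" is "\<lambda>p. coeff (coeff p 1) 1"
  by (simp add: R2_cong_iff)

lemma R2_decomp_iff:
  "x = R2_of_bit a + R2_u * R2_of_bit b + R2_v * R2_of_bit c + R2_u * R2_v * R2_of_bit d \<longleftrightarrow>
     a = cf_1 x \<and> b = cf_u x \<and> c = cf_v x \<and> d = cf_uv x"
  by transfer (auto simp: R2_cong_iff poly_u_def poly_v_def)

lemma R2_eq_iff:
  "x = y \<longleftrightarrow> cf_1 x = cf_1 y \<and> cf_u x = cf_u y \<and> cf_v x = cf_v y \<and> cf_uv x = cf_uv y"
  by transfer (simp add: R2_cong_iff)

lemma cf_add:
  "cf_1 (x + y) = cf_1 x + cf_1 y" "cf_u (x + y) = cf_u x + cf_u y"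
  "cf_v (x + y) = cf_v x + cf_v y" "cf_uv (x + y) = cf_uv x + cf_uv y"
  by (transfer; simp)+

lemma cf_mult:
  "cf_1 (x * y) = cf_1 x * cf_1 y"
  "cf_u (x * y) = cf_1 x * cf_u y + cf_u x * cf_1 y"
  "cf_v (x * y) = cf_1 x * cf_v y + cf_v x * cf_1 y"
  "cf_uv (x * y) = cf_1 x * cf_uv y + cf_u x * cf_v y + cf_v x * cf_u y + cf_uv x * cf_1 y"
  by (transfer; simp only: coeff_mult_01 coeff_add add.assoc)+

section \<open>Codes\<close>

definition linear_code :: "nat \<Rightarrow> 'a::comm_ring_1 vec set \<Rightarrow> bool" where
  "linear_code n C \<longleftrightarrow> submodule class_ring C (module_vec TYPE('a) n)"

lemma linear_code_iff:
  fixes C :: "'a::comm_ring_1 vec set"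
  shows "linear_code n C \<longleftrightarrow>
    C \<subseteq> carrier_vec n \<and> 0\<^sub>v n \<in> C \<and> (\<forall>x\<in>C. \<forall>y\<in>C. x + y \<in> C) \<and> (\<forall>a. \<forall>x\<in>C. a \<cdot>\<^sub>v x \<in> C)"
proof -
  interpret vec_module "TYPE('a)" n .
  show ?thesis
    unfolding linear_code_def submodule_def using module_axioms
    by (auto simp: module_vec_simps)
qed

definition dual_code :: "nat \<Rightarrow> 'a::comm_ring_1 vec set \<Rightarrow> 'a vec set" where
  "dual_code n C = {x \<in> carrier_vec n. \<forall>y\<in>C. x \<bullet> y = 0}"

definition self_dual :: "nat \<Rightarrow> 'a::comm_ring_1 vec set \<Rightarrow> bool" where
  "self_dual n C \<longleftrightarrow> linear_code n C \<and> C = dual_code n C"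

text \<open>The code generated by (the rows of) a matrix: all linear combinations \<open>y\<cdot>G\<close> of its rows.\<close>

definition generated_code :: "'a::comm_ring_1 mat \<Rightarrow> 'a vec set" where
  "generated_code G = {G\<^sup>T *\<^sub>v y | y. y \<in> carrier_vec (dim_row G)}"

text \<open>The matrix \<open>[A | B]\<close>, for \<open>A\<close> and \<open>B\<close> with the same number of rows.\<close>

definition append_cols :: "'a::zero mat \<Rightarrow> 'a mat \<Rightarrow> 'a mat" where
  "append_cols A B = four_block_mat A B (0\<^sub>m 0 (dim_col A)) (0\<^sub>m 0 (dim_col B))"

section \<open>Binary codes\<close>

definition weight :: "bit vec \<Rightarrow> nat" where
  "weight x = card {i. i < dim_vec x \<and> x $ i \<noteq> 0}"

definition hamming_dist :: "bit vec \<Rightarrow> bit vec \<Rightarrow> nat" where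
  "hamming_dist x y = card {i. i < dim_vec x \<and> x $ i \<noteq> y $ i}"

definition min_distance :: "bit vec set \<Rightarrow> nat" where
  "min_distance C = Min {hamming_dist x y | x y. x \<in> C \<and> y \<in> C \<and> x \<noteq> y}"

definition binary_code :: "nat \<Rightarrow> nat \<Rightarrow> nat \<Rightarrow> bit vec set \<Rightarrow> bool" where
  "binary_code n k d C \<longleftrightarrow>
     linear_code n C \<and>
     vectorspace.dim class_ring (module_vec TYPE(bit) n\<lparr>carrier := C\<rparr>) = k \<and>
     min_distance C = d"

definition type_II :: "nat \<Rightarrow> bit vec set \<Rightarrow> bool" where
  "type_II n C \<longleftrightarrow> self_dual n C \<and> (\<forall>x\<in>C. 4 dvd weight x)"

definition type_I :: "nat \<Rightarrow> bit vec set \<Rightarrow> bool" where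
  "type_I n C \<longleftrightarrow> self_dual n C \<and> \<not> type_II n C"

definition extremal_bound :: "nat \<Rightarrow> nat" where
  "extremal_bound n = (if n mod 24 = 22 then 4 * (n div 24) + 6 else 4 * (n div 24) + 4)"

definition extremal :: "nat \<Rightarrow> bit vec set \<Rightarrow> bool" where
  "extremal n C \<longleftrightarrow> self_dual n C \<and> min_distance C = extremal_bound n"

definition weight_enumerator :: "nat \<Rightarrow> bit vec set \<Rightarrow> int poly" where
  "weight_enumerator n C = (\<Sum>i\<le>n. monom (int (card {x \<in> C. weight x = i})) i)"

text \<open>A code has weight enumerator \<open>W\<^sub>6\<^sub>4\<^sub>,\<^sub>1\<close> or \<open>W\<^sub>6\<^sub>4\<^sub>,\<^sub>2\<close> with parameter \<open>\<beta>\<close> if its numbers of codewords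
  of weights 12 and 14 are the displayed coefficients. The parameter range is part of either form.\<close>

definition has_W64_1 :: "int \<Rightarrow> bit vec set \<Rightarrow> bool" where
  "has_W64_1 \<beta> C \<longleftrightarrow> 14 \<le> \<beta> \<and> \<beta> \<le> 284 \<and>
     coeff (weight_enumerator 64 C) 12 = 1312 + 16 * \<beta> \<and>
     coeff (weight_enumerator 64 C) 14 = 22016 - 64 * \<beta>"

definition has_W64_2 :: "int \<Rightarrow> bit vec set \<Rightarrow> bool" where
  "has_W64_2 \<beta> C \<longleftrightarrow> 0 \<le> \<beta> \<and> \<beta> \<le> 277 \<and>
     coeff (weight_enumerator 64 C) 12 = 1312 + 16 * \<beta> \<and>
     coeff (weight_enumerator 64 C) 14 = 23040 - 64 * \<beta>"

section \<open>Gray map, projection and lifts\<close>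

definition gray :: "R2 vec \<Rightarrow> bit vec" where
  "gray x = (let a = map_vec cf_1 x; b = map_vec cf_u x; c = map_vec cf_v x; d = map_vec cf_uv x
     in d @\<^sub>v (c + d) @\<^sub>v (b + d) @\<^sub>v (a + b + c + d))"

definition proj :: "R2 vec \<Rightarrow> bit vec" where
  "proj x = map_vec cf_1 x"

definition is_lift :: "nat \<Rightarrow> R2 vec set \<Rightarrow> bit vec set \<Rightarrow> bool" where
  "is_lift n \<L> D \<longleftrightarrow> linear_code n \<L> \<and> self_dual n D \<and> proj ` \<L> = D"

definition A2 :: "bit mat" where
  "A2 = mat_of_rows_list 8
    [[1,0,0,1,1,1,1,0],
     [0,1,0,1,1,1,1,0],
     [0,0,1,1,1,1,1,0],
     [0,0,0,1,0,0,1,1],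
     [0,0,0,0,1,0,1,1],
     [0,0,0,0,0,1,1,1],
     [1,1,1,1,1,1,0,1],
     [1,1,1,0,0,0,1,1]]"

definition D_code :: "bit vec set" where
  "D_code = generated_code (append_cols (1\<^sub>m 8) A2)"

end

theory Submission
  imports Defs
begin

text \<open>
  Pairing the coordinates of \<open>\<phi>(\<L>)\<close> that are exchanged by \<open>1 + v\<close>, write a codeword as \<open>(h, h + p)\<close>.
  For all fifteen codes the words \<open>p\<close> form one and the same doubly-even self-dual \<open>[32,16,8]\<close> code \<open>E\<close>,
  and \<open>(h, h + p)\<close> has weight \<open>wt p + 2 wt (h \<and> \<not> p)\<close>. A nonzero codeword of weight below 12 therefore
  lies over a word \<open>p\<close> of weight 8 with \<open>h\<close> having at most one entry outside \<open>p\<close>. Orthogonality to the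
  codewords over words of \<open>E\<close> disjoint from \<open>p\<close> tells the position of that entry, and excludes all
  positions: this is a small computation for each of the 620 words \<open>p\<close> of weight 8.

  The numbers of codewords of weight 12 and 14 are determined by the numbers of vectors of weight
  at most 8 in the shadow, by the MacWilliams identities for the code and for the shadow (a coset of the
  dual of the doubly-even subcode). The light shadow vectors also lie over \<open>E\<close>: over \<open>0\<close> they form
  a coset of \<open>E\<close>, over each word of weight 8 there are none or two.
\<close>

section \<open>Binary words\<close>

text \<open>The words \<open>p\<close> are the pairs (b, a + b), the Gray image of the code modulo
  v. They depend only on the coefficients of 1 and u in \<open>L\<close>, which the fifteen codes
  share; the coefficients of v and uv enter only through \<open>h\<close>. As \<open>E\<close> is
  self-dual, the inner products of \<open>h\<close> with the words of \<open>E\<close> determine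
  \<open>h\<close> modulo \<open>E\<close>, and for a codeword over \<open>p\<close> they are a
  linear function of \<open>p\<close>, the syndrome \<open>syn p\<close>. Thus an enumeration of
  2^32 codewords is replaced by 620 syndrome tests per code. The 620 words are not searched for
  either: the MacWilliams identities for \<open>E\<close> fix their number, so any 620 distinct
  words of weight 8 in \<open>E\<close> are all of them. Let t and s be the numbers of shadow
  vectors of weight 4 and 8. With minimum distance at least 12 and no shadow vectors of weight 0, 2
  or 6, both weight enumerators are instances of one formula with \<beta> = s + 14 t: the form
  W_{64,1} is the case t = 1, the form W_{64,2} the case t = 0.\<close>

fun xr :: "bool list \<Rightarrow> bool list \<Rightarrow> bool list" where
  "xr (x # xs) (y # ys) = (x \<noteq> y) # xr xs ys"
| "xr _ _ = []"

fun par :: "bool list \<Rightarrow> bool list \<Rightarrow> bool" where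
  "par (x # xs) (y # ys) = ((x \<and> y) \<noteq> par xs ys)"
| "par _ _ = False"

primrec wt :: "bool list \<Rightarrow> nat" where
  "wt [] = 0"
| "wt (x # xs) = (if x then Suc (wt xs) else wt xs)"

definition words :: "nat \<Rightarrow> bool list set" where
  "words n = {xs. length xs = n}"

abbreviation zero :: "nat \<Rightarrow> bool list" where
  "zero n \<equiv> replicate n False"

lemma words_0 [simp]: "words 0 = {[]}"
  by (auto simp: words_def)

lemma words_Suc: "words (Suc n) = (#) True ` words n \<union> (#) False ` words n"
  by (auto simp: words_def length_Suc_conv image_iff)

lemma finite_words [simp]: "finite (words n)"
  by (induction n) (auto simp: words_Suc)

lemma card_words: "card (words n) = 2 ^ n"
proof (induction n)
  case (Suc n)
  have "card (words (Suc n)) = card ((#) True ` words n) + card ((#) False ` words n)"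
    unfolding words_Suc by (rule card_Un_disjoint) auto
  then show ?case using Suc by (simp add: card_image)
qed simp

lemma sum_words_Suc:
  "(\<Sum>y\<in>words (Suc n). f y) = (\<Sum>y\<in>words n. f (True # y)) + (\<Sum>y\<in>words n. f (False # y))"
  unfolding words_Suc
  by (subst sum.union_disjoint) (auto simp: sum.reindex)

lemma length_xr [simp]: "length (xr x y) = min (length x) (length y)"
  by (induction x y rule: xr.induct) auto

lemma xr_words: "x \<in> words n \<Longrightarrow> y \<in> words n \<Longrightarrow> xr x y \<in> words n"
  by (simp add: words_def)

lemma zero_words [simp]: "zero n \<in> words n"
  by (simp add: words_def)

lemma xr_commute: "xr x y = xr y x"
  by (induction x y rule: xr.induct) auto

lemma xr_assoc: "xr (xr x y) z = xr x (xr y z)"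
proof (induction x y arbitrary: z rule: xr.induct)
  case (1 x xs y ys)
  then show ?case by (cases z) auto
qed auto

lemma xr_zero [simp]:
  "length x = n \<Longrightarrow> xr x (zero n) = x" "length x = n \<Longrightarrow> xr (zero n) x = x"
  by (induction x arbitrary: n) auto

lemma xr_self [simp]: "xr x x = zero (length x)"
  by (induction x) auto

lemma xr_cancel [simp]: "length x = length y \<Longrightarrow> xr x (xr x y) = y"
  by (simp add: xr_assoc [symmetric])

lemma xr_append: "length x = length x' \<Longrightarrow> xr (x @ y) (x' @ y') = xr x x' @ xr y y'"
  by (induction x x' rule: xr.induct) auto

lemma xr_nth: "i < length x \<Longrightarrow> i < length y \<Longrightarrow> xr x y ! i = (x ! i \<noteq> y ! i)"
  by (induction x y arbitrary: i rule: xr.induct) (auto simp: nth_Cons')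

lemma xr_eq_zero_iff:
  "length x = length y \<Longrightarrow> xr x y = zero (length x) \<longleftrightarrow> x = y"
  by (induction x y rule: list_induct2) auto

lemma par_commute: "par x y = par y x"
  by (induction x y rule: par.induct) auto

lemma par_zero [simp]: "par (zero n) y = False" "par y (zero n) = False"
proof -
  show "par (zero n) y = False"
    by (induction n arbitrary: y) (simp, case_tac y, auto)
  then show "par y (zero n) = False" by (simp add: par_commute)
qed

lemma par_xr_left: "length x = length y \<Longrightarrow> par (xr x y) z = (par x z \<noteq> par y z)"
proof (induction x y arbitrary: z rule: list_induct2)
  case (Cons x xs y ys)
  then show ?case by (cases z) auto
qed simp

lemma par_xr_right: "length x = length y \<Longrightarrow> par z (xr x y) = (par z x \<noteq> par z y)"
  by (simp add: par_commute [of z] par_xr_left)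

lemma par_append: "length x = length x' \<Longrightarrow> par (x @ y) (x' @ y') = (par x x' \<noteq> par y y')"
  by (induction x x' rule: list_induct2) auto

lemma par_self: "par x x = odd (wt x)"
  by (induction x) auto

lemma wt_append [simp]: "wt (x @ y) = wt x + wt y"
  by (induction x) auto

lemma wt_zero [simp]: "wt (zero n) = 0"
  by (induction n) auto

lemma wt_le: "wt x \<le> length x"
  by (induction x) auto

lemma wt_eq_0_iff: "wt x = 0 \<longleftrightarrow> x = zero (length x)"
  by (induction x) auto

lemma wt_xr_True: "length x = n \<Longrightarrow> wt (xr x (replicate n True)) = n - wt x"
proof (induction x arbitrary: n)
  case (Cons a x)
  then show ?case using wt_le [of x] by (auto simp: Suc_diff_le)
qed simp

text \<open>The witness \<open>m\<close> is the number of common ones; stating the formula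
  additively avoids subtraction on \<open>nat\<close>.\<close>

lemma wt_xr_parity:
  "length x = length y \<Longrightarrow> \<exists>m. wt (xr x y) + 2 * m = wt x + wt y \<and> odd m = par x y"
proof (induction x y rule: list_induct2)
  case (Cons x xs y ys)
  then obtain m where m: "wt (xr xs ys) + 2 * m = wt xs + wt ys" "odd m = par xs ys"
    by blast
  show ?case
    by (rule exI [of _ "if x \<and> y then Suc m else m"]) (use m in auto)
qed simp

section \<open>The MacWilliams identity for codes and for cosets of their duals\<close>

definition sgn_of :: "bool \<Rightarrow> 'a::comm_ring_1" where
  "sgn_of b = (if b then - 1 else 1)"

lemma sgn_of_xor: "sgn_of (a \<noteq> b) = sgn_of a * sgn_of b"
  by (simp add: sgn_of_def)

text \<open>The sum factors over the coordinates: a position contributes 1 - z where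
  \<open>x\<close> has a one and 1 + z elsewhere. The induction splits off one factor at a
  time.\<close>

lemma character_sum:
  fixes z :: "'a::comm_ring_1"
  shows "(\<Sum>y\<in>words (length x). sgn_of (par x y) * z ^ wt y)
           = (1 - z) ^ wt x * (1 + z) ^ (length x - wt x)"
proof (induction x)
  case (Cons a x)
  let ?f = "\<lambda>y. sgn_of (par x y) * z ^ wt y"
  have "(\<Sum>y\<in>words (length (a # x)). sgn_of (par (a # x) y) * z ^ wt y)
      = sgn_of a * z * (\<Sum>y\<in>words (length x). ?f y) + (\<Sum>y\<in>words (length x). ?f y)"
    by (simp add: sum_words_Suc sum_distrib_left sgn_of_def if_distrib algebra_simps
        cong: if_cong sum.cong)
       (auto intro!: sum.cong simp: sum_negf [symmetric] simp del: sum_negf)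
  also have "\<dots> = (1 + sgn_of a * z) * ((1 - z) ^ wt x * (1 + z) ^ (length x - wt x))"
    by (simp only: Cons.IH distrib_right mult_1 add.commute)
  finally show ?case
    using wt_le [of x] by (auto simp: sgn_of_def Suc_diff_le algebra_simps)
qed (simp add: sgn_of_def)

definition wlinear :: "nat \<Rightarrow> bool list set \<Rightarrow> bool" where
  "wlinear n C \<longleftrightarrow> C \<subseteq> words n \<and> zero n \<in> C \<and> (\<forall>x\<in>C. \<forall>y\<in>C. xr x y \<in> C)"

definition additive_on :: "bool list set \<Rightarrow> (bool list \<Rightarrow> bool) \<Rightarrow> bool" where
  "additive_on C q \<longleftrightarrow> (\<forall>x\<in>C. \<forall>y\<in>C. q (xr x y) = (q x \<noteq> q y))"

text \<open>The vectors that realise the character (-1)^(q c) of \<open>C\<close> by inner products,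
  a coset of the dual code if there are any. The constant \<open>False\<close> gives the dual
  itself, \<open>half_odd\<close> gives the shadow; one MacWilliams identity therefore serves
  both.\<close>

definition wcoset :: "nat \<Rightarrow> bool list set \<Rightarrow> (bool list \<Rightarrow> bool) \<Rightarrow> bool list set" where
  "wcoset n C q = {y \<in> words n. \<forall>c\<in>C. par c y = q c}"

definition wdual :: "nat \<Rightarrow> bool list set \<Rightarrow> bool list set" where
  "wdual n C = wcoset n C (\<lambda>_. False)"

lemma wlinearD:
  assumes "wlinear n C"
  shows "C \<subseteq> words n" "finite C" "zero n \<in> C" "\<And>x y. x \<in> C \<Longrightarrow> y \<in> C \<Longrightarrow> xr x y \<in> C"
    "\<And>x. x \<in> C \<Longrightarrow> length x = n"
  using assms finite_subset [OF _ finite_words]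
  unfolding wlinear_def by (auto simp: words_def)

text \<open>If \<open>q d\<close> holds for some \<open>d\<close> in \<open>C\<close>, translation
  by \<open>d\<close> permutes \<open>C\<close> and flips every sign, so the sum equals its own
  negative.\<close>

lemma sum_signs:
  assumes C: "wlinear n C" and q: "additive_on C q"
  shows "(\<Sum>c\<in>C. sgn_of (q c)) = (if \<forall>c\<in>C. \<not> q c then of_nat (card C) else (0::int))"
proof (cases "\<forall>c\<in>C. \<not> q c")
  case False
  then obtain d where d: "d \<in> C" "q d" by blast
  let ?s = "\<Sum>c\<in>C. sgn_of (q c) :: int"
  have "bij_betw (xr d) C C"
    by (rule bij_betw_byWitness [where f' = "xr d"]) (use wlinearD [OF C] d in auto)
  then have "?s = (\<Sum>c\<in>C. sgn_of (q (xr d c)))"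
    by (rule sum.reindex_bij_betw [symmetric])
  also have "\<dots> = (\<Sum>c\<in>C. - sgn_of (q c))"
    using q d by (intro sum.cong) (auto simp: additive_on_def sgn_of_def)
  finally have "?s = 0" by (simp add: sum_negf)
  then show ?thesis using False by auto
qed (simp add: sgn_of_def)

text \<open>Double counting: the sum over all \<open>c\<close> in \<open>C\<close> and all words
  \<open>y\<close> of the signs of \<open>q c\<close> and \<open>par c y\<close> times z^(wt y) is
  evaluated in both orders. Summing over \<open>y\<close> first is \<open>character_sum\<close>;
  summing over \<open>c\<close> first is a character sum on \<open>C\<close>, which survives only
  for \<open>y\<close> in the coset.\<close>

theorem MacWilliams_coset:
  fixes z :: "'a::comm_ring_1"
  assumes C: "wlinear n C" and q: "additive_on C q"
  shows "(\<Sum>c\<in>C. sgn_of (q c) * ((1 - z) ^ wt c * (1 + z) ^ (n - wt c)))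
           = of_nat (card C) * (\<Sum>y\<in>wcoset n C q. z ^ wt y)"
proof -
  note CD = wlinearD [OF C]
  have sum_char: "(\<Sum>c\<in>C. sgn_of (q c) * sgn_of (par c y))
      = (if y \<in> wcoset n C q then of_nat (card C) else (0::'a))" if "y \<in> words n" for y
  proof -
    have "additive_on C (\<lambda>c. q c \<noteq> par c y)"
      using q CD(5) by (auto simp: additive_on_def par_xr_left)
    from sum_signs [OF C this]
    have "(\<Sum>c\<in>C. sgn_of (q c \<noteq> par c y)) = (if y \<in> wcoset n C q then of_nat (card C) else (0::int))"
      using that by (auto simp: wcoset_def)
    then have "of_int (\<Sum>c\<in>C. sgn_of (q c \<noteq> par c y))
        = (of_int (if y \<in> wcoset n C q then of_nat (card C) else 0) :: 'a)"
      by simp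
    moreover have "of_int (sgn_of b) = (sgn_of b :: 'a)" for b
      by (simp add: sgn_of_def)
    ultimately show ?thesis
      by (simp only: sgn_of_xor of_int_sum of_int_mult) (simp split: if_splits)
  qed
  have chars: "(\<Sum>y\<in>words n. sgn_of (par c y) * z ^ wt y) = (1 - z) ^ wt c * (1 + z) ^ (n - wt c)"
    if "c \<in> C" for c
    using character_sum [of c z] CD(5) [OF that] by simp
  have "(\<Sum>c\<in>C. sgn_of (q c) * ((1 - z) ^ wt c * (1 + z) ^ (n - wt c)))
      = (\<Sum>c\<in>C. sgn_of (q c) * (\<Sum>y\<in>words n. sgn_of (par c y) * z ^ wt y))"
    by (intro sum.cong refl) (simp only: chars)
  also have "\<dots> = (\<Sum>y\<in>words n. \<Sum>c\<in>C. sgn_of (q c) * sgn_of (par c y) * z ^ wt y)"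
    by (subst sum.swap) (simp add: sum_distrib_left mult.assoc)
  also have "\<dots> = (\<Sum>y\<in>words n. if y \<in> wcoset n C q then of_nat (card C) * z ^ wt y else 0)"
    by (intro sum.cong refl) (simp add: sum_char sum_distrib_right [symmetric])
  also have "\<dots> = (\<Sum>y\<in>wcoset n C q. of_nat (card C) * z ^ wt y)"
    by (intro sum.mono_neutral_cong_right) (auto simp: wcoset_def)
  finally show ?thesis by (simp add: sum_distrib_left)
qed

lemma additive_on_False [simp]: "additive_on C (\<lambda>_. False)"
  by (simp add: additive_on_def)

text \<open>At z = 1 the factor (1 - z)^(wt c) removes every codeword but zero, which contributes
  2^n.\<close>

lemma card_wdual:
  assumes C: "wlinear n C"
  shows "card C * card (wdual n C) = 2 ^ n"
proof -
  note CD = wlinearD [OF C]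
  have "(\<Sum>c\<in>C. (0::int) ^ wt c * 2 ^ (n - wt c)) = of_nat (card C) * of_nat (card (wdual n C))"
    using MacWilliams_coset [OF C additive_on_False, of "1::int"]
    by (simp add: sgn_of_def wdual_def)
  moreover have "(\<Sum>c\<in>C. (0::int) ^ wt c * 2 ^ (n - wt c)) = (\<Sum>c\<in>{zero n}. 2 ^ n)"
    using CD by (intro sum.mono_neutral_cong_right) (auto simp: wt_eq_0_iff)
  ultimately have "int (card C * card (wdual n C)) = int (2 ^ n)" by simp
  then show ?thesis by (simp only: of_nat_eq_iff)
qed

text \<open>The value K_k(w) of the binary Krawtchouk polynomial of length n, taken from its
  generating function.\<close>

definition kraw :: "nat \<Rightarrow> nat \<Rightarrow> nat \<Rightarrow> int" where
  "kraw n k w = coeff ([:1, -1:] ^ w * [:1, 1:] ^ (n - w)) k"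

lemma MacWilliams_coeff:
  assumes "wlinear n C" "additive_on C q"
  shows "(\<Sum>c\<in>C. sgn_of (q c) * kraw n k (wt c))
           = int (card C) * int (card {y \<in> wcoset n C q. wt y = k})"
proof -
  let ?z = "monom 1 1 :: int poly"
  have fin: "finite (wcoset n C q)"
    by (rule finite_subset [OF _ finite_words [of n]]) (auto simp: wcoset_def)
  have z: "1 - ?z = [:1, -1:]" "1 + ?z = [:1, 1:]"
    by (simp_all add: monom_altdef one_pCons)
  have s: "sgn_of b * p = Polynomial.smult (sgn_of b) p" for b and p :: "int poly"
    by (simp add: sgn_of_def)
  have "(\<Sum>c\<in>C. sgn_of (q c) * kraw n k (wt c))
      = coeff (\<Sum>c\<in>C. sgn_of (q c) * ((1 - ?z) ^ wt c * (1 + ?z) ^ (n - wt c))) k"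
    by (simp only: coeff_sum kraw_def z s coeff_smult)
  also have "\<dots> = coeff (of_nat (card C) * (\<Sum>y\<in>wcoset n C q. ?z ^ wt y)) k"
    by (subst MacWilliams_coset [OF assms]) rule
  also have "\<dots> = int (card C) * (\<Sum>y\<in>wcoset n C q. if wt y = k then 1 else 0)"
    by (simp add: of_nat_poly coeff_sum monom_power)
  also have "(\<Sum>y\<in>wcoset n C q. if wt y = k then 1 else (0::int)) = int (card {y \<in> wcoset n C q. wt y = k})"
    using fin by (simp add: sum.If_cases Int_def)
  finally show ?thesis .
qed

section \<open>Weight distributions of self-dual codes\<close>

definition wself_dual :: "nat \<Rightarrow> bool list set \<Rightarrow> bool" where
  "wself_dual n C \<longleftrightarrow> wlinear n C \<and> wdual n C = C"

definition half_odd :: "bool list \<Rightarrow> bool" where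
  "half_odd c \<longleftrightarrow> odd (wt c div 2)"

abbreviation wcount :: "bool list set \<Rightarrow> nat \<Rightarrow> int" where
  "wcount C k \<equiv> int (card {c \<in> C. wt c = k})"

lemma wself_dualD:
  assumes "wself_dual n C"
  shows "wlinear n C" "\<And>y. y \<in> C \<longleftrightarrow> length y = n \<and> (\<forall>c\<in>C. \<not> par c y)"
    "\<And>x y. x \<in> C \<Longrightarrow> y \<in> C \<Longrightarrow> \<not> par x y" "\<And>x. x \<in> C \<Longrightarrow> even (wt x)"
    "replicate n True \<in> C"
proof -
  show C: "wlinear n C" using assms by (simp add: wself_dual_def)
  show iff: "y \<in> C \<longleftrightarrow> length y = n \<and> (\<forall>c\<in>C. \<not> par c y)" for y
    using assms unfolding wself_dual_def wdual_def wcoset_def words_def by blast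
  show orth: "\<not> par x y" if "x \<in> C" "y \<in> C" for x y
    using that iff by blast
  show ev: "even (wt x)" if "x \<in> C" for x
    using orth [OF that that] by (simp add: par_self)
  have "par c (replicate n True) = odd (wt c)" if "length c = n" for c n
    using that by (induction c arbitrary: n) auto
  then show "replicate n True \<in> C"
    using ev wlinearD(5) [OF C] unfolding iff [of "replicate n True"] by auto
qed

lemma card_wself_dual:
  assumes "wself_dual (2 * m) C" shows "card C = 2 ^ m"
proof -
  have "card C * card C = 2 ^ m * 2 ^ m"
    using card_wdual [of "2 * m" C] assms
    by (simp add: wself_dual_def mult_2 power_add)
  then show ?thesis
    by (metis power2_eq_square power2_eq_iff_nonneg zero_le)
qed

text \<open>By orthogonality two codewords overlap in an even number of places, so the weight of the
  sum agrees with the sum of the weights modulo 4. The words on which \<open>half_odd\<close> fails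
  form the doubly-even subcode.\<close>

lemma additive_half_odd:
  assumes "wself_dual n C" shows "additive_on C half_odd"
  unfolding additive_on_def
proof (intro ballI)
  fix x y assume xy: "x \<in> C" "y \<in> C"
  note D = wself_dualD [OF assms]
  have "length x = length y" using xy D(2) by metis
  then obtain m where m: "wt (xr x y) + 2 * m = wt x + wt y" "odd m = par x y"
    using wt_xr_parity by blast
  have "even m" "even (wt x)" "even (wt y)" using D(3,4) xy m(2) by auto
  then obtain k a b where "m = 2 * k" "wt x = 2 * a" "wt y = 2 * b" by (auto elim!: evenE)
  with m have "wt (xr x y) = 2 * (a + b - 2 * k)" "2 * k \<le> a + b"
    by auto
  then show "half_odd (xr x y) = (half_odd x \<noteq> half_odd y)"
    using \<open>wt x = 2 * a\<close> \<open>wt y = 2 * b\<close> by (simp add: half_odd_def)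
qed

text \<open>Even weights put the all-ones word into the dual, hence into \<open>C\<close>; adding it
  is an involution of \<open>C\<close>.\<close>

lemma wcount_complement:
  assumes C: "wself_dual n C" and k: "k \<le> n"
  shows "wcount C (n - k) = wcount C k"
proof -
  note D = wself_dualD [OF C] and L = wlinearD [OF wself_dualD(1) [OF C]]
  let ?f = "\<lambda>c. xr c (replicate n True)"
  have inv: "?f (?f c) = c" if "c \<in> C" for c
    using L(5) [OF that] by (metis length_replicate xr_cancel xr_commute)
  have "bij_betw ?f {c \<in> C. wt c = k} {c \<in> C. wt c = n - k}"
    by (rule bij_betw_byWitness [where f' = ?f])
      (use inv L(4,5) D(5) k in \<open>auto simp: wt_xr_True\<close>)
  then show ?thesis by (simp add: bij_betw_same_card)
qed

lemma sum_by_weight: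
  assumes "finite C" "wt ` C \<subseteq> set ws" "distinct ws"
  shows "(\<Sum>c\<in>C. f (wt c)) = (\<Sum>w\<leftarrow>ws. wcount C w * (f w :: int))"
proof -
  have "(\<Sum>c\<in>C. f (wt c)) = (\<Sum>w\<in>set ws. \<Sum>c\<in>{c \<in> C. wt c = w}. f (wt c))"
    using assms(1,2) by (intro sum.group [symmetric]) auto
  also have "\<dots> = (\<Sum>w\<in>set ws. wcount C w * f w)"
    by (intro sum.cong) auto
  also have "\<dots> = (\<Sum>w\<leftarrow>ws. wcount C w * f w)"
    using assms(3) by (simp add: sum_list_distinct_conv_sum_set)
  finally show ?thesis .
qed

subsection \<open>Evaluating Krawtchouk polynomials\<close>

text \<open>Multiplication of a truncated coefficient list by 1 + c z; the argument \<open>p\<close>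
  carries the preceding coefficient, initially 0.\<close>

fun mulc :: "int \<Rightarrow> int \<Rightarrow> int list \<Rightarrow> int list" where
  "mulc c p (x # xs) = (x + c * p) # mulc c x xs"
| "mulc c p [] = []"

lemma length_mulc [simp]: "length (mulc c p xs) = length xs"
  by (induction c p xs rule: mulc.induct) auto

lemma mulc_nth:
  "i < length xs \<Longrightarrow> mulc c p xs ! i = xs ! i + c * (case i of 0 \<Rightarrow> p | Suc j \<Rightarrow> xs ! j)"
  by (induction c p xs arbitrary: i rule: mulc.induct) (auto split: nat.splits simp: nth_Cons')

lemma mulc_coeff:
  "map (coeff ([:1, c:] * p)) [0..<n] = mulc c 0 (map (coeff p) [0..<n])"
  by (rule nth_equalityI) (auto simp: mulc_nth coeff_pCons split: nat.splits)

primrec iter_mulc :: "nat \<Rightarrow> int \<Rightarrow> int list \<Rightarrow> int list" where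
  "iter_mulc 0 c xs = xs"
| "iter_mulc (Suc m) c xs = iter_mulc m c (mulc c 0 xs)"

lemma iter_mulc_coeff:
  "iter_mulc m c (map (coeff p) [0..<n]) = map (coeff ([:1, c:] ^ m * p)) [0..<n]"
proof (induction m arbitrary: p)
  case (Suc m)
  show ?case by (simp only: iter_mulc.simps mulc_coeff [symmetric] Suc power_Suc2 mult.assoc)
qed simp

text \<open>Eleven coefficients are kept because the identities are used up to degree 10
  only.\<close>

definition kraws :: "nat \<Rightarrow> nat \<Rightarrow> int list" where
  "kraws n w = iter_mulc w (-1) (iter_mulc (n - w) 1 [1, 0, 0, 0, 0, 0, 0, 0, 0, 0, 0])"

lemma kraw_kraws: "k < 11 \<Longrightarrow> kraw n k w = kraws n w ! k"
proof -
  assume k: "k < 11"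
  have "[1, 0, 0, 0, 0, 0, 0, 0, 0, 0, 0] = map (coeff (1 :: int poly)) [0..<11]"
    by (simp add: upt_rec)
  then have "kraws n w = map (coeff ([:1, -1:] ^ w * ([:1, 1:] ^ (n - w) * 1))) [0..<11]"
    by (simp only: kraws_def iter_mulc_coeff)
  then show ?thesis using k by (simp add: kraw_def)
qed

lemma kraws_64:
    "kraws 64 0 = [1, 64, 2016, 41664, 635376, 7624512, 74974368, 621216192, 4426165368, 27540584512, 151473214816]"
    "kraws 64 12 = [1, 40, 768, 9400, 82096, 542088, 2792960, 11390744, 36704760, 90990888, 158416896]"
    "kraws 64 14 = [1, 36, 616, 6636, 50176, 280308, 1180088, 3706428, 8123288, 9019108, -13021624]"
    "kraws 64 16 = [1, 32, 480, 4448, 28144, 125856, 389792, 721120, 58488, -4359136, -14276768]"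
    "kraws 64 18 = [1, 28, 360, 2772, 13824, 43596, 65208, -106620, -845928, -1956516, -741048]"
    "kraws 64 20 = [1, 24, 256, 1544, 5296, 6584, -26624, -146776, -247304, 270104, 2033152]"
    "kraws 64 22 = [1, 20, 168, 700, 896, -4956, -25480, -31028, 107160, 434644, 269192]"
    "kraws 64 24 = [1, 16, 96, 176, -784, -4656, -4576, 28784, 90744, -20976, -541728]"
    "kraws 64 26 = [1, 12, 40, -92, -896, -1028, 6904, 20500, -19304, -155572, -78584]"
    "kraws 64 28 = [1, 8, 0, -168, -336, 1512, 5376, -6600, -45576, 1288, 256256]"
    "kraws 64 30 = [1, 4, -24, -116, 256, 1620, -1480, -14500, 3480, 93380, 17864]"
    "kraws 64 32 = [1, 0, -32, 0, 496, 0, -4960, 0, 35960, 0, -201376]"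
    "kraws 64 34 = [1, -4, -24, 116, 256, -1620, -1480, 14500, 3480, -93380, 17864]"
    "kraws 64 36 = [1, -8, 0, 168, -336, -1512, 5376, 6600, -45576, -1288, 256256]"
    "kraws 64 38 = [1, -12, 40, 92, -896, 1028, 6904, -20500, -19304, 155572, -78584]"
    "kraws 64 40 = [1, -16, 96, -176, -784, 4656, -4576, -28784, 90744, 20976, -541728]"
    "kraws 64 42 = [1, -20, 168, -700, 896, 4956, -25480, 31028, 107160, -434644, 269192]"
    "kraws 64 44 = [1, -24, 256, -1544, 5296, -6584, -26624, 146776, -247304, -270104, 2033152]"
    "kraws 64 46 = [1, -28, 360, -2772, 13824, -43596, 65208, 106620, -845928, 1956516, -741048]"
    "kraws 64 48 = [1, -32, 480, -4448, 28144, -125856, 389792, -721120, 58488, 4359136, -14276768]"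
    "kraws 64 50 = [1, -36, 616, -6636, 50176, -280308, 1180088, -3706428, 8123288, -9019108, -13021624]"
    "kraws 64 52 = [1, -40, 768, -9400, 82096, -542088, 2792960, -11390744, 36704760, -90990888, 158416896]"
    "kraws 64 64 = [1, -64, 2016, -41664, 635376, -7624512, 74974368, -621216192, 4426165368, -27540584512, 151473214816]"
  by code_simp+

lemma kraws_32:
    "kraws 32 0 = [1, 32, 496, 4960, 35960, 201376, 906192, 3365856, 10518300, 28048800, 64512240]"
    "kraws 32 8 = [1, 16, 112, 432, 888, 336, -3248, -8720, -6884, 11984, 35696]"
    "kraws 32 12 = [1, 8, 16, -40, -200, -88, 816, 1272, -1380, -4760, -496]"
    "kraws 32 16 = [1, 0, -16, 0, 120, 0, -560, 0, 1820, 0, -4368]"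
    "kraws 32 20 = [1, -8, 16, 40, -200, 88, 816, -1272, -1380, 4760, -496]"
    "kraws 32 24 = [1, -16, 112, -432, 888, -336, -3248, 8720, -6884, -11984, 35696]"
    "kraws 32 32 = [1, -32, 496, -4960, 35960, -201376, 906192, -3365856, 10518300, -28048800, 64512240]"
  by code_simp+

text \<open>The multipliers below solve the linear system that eliminates all unknowns but one.\<close>

lemma solve_64:
  fixes a12 a14 a16 a18 a20 a22 a24 a26 a28 a30 a32 s t :: int
  assumes e: "2 + 2 * a12 + 2 * a14 + 2 * a16 + 2 * a18 + 2 * a20 + 2 * a22 + 2 * a24 + 2 * a26 + 2 * a28 + 2 * a30 + 1 * a32 = 4294967296"
    "4032 + 1536 * a12 + 1232 * a14 + 960 * a16 + 720 * a18 + 512 * a20 + 336 * a22 + 192 * a24 + 80 * a26 + 0 * a28 + (-48) * a30 + (-32) * a32 = 0"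
    "1270752 + 164192 * a12 + 100352 * a14 + 56288 * a16 + 27648 * a18 + 10592 * a20 + 1792 * a22 + (-1568) * a24 + (-1792) * a26 + (-672) * a28 + 512 * a30 + 496 * a32 = 0"
    "149948736 + 5585920 * a12 + 2360176 * a14 + 779584 * a16 + 130416 * a18 + (-53248) * a20 + (-50960) * a22 + (-9152) * a24 + 13808 * a26 + 10752 * a28 + (-2960) * a30 + (-4960) * a32 = 0"
    "8852330736 + 73409520 * a12 + 16246576 * a14 + 116976 * a16 + (-1691856) * a18 + (-494608) * a20 + 214320 * a22 + 181488 * a24 + (-38608) * a26 + (-91152) * a28 + 6960 * a30 + 35960 * a32 = 0"
    "302946429632 + 316833792 * a12 + (-26043248) * a14 + (-28553536) * a16 + (-1482096) * a18 + 4066304 * a20 + 538384 * a22 + (-1083456) * a24 + (-157168) * a26 + 512512 * a28 + 35728 * a30 + (-201376) * a32 = 0"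
    "2 + 2 * a12 + (-2) * a14 + 2 * a16 + (-2) * a18 + 2 * a20 + (-2) * a22 + 2 * a24 + (-2) * a26 + 2 * a28 + (-2) * a30 + 1 * a32 = 0"
    "4032 + 1536 * a12 + (-1232) * a14 + 960 * a16 + (-720) * a18 + 512 * a20 + (-336) * a22 + 192 * a24 + (-80) * a26 + 0 * a28 + 48 * a30 + (-32) * a32 = 0"
    "1270752 + 164192 * a12 + (-100352) * a14 + 56288 * a16 + (-27648) * a18 + 10592 * a20 + (-1792) * a22 + (-1568) * a24 + 1792 * a26 + (-672) * a28 + (-512) * a30 + 496 * a32 = 4294967296 * t"
    "149948736 + 5585920 * a12 + (-2360176) * a14 + 779584 * a16 + (-130416) * a18 + (-53248) * a20 + 50960 * a22 + (-9152) * a24 + (-13808) * a26 + 10752 * a28 + 2960 * a30 + (-4960) * a32 = 0"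
    "8852330736 + 73409520 * a12 + (-16246576) * a14 + 116976 * a16 + 1691856 * a18 + (-494608) * a20 + (-214320) * a22 + 181488 * a24 + 38608 * a26 + (-91152) * a28 + (-6960) * a30 + 35960 * a32 = 4294967296 * s"
  shows "a12 = 1312 + 16 * (s + 14 * t) \<and> a14 = 23040 - 64 * (s + 14 * t) - 1024 * t"
proof
  have "(416) * (2 + 2 * a12 + 2 * a14 + 2 * a16 + 2 * a18 + 2 * a20 + 2 * a22 + 2 * a24 + 2 * a26 + 2 * a28 + 2 * a30 + 1 * a32) + (170) * (4032 + 1536 * a12 + 1232 * a14 + 960 * a16 + 720 * a18 + 512 * a20 + 336 * a22 + 192 * a24 + 80 * a26 + 0 * a28 + (-48) * a30 + (-32) * a32) + (56) * (1270752 + 164192 * a12 + 100352 * a14 + 56288 * a16 + 27648 * a18 + 10592 * a20 + 1792 * a22 + (-1568) * a24 + (-1792) * a26 + (-672) * a28 + 512 * a30 + 496 * a32) + (19) * (149948736 + 5585920 * a12 + 2360176 * a14 + 779584 * a16 + 130416 * a18 + (-53248) * a20 + (-50960) * a22 + (-9152) * a24 + 13808 * a26 + 10752 * a28 + (-2960) * a30 + (-4960) * a32) + (4) * (8852330736 + 73409520 * a12 + 16246576 * a14 + 116976 * a16 + (-1691856) * a18 + (-494608) * a20 + 214320 * a22 + 181488 * a24 + (-38608) * a26 + (-91152) * a28 + 6960 * a30 + 35960 * a32) + (1) * (302946429632 + 316833792 * a12 + (-26043248) * a14 + (-28553536) * a16 + (-1482096) * a18 + 4066304 * a20 + 538384 *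 a22 + (-1083456) * a24 + (-157168) * a26 + 512512 * a28 + 35728 * a30 + (-201376) * a32) + (416) * (2 + 2 * a12 + (-2) * a14 + 2 * a16 + (-2) * a18 + 2 * a20 + (-2) * a22 + 2 * a24 + (-2) * a26 + 2 * a28 + (-2) * a30 + 1 * a32) + (104) * (4032 + 1536 * a12 + (-1232) * a14 + 960 * a16 + (-720) * a18 + 512 * a20 + (-336) * a22 + 192 * a24 + (-80) * a26 + 0 * a28 + 48 * a30 + (-32) * a32) + (56) * (1270752 + 164192 * a12 + (-100352) * a14 + 56288 * a16 + (-27648) * a18 + 10592 * a20 + (-1792) * a22 + (-1568) * a24 + 1792 * a26 + (-672) * a28 + (-512) * a30 + 496 * a32) + (8) * (149948736 + 5585920 * a12 + (-2360176) * a14 + 779584 * a16 + (-130416) * a18 + (-53248) * a20 + 50960 * a22 + (-9152) * a24 + (-13808) * a26 + 10752 * a28 + 2960 * a30 + (-4960) * a32) + (4) * (8852330736 + 73409520 * a12 + (-16246576) * a14 + 116976 * a16 + 1691856 * a18 + (-494608) * a20 + (-214320) * a22 + 181488 * a24 + 38608 * a26 + (-91152) * a28 + (-6960) * a30 + 35960 * a32)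
      = (416) * (4294967296) + (170) * (0) + (56) * (0) + (19) * (0) + (4) * (0) + (1) * (0) + (416) * (0) + (104) * (0) + (56) * (4294967296 * t) + (8) * (0) + (4) * (4294967296 * s)"
    by (simp only: e)
  then show "a12 = 1312 + 16 * (s + 14 * t)" by simp
  have "(360) * (2 + 2 * a12 + 2 * a14 + 2 * a16 + 2 * a18 + 2 * a20 + 2 * a22 + 2 * a24 + 2 * a26 + 2 * a28 + 2 * a30 + 1 * a32) + (110) * (4032 + 1536 * a12 + 1232 * a14 + 960 * a16 + 720 * a18 + 512 * a20 + 336 * a22 + 192 * a24 + 80 * a26 + 0 * a28 + (-48) * a30 + (-32) * a32) + (30) * (1270752 + 164192 * a12 + 100352 * a14 + 56288 * a16 + 27648 * a18 + 10592 * a20 + 1792 * a22 + (-1568) * a24 + (-1792) * a26 + (-672) * a28 + 512 * a30 + 496 * a32) + (6) * (149948736 + 5585920 * a12 + 2360176 * a14 + 779584 * a16 + 130416 * a18 + (-53248) * a20 + (-50960) * a22 + (-9152) * a24 + 13808 * a26 + 10752 * a28 + (-2960) * a30 + (-4960) * a32) + (1) * (8852330736 + 73409520 * a12 + 16246576 * a14 + 116976 * a16 + (-1691856) * a18 + (-494608) * a20 + 214320 * a22 + 181488 * a24 + (-38608) * a26 + (-91152) * a28 + 6960 * a30 + 35960 * a32) + (-360) * (2 + 2 * a12 + (-2) * a14 + 2 * a16 + (-2) * a18 + 2 * a20 + (-2) * a22 + 2 * a24 + (-2) * a26 + 2 * a28 + (-2) * a30 + 1 * a32) + (-110) * (4032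 + 1536 * a12 + (-1232) * a14 + 960 * a16 + (-720) * a18 + 512 * a20 + (-336) * a22 + 192 * a24 + (-80) * a26 + 0 * a28 + 48 * a30 + (-32) * a32) + (-30) * (1270752 + 164192 * a12 + (-100352) * a14 + 56288 * a16 + (-27648) * a18 + 10592 * a20 + (-1792) * a22 + (-1568) * a24 + 1792 * a26 + (-672) * a28 + (-512) * a30 + 496 * a32) + (-6) * (149948736 + 5585920 * a12 + (-2360176) * a14 + 779584 * a16 + (-130416) * a18 + (-53248) * a20 + 50960 * a22 + (-9152) * a24 + (-13808) * a26 + 10752 * a28 + 2960 * a30 + (-4960) * a32) + (-1) * (8852330736 + 73409520 * a12 + (-16246576) * a14 + 116976 * a16 + 1691856 * a18 + (-494608) * a20 + (-214320) * a22 + 181488 * a24 + 38608 * a26 + (-91152) * a28 + (-6960) * a30 + 35960 * a32)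
      = (360) * (4294967296) + (110) * (0) + (30) * (0) + (6) * (0) + (1) * (0) + (-360) * (0) + (-110) * (0) + (-30) * (4294967296 * t) + (-6) * (0) + (-1) * (4294967296 * s)"
    by (simp only: e)
  then show "a14 = 23040 - 64 * (s + 14 * t) - 1024 * t" by simp
qed

lemma MacWilliams_wself_dual:
  assumes C: "wself_dual n C" and ws: "wt ` C \<subseteq> set ws" "distinct ws"
  shows "(\<Sum>w\<leftarrow>ws. wcount C w * kraw n k w) = int (card C) * wcount C k"
    "(\<Sum>w\<leftarrow>ws. wcount C w * (sgn_of (odd (w div 2)) * kraw n k w))
       = int (card C) * wcount (wcoset n C half_odd) k"
proof -
  have lin: "wlinear n C" and fin: "finite C" and dual: "wcoset n C (\<lambda>_. False) = C"
    using C wlinearD(2) by (auto simp: wself_dual_def wdual_def)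
  show "(\<Sum>w\<leftarrow>ws. wcount C w * kraw n k w) = int (card C) * wcount C k"
    using MacWilliams_coeff [OF lin additive_on_False, of k]
    by (simp add: sum_by_weight [OF fin ws, symmetric] dual sgn_of_def)
  show "(\<Sum>w\<leftarrow>ws. wcount C w * (sgn_of (odd (w div 2)) * kraw n k w))
       = int (card C) * wcount (wcoset n C half_odd) k"
    using MacWilliams_coeff [OF lin additive_half_odd [OF C], of k]
    by (simp add: sum_by_weight [OF fin ws, of "\<lambda>w. sgn_of (odd (w div 2)) * kraw n k w", symmetric] half_odd_def)
qed

lemma wcount_zero:
  assumes "wlinear n C" shows "wcount C 0 = 1"
proof -
  have "{c \<in> C. wt c = 0} = {zero n}"
    using wlinearD(3,5) [OF assms] by (auto simp: wt_eq_0_iff)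
  then show ?thesis by simp
qed

text \<open>By complementation the unknowns are the eleven counts of even weights 12 to 32. In odd
  degrees the contributions of w and 64 - w cancel, so the equations come from even degrees: 0 to 10
  for the code itself and 0 to 8 for the shadow, eleven in all. The shadow counts \<open>t\<close>
  and \<open>s\<close> stay as parameters on the right-hand sides of degrees 4 and 8.\<close>

theorem weights_64:
  assumes C: "wself_dual 64 C" and d: "\<And>c. c \<in> C \<Longrightarrow> c \<noteq> zero 64 \<Longrightarrow> 12 \<le> wt c"
    and S: "\<And>k. k \<in> {0, 2, 6} \<Longrightarrow> wcount (wcoset 64 C half_odd) k = 0"
  defines "s \<equiv> wcount (wcoset 64 C half_odd) 8" and "t \<equiv> wcount (wcoset 64 C half_odd) 4"
  shows "wcount C 12 = 1312 + 16 * (s + 14 * t)"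
    "wcount C 14 = 23040 - 64 * (s + 14 * t) - 1024 * t"
proof -
  note D = wself_dualD [OF C] and L = wlinearD [OF wself_dualD(1) [OF C]]
  let ?ws = "[0, 12, 14, 16, 18, 20, 22, 24, 26, 28, 30, 32, 34, 36, 38, 40, 42, 44, 46, 48, 50, 52, 64] :: nat list"
  have ws: "wt c \<in> set ?ws" if c: "c \<in> C" for c
  proof -
    let ?c = "xr c (replicate 64 True)"
    have len: "length c = 64" using L(5) c .
    \<comment> \<open>The bound 12 applies to the complement as well, which bounds all remaining
      weights by 52.\<close>
    have "wt c = 0 \<or> wt c = 64 \<or> 12 \<le> wt c \<and> wt c \<le> 52"
    proof (cases "c = zero 64 \<or> ?c = zero 64")
      case True
      moreover have "wt ?c = 64 - wt c" "wt c \<le> 64"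
        using wt_xr_True [OF len] wt_le [of c] len by auto
      ultimately show ?thesis by (metis wt_zero diff_is_0_eq le_antisym)
    next
      case False
      then have "12 \<le> wt c" "12 \<le> wt ?c" using d c L(4) D(5) by auto
      then show ?thesis using wt_xr_True [OF len] by auto
    qed
    moreover obtain m where m: "wt c = 2 * m" using D(4) c by (auto elim!: evenE)
    ultimately have "m \<in> {0} \<union> ({6..<27} \<union> {32})" by auto
    then have "m \<in> set ([0] @ [6..<27] @ [32])"
      by (simp only: set_append set_upt list.set)
    then have "wt c \<in> set (map ((*) 2) ([0] @ [6..<27] @ [32]))"
      unfolding m set_map by (rule imageI)
    also have "map ((*) 2) ([0] @ [6..<27] @ [32]) = ?ws" by (simp add: upt_rec)
    finally show ?thesis .
  qed
  have dis: "distinct ?ws" by simp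
  have card: "int (card C) = 4294967296" using card_wself_dual [of 32 C] C by simp
  have low: "wcount C k = 0" if "k \<in> {2, 4, 6, 8, 10}" for k
  proof -
    have "{c \<in> C. wt c = k} = {}" using that ws by fastforce
    then show ?thesis by (simp only: card.empty of_nat_0)
  qed
  have sym: "wcount C 52 = wcount C 12" "wcount C 50 = wcount C 14" "wcount C 48 = wcount C 16"
    "wcount C 46 = wcount C 18" "wcount C 44 = wcount C 20" "wcount C 42 = wcount C 22"
    "wcount C 40 = wcount C 24" "wcount C 38 = wcount C 26" "wcount C 36 = wcount C 28"
    "wcount C 34 = wcount C 30" "wcount C 64 = 1"
    using wcount_complement [OF C, of 12] wcount_complement [OF C, of 14] wcount_complement [OF C, of 16]
      wcount_complement [OF C, of 18] wcount_complement [OF C, of 20] wcount_complement [OF C, of 22]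
      wcount_complement [OF C, of 24] wcount_complement [OF C, of 26] wcount_complement [OF C, of 28]
      wcount_complement [OF C, of 30] wcount_complement [OF C, of 0] wcount_zero [OF D(1)]
    by simp_all
  have img: "wt ` C \<subseteq> set ?ws" using ws by blast
  note M = MacWilliams_wself_dual [OF C img dis, unfolded card]
  note E = list.map sum_list.Cons sum_list.Nil kraw_kraws kraws_64 sym wcount_zero [OF D(1)]
    sgn_of_def low S s_def [symmetric] t_def [symmetric]
  have "wcount C 12 = 1312 + 16 * (s + 14 * t) \<and> wcount C 14 = 23040 - 64 * (s + 14 * t) - 1024 * t"
    apply (rule solve_64 [of _ _ "wcount C 16" "wcount C 18" "wcount C 20" "wcount C 22"
          "wcount C 24" "wcount C 26" "wcount C 28" "wcount C 30" "wcount C 32"])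
    subgoal using M(1) [of 0] by (simp add: E)
    subgoal using M(1) [of 2] by (simp add: E)
    subgoal using M(1) [of 4] by (simp add: E)
    subgoal using M(1) [of 6] by (simp add: E)
    subgoal using M(1) [of 8] by (simp add: E)
    subgoal using M(1) [of 10] by (simp add: E)
    subgoal using M(2) [of 0] by (simp add: E)
    subgoal using M(2) [of 2] by (simp add: E)
    subgoal using M(2) [of 4] by (simp add: E)
    subgoal using M(2) [of 6] by (simp add: E)
    subgoal using M(2) [of 8] by (simp add: E)
    done
  then show "wcount C 12 = 1312 + 16 * (s + 14 * t)"
    "wcount C 14 = 23040 - 64 * (s + 14 * t) - 1024 * t" by blast+
qed

text \<open>The only unknown counts are those of weights 8, 12 and 16: a word of weight 28 would
  have a complement of weight 4. Degrees 0, 2 and 4 determine them. The number 620 is what later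
  certifies that the list of light words is complete.\<close>

theorem weights_32:
  assumes C: "wself_dual 32 C" and d: "\<And>c. c \<in> C \<Longrightarrow> 4 dvd wt c" and A4: "\<And>c. c \<in> C \<Longrightarrow> wt c \<noteq> 4"
  shows "wcount C 8 = 620"
proof -
  note D = wself_dualD [OF C] and L = wlinearD [OF wself_dualD(1) [OF C]]
  let ?ws = "[0, 8, 12, 16, 20, 24, 32] :: nat list"
  have ws: "wt c \<in> set ?ws" if c: "c \<in> C" for c
  proof -
    have len: "length c = 32" using L(5) c .
    have "wt (xr c (replicate 32 True)) \<noteq> 4" using A4 L(4) D(5) c by blast
    then have "wt c \<noteq> 28" "wt c \<le> 32" using wt_xr_True [OF len] wt_le [of c] len by auto
    with d [OF c] A4 [OF c] show ?thesis by (auto elim!: dvdE)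
  qed
  have dis: "distinct ?ws" by simp
  have card: "int (card C) = 65536" using card_wself_dual [of 16 C] C by simp
  have low: "wcount C k = 0" if "k \<in> {2, 4}" for k
  proof -
    have "{c \<in> C. wt c = k} = {}" using that ws by fastforce
    then show ?thesis by (simp only: card.empty of_nat_0)
  qed
  have sym: "wcount C 24 = wcount C 8" "wcount C 20 = wcount C 12" "wcount C 32 = 1"
    using wcount_complement [OF C, of 8] wcount_complement [OF C, of 12]
      wcount_complement [OF C, of 0] wcount_zero [OF D(1)]
    by simp_all
  have img: "wt ` C \<subseteq> set ?ws" using ws by blast
  note M = MacWilliams_wself_dual(1) [OF C img dis, unfolded card]
  note E = list.map sum_list.Cons sum_list.Nil kraw_kraws kraws_32 sym wcount_zero [OF D(1)] low
  show ?thesis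
    using M [of 0] M [of 2] M [of 4] by (simp add: E)
qed

section \<open>Spans of lists of words\<close>

fun enc :: "nat \<Rightarrow> bool list list \<Rightarrow> bool list \<Rightarrow> bool list" where
  "enc n (g # G) (x # a) = (if x then xr g (enc n G a) else enc n G a)"
| "enc n _ _ = zero n"

definition wspan :: "nat \<Rightarrow> bool list list \<Rightarrow> bool list set" where
  "wspan n G = enc n G ` words (length G)"

lemma wlinear_words: "wlinear n (words n)"
  by (auto simp: wlinear_def words_def)

lemma enc_in:
  assumes "wlinear n C" "set G \<subseteq> C" shows "enc n G a \<in> C"
  using assms(2)
proof (induction G arbitrary: a)
  case (Cons g G)
  then show ?case by (cases a) (auto intro: wlinearD [OF assms(1)])
qed (auto intro: wlinearD [OF assms(1)])

lemma length_enc: "set G \<subseteq> words n \<Longrightarrow> length (enc n G a) = n"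
  using enc_in [OF wlinear_words, of G n a] by (simp add: words_def)

lemma additive_zero: "wlinear n C \<Longrightarrow> additive_on C f \<Longrightarrow> \<not> f (zero n)"
  using wlinearD(3) [of n C] unfolding additive_on_def
  by (metis length_replicate xr_self)

text \<open>An additive functional on a span is determined by its values on the generators. It is
  applied to inner products, to single coordinates and to \<open>half_odd\<close>.\<close>

lemma enc_additive:
  assumes C: "wlinear n C" and G: "set G \<subseteq> C" and f: "additive_on C f"
  shows "f (enc n G a) = par a (map f G)"
  using G
proof (induction G arbitrary: a)
  case (Cons g G)
  show ?case
  proof (cases a)
    case Nil
    then show ?thesis using additive_zero [OF C f] by simp
  next
    case a: (Cons x b)
    have "f (xr g (enc n G b)) = (f g \<noteq> f (enc n G b))"
      using f enc_in [OF C, of G b] Cons.prems unfolding additive_on_def by auto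
    with a Cons.IH [of b] Cons.prems show ?thesis by auto
  qed
qed (use additive_zero [OF C f] in auto)

lemma par_enc:
  assumes "set G \<subseteq> words n"
  shows "par (enc n G a) y = par a (map (\<lambda>g. par g y) G)"
proof (rule enc_additive [OF wlinear_words assms])
  show "additive_on (words n) (\<lambda>g. par g y)"
    by (simp add: additive_on_def words_def par_xr_left)
qed

lemma enc_xr:
  assumes "set G \<subseteq> words n" "length a = length b"
  shows "enc n G (xr a b) = xr (enc n G a) (enc n G b)"
  using assms(2,1)
proof (induction a b arbitrary: G rule: list_induct2)
  case (Cons x a y b)
  show ?case
  proof (cases G)
    case (Cons g G')
    have len: "length g = n" "length (enc n G' a) = n" "length (enc n G' b) = n"
      using Cons.prems Cons length_enc [of G' n] by (auto simp: words_def)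
    have IH: "enc n G' (xr a b) = xr (enc n G' a) (enc n G' b)"
      using Cons.IH Cons.prems Cons by auto
    have c: "xr g (xr (enc n G' a) (enc n G' b)) = xr (enc n G' a) (xr g (enc n G' b))"
      by (metis xr_assoc xr_commute)
    have "xr (xr g (enc n G' a)) (xr g (enc n G' b)) = xr g (xr g (xr (enc n G' a) (enc n G' b)))"
      by (metis xr_assoc xr_commute)
    also have "\<dots> = xr (enc n G' a) (enc n G' b)" using len by simp
    finally show ?thesis using IH c Cons by (auto simp: xr_assoc)
  qed simp
qed simp

lemma wlinear_wspan:
  assumes "set G \<subseteq> words n" shows "wlinear n (wspan n G)"
proof -
  have "enc n G (zero (length G)) = zero n"
    by (induction G) auto
  then have "zero n \<in> wspan n G" unfolding wspan_def by (metis zero_words image_eqI)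
  moreover have "xr (enc n G a) (enc n G b) \<in> wspan n G"
    if "a \<in> words (length G)" "b \<in> words (length G)" for a b
  proof -
    have "enc n G (xr a b) \<in> wspan n G"
      unfolding wspan_def by (rule imageI) (rule xr_words [OF that])
    then show ?thesis using enc_xr [OF assms, of a b] that by (simp add: words_def)
  qed
  ultimately show ?thesis
    using length_enc [OF assms] by (auto simp: wlinear_def wspan_def words_def)
qed

text \<open>The transposed generator list. Adding up the columns selected by a word of weight 8
  yields all its inner products with the generators at once.\<close>

fun columns :: "nat \<Rightarrow> bool list list \<Rightarrow> bool list list" where
  "columns n [] = replicate n []"
| "columns n (g # G) = map2 (#) g (columns n G)"

lemma length_columns: "set G \<subseteq> words n \<Longrightarrow> length (columns n G) = n"
  by (induction G) (auto simp: words_def)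

lemma enc_columns:
  assumes "set G \<subseteq> words n" "length e = n"
  shows "enc (length G) (columns n G) e = map (\<lambda>g. par g e) G"
  using assms(1)
proof (induction G)
  case Nil
  have "enc 0 (replicate n []) e = []" for n
    by (induction n arbitrary: e) (auto, case_tac e, auto)
  then show ?case by simp
next
  case (Cons g G)
  have "enc (Suc m) (map2 (#) g cs) e = par g e # enc m cs e"
    if "length g = length cs" "length cs = length e" for g cs m
    using that by (induction g cs e arbitrary: m rule: list_induct3) auto
  moreover have "length g = length (columns n G)" "length (columns n G) = length e"
    using Cons.prems assms(2) length_columns [of G n] by (auto simp: words_def)
  ultimately show ?case using Cons by auto
qed

section \<open>Sieving the positions\<close>

fun off :: "bool list \<Rightarrow> bool list \<Rightarrow> bool list" where
  "off (x # h) (y # p) = (x \<and> \<not> y) # off h p"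
| "off _ _ = []"

lemma wt_off: "length h = length p \<Longrightarrow> wt h + wt (xr h p) = wt p + 2 * wt (off h p)"
  by (induction h p rule: list_induct2) auto

lemma length_off [simp]: "length (off h p) = min (length h) (length p)"
  by (induction h p rule: off.induct) auto

fun disj :: "bool list \<Rightarrow> bool list \<Rightarrow> bool" where
  "disj (x # xs) (y # ys) = (\<not> (x \<and> y) \<and> disj xs ys)"
| "disj _ _ = True"

text \<open>As \<open>g\<close> vanishes on the support of \<open>p\<close>, it sees only the part
  of \<open>h\<close> outside \<open>p\<close>.\<close>

lemma par_disj: "length g = length p \<Longrightarrow> length p = length h \<Longrightarrow> disj p g \<Longrightarrow> par g h = par g (off h p)"
  by (induction g p h rule: list_induct3) auto

lemma disj_nth: "disj x y \<Longrightarrow> i < length x \<Longrightarrow> i < length y \<Longrightarrow> x ! i \<Longrightarrow> \<not> y ! i"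
  by (induction x y arbitrary: i rule: disj.induct) (auto simp: nth_Cons')

lemma par_singleton: "wt x = 1 \<Longrightarrow> \<exists>i<length x. \<forall>g. length g = length x \<longrightarrow> par g x = g ! i"
proof (induction x)
  case (Cons a x)
  show ?case
  proof (cases a)
    case True
    then have "x = zero (length x)" using Cons.prems by (simp add: wt_eq_0_iff)
    then obtain n where x: "x = zero n" by blast
    have "par g (a # x) = g ! 0" if "length g = length (a # x)" for g
      using that True unfolding x by (cases g) auto
    then show ?thesis by (intro exI [of _ 0]) auto
  next
    case False
    then obtain i where i: "i < length x" "\<forall>g. length g = length x \<longrightarrow> par g x = g ! i"
      using Cons by auto
    have "par g (a # x) = g ! Suc i" if "length g = length (a # x)" for g
      using that False i by (cases g) auto
    then show ?thesis using i by (intro exI [of _ "Suc i"]) auto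
  qed
qed simp

fun narrow :: "bool \<Rightarrow> bool list \<Rightarrow> bool list \<Rightarrow> bool list" where
  "narrow b (x # m) (y # g) = (x \<and> y = b) # narrow b m g"
| "narrow b _ _ = []"

text \<open>The mask \<open>m\<close> marks the positions still possible for the single entry of
  \<open>h\<close> outside \<open>p\<close>. Each pair is a word \<open>g\<close> of
  \<open>E\<close> disjoint from \<open>p\<close> with its information digits \<open>a\<close>; the
  entry must be at a position where \<open>g\<close> has the value \<open>par a r\<close>,
  \<open>r\<close> being the syndrome. Success means that no position is left.\<close>

fun sieve :: "bool list \<Rightarrow> bool list \<Rightarrow> (bool list \<times> bool list) list \<Rightarrow> bool" where
  "sieve r m [] = (True \<notin> set m)"
| "sieve r m ((a, g) # ags) = (True \<notin> set m \<or> sieve r (narrow (par a r) m g) ags)"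

lemma length_narrow [simp]: "length (narrow b m g) = min (length m) (length g)"
  by (induction b m g rule: narrow.induct) auto

lemma narrow_nth:
  "i < length m \<Longrightarrow> i < length g \<Longrightarrow> narrow b m g ! i \<longleftrightarrow> m ! i \<and> g ! i = b"
  by (induction b m g arbitrary: i rule: narrow.induct) (auto simp: nth_Cons')

text \<open>A marked position on which all pairs agree with the syndrome is never unmarked, while a
  successful sieve ends with an empty mask.\<close>

lemma sieve_sound:
  assumes "sieve r m ags" "i < length m" "m ! i" "\<And>a g. (a, g) \<in> set ags \<Longrightarrow> i < length g"
  shows "\<exists>(a, g)\<in>set ags. par a r \<noteq> g ! i"
  using assms
proof (induction r m ags rule: sieve.induct)
  case (1 r m)
  then show ?case by (auto simp: in_set_conv_nth)
next
  case (2 r m a g ags)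
  have g: "i < length g" using 2(5) by auto
  note mn = narrow_nth [OF 2(3) g, of "par a r"]
  have "True \<in> set m" using 2(3,4) by (auto simp: in_set_conv_nth)
  then have "sieve r (narrow (par a r) m g) ags" "True \<in> set m" using 2(2) by auto
  then show ?case
    using 2(1) mn g 2(3,4,5) by (cases "par a r = g ! i") auto
qed

definition hits :: "bool list \<Rightarrow> (bool list \<times> bool list) list \<Rightarrow> bool" where
  "hits r ags \<longleftrightarrow> (\<exists>(a, g)\<in>set ags. par a r)"

section \<open>Codes of length 64 over a code of length 32\<close>

definition lift_word :: "bool list \<Rightarrow> bool list \<Rightarrow> bool list" where
  "lift_word h p = h @ xr h p"

lemma length_lift_word: "length h = n \<Longrightarrow> length p = n \<Longrightarrow> length (lift_word h p) = 2 * n"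
  by (simp add: lift_word_def)

lemma lift_word_cases:
  assumes "length c = 2 * n"
  obtains h p where "c = lift_word h p" "length h = n" "length p = n"
proof
  show "c = lift_word (take n c) (xr (take n c) (drop n c))"
    using assms by (simp add: lift_word_def)
qed (use assms in auto)

lemma lift_word_eq_iff:
  "length h = n \<Longrightarrow> length p = n \<Longrightarrow> length h' = n \<Longrightarrow> length p' = n \<Longrightarrow>
     lift_word h p = lift_word h' p' \<longleftrightarrow> h = h' \<and> p = p'"
  unfolding lift_word_def by (metis append_eq_append_conv xr_cancel)

lemma lift_word_zero: "length h = n \<Longrightarrow> lift_word h (zero n) = h @ h"
  by (simp add: lift_word_def)

lemma xr_xr_xr: "xr (xr a b) (xr c d) = xr (xr a c) (xr b d)"
  by (metis xr_assoc xr_commute)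

lemma xr_lift_word:
  "length h = n \<Longrightarrow> length p = n \<Longrightarrow> length h' = n \<Longrightarrow> length p' = n \<Longrightarrow>
     xr (lift_word h p) (lift_word h' p') = lift_word (xr h h') (xr p p')"
  by (simp add: lift_word_def xr_append xr_xr_xr)

text \<open>The products of \<open>k\<close> and \<open>h\<close> from the two halves cancel. Inside
  \<open>E\<close> the last term vanishes too, which leaves a bilinear pairing of upper words with
  lower words.\<close>

lemma par_lift_word:
  assumes "length k = n" "length g = n" "length h = n" "length p = n"
  shows "par (lift_word k g) (lift_word h p) = ((par k p \<noteq> par g h) \<noteq> par g p)"
proof -
  have "par (xr k g) (xr h p) = ((par k h \<noteq> par k p) \<noteq> (par g h \<noteq> par g p))"
    using assms by (auto simp: par_xr_left par_xr_right)
  then show ?thesis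
    using assms by (auto simp: lift_word_def par_append)
qed

lemma wt_lift_word:
  "length h = length p \<Longrightarrow> wt (lift_word h p) = wt p + 2 * wt (off h p)"
  using wt_off [of h p] by (simp add: lift_word_def)

lemma enc_lift_word:
  assumes "length K = length G" "set G \<subseteq> words n" "set K \<subseteq> words n"
  shows "enc (2 * n) (map2 lift_word K G) a = lift_word (enc n K a) (enc n G a)"
  using assms
proof (induction K G arbitrary: a rule: list_induct2)
  case (Cons k K g G)
  show ?case
  proof (cases a)
    case (Cons x b)
    have "length k = n" "length g = n" "length (enc n K b) = n" "length (enc n G b) = n"
      using Cons.prems length_enc [of K n b] length_enc [of G n b] by (auto simp: words_def)
    then show ?thesis using Cons Cons.IH [of b] Cons.prems by (simp add: xr_lift_word)
  qed (simp add: lift_word_def replicate_add [symmetric] mult_2)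
qed (simp add: lift_word_def replicate_add [symmetric] mult_2)

lemma enc_double:
  assumes "set G \<subseteq> words n"
  shows "enc (2 * n) (map (\<lambda>g. g @ g) G) a = enc n G a @ enc n G a"
  using assms
proof (induction G arbitrary: a)
  case (Cons g G)
  then show ?case
    using length_enc [of G n] by (cases a) (auto simp: xr_append mult_2 replicate_add words_def)
qed (simp add: mult_2 replicate_add)

lemma off_zero_xr:
  "length h = n \<Longrightarrow> length h' = n \<Longrightarrow> length p = n \<Longrightarrow> off h p = zero n \<Longrightarrow> off h' p = zero n \<Longrightarrow>
     off (xr h h') p = zero n"
proof (induction h h' arbitrary: p n rule: xr.induct)
  case (1 x xs y ys)
  then show ?case by (cases p; cases n) auto
qed auto

lemma off_self: "off p p = zero (length p)"
  by (induction p) auto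

lemma generators_in_wspan:
  assumes "set G \<subseteq> words n" shows "set G \<subseteq> wspan n G"
  using assms
proof (induction G)
  case (Cons g G)
  have z: "enc n G (zero (length G)) = zero n"
    by (induction G) auto
  have "g = enc n (g # G) (True # zero (length G))"
    using Cons.prems z by (simp add: words_def)
  then have "g \<in> wspan n (g # G)"
    unfolding wspan_def by (rule image_eqI) (simp add: words_def)
  moreover have "wspan n G \<subseteq> wspan n (g # G)"
  proof
    fix y assume "y \<in> wspan n G"
    then obtain a where "a \<in> words (length G)" "y = enc n (g # G) (False # a)"
      by (auto simp: wspan_def)
    then show "y \<in> wspan n (g # G)"
      unfolding wspan_def by (intro image_eqI [of _ _ "False # a"]) (auto simp: words_def)
  qed
  ultimately show ?case using Cons by auto
qed simp

text \<open>What is needed of a Gray image: each generator of \<open>E\<close> in \<open>G\<close>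
  has a codeword over it, with upper word in \<open>K\<close>, and the doubled words of
  \<open>E\<close> lie over 0. Self-duality of \<open>C\<close> does the work of a generating set:
  it says which upper words occur over a given \<open>p\<close>.\<close>

locale lifted_code =
  fixes G K :: "bool list list" and C :: "bool list set"
  assumes G: "length G = 16" "set G \<subseteq> words 32"
    and K: "length K = 16" "set K \<subseteq> words 32"
    and E: "wself_dual 32 (wspan 32 G)"
    and E4: "\<And>e. e \<in> wspan 32 G \<Longrightarrow> 4 dvd wt e" and E_not4: "\<And>e. e \<in> wspan 32 G \<Longrightarrow> wt e \<noteq> 4"
    and C: "wself_dual 64 C"
    and lifts: "set (map2 lift_word K G) \<subseteq> C"
    and doubles: "\<And>g. g \<in> set G \<Longrightarrow> g @ g \<in> C"
begin

abbreviation E where "E \<equiv> wspan 32 G"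
abbreviation S where "S \<equiv> wcoset 64 C half_odd"

definition q :: "bool list" where "q = map half_odd (map2 lift_word K G)"

text \<open>As a functional of the information digits \<open>a\<close>, this is the inner product of
  \<open>p\<close> with the upper word \<open>enc 32 K a\<close>.\<close>

definition syn :: "bool list \<Rightarrow> bool list" where "syn p = map (\<lambda>k. par k p) K"

lemmas ED = wself_dualD [OF E] and CD = wself_dualD [OF C]
lemmas EL = wlinearD [OF ED(1)] and CL = wlinearD [OF CD(1)]

lemma length_q: "length q = 16"
  by (simp add: q_def G K)

lemma length_syn: "length (syn p) = 16"
  by (simp add: syn_def K)

lemma length_encG: "length (enc 32 G a) = 32"
  using G(2) by (rule length_enc)

lemma length_encK: "length (enc 32 K a) = 32"
  using K(2) by (rule length_enc)

lemma encG_E: "a \<in> words 16 \<Longrightarrow> enc 32 G a \<in> E"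
  unfolding wspan_def G(1) by (rule imageI)

lemma E_cases:
  assumes "e \<in> E" obtains a where "a \<in> words 16" "e = enc 32 G a"
  using assms G(1) by (auto simp: wspan_def)

lemma E_weights: "e \<in> E \<Longrightarrow> wt e = 0 \<or> wt e = 8 \<or> 12 \<le> wt e"
  using E4 [of e] E_not4 [of e] by (auto elim!: dvdE)

lemma double_in_C:
  assumes "e \<in> E" shows "e @ e \<in> C"
proof -
  obtain a where "e = enc 32 G a" using assms by (rule E_cases)
  then show ?thesis
    using enc_double [OF G(2), of a] enc_in [OF CD(1), of "map (\<lambda>g. g @ g) G" a] doubles by auto
qed

lemma half_odd_double: "e \<in> E \<Longrightarrow> \<not> half_odd (e @ e)"
  using ED(4) [of e] by (auto simp: half_odd_def)

lemma lift_in_C: "lift_word (enc 32 K a) (enc 32 G a) \<in> C"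
  using enc_lift_word [of K G 32 a] G K enc_in [OF CD(1) lifts, of a] by auto

lemma half_odd_lift: "half_odd (lift_word (enc 32 K a) (enc 32 G a)) = par a q"
  using enc_additive [OF CD(1) lifts additive_half_odd [OF C], of a] enc_lift_word [of K G 32 a] G K
  by (auto simp: q_def)

lemma par_encK: "par (enc 32 K a) p = par a (syn p)"
  unfolding syn_def using K(2) by (rule par_enc)

lemma par_double_lift:
  "length e = 32 \<Longrightarrow> length h = 32 \<Longrightarrow> length p = 32 \<Longrightarrow> par (e @ e) (lift_word h p) = par e p"
  by (auto simp: lift_word_def par_append par_xr_right)

text \<open>Orthogonality to the doubled words \<open>e @ e\<close> places \<open>p\<close> in the
  dual of \<open>E\<close>, which is \<open>E\<close>.\<close>

lemma base_C:
  assumes "lift_word h p \<in> C" "length h = 32" "length p = 32" shows "p \<in> E"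
  unfolding ED(2) [of p]
  using CD(3) [OF double_in_C assms(1)] par_double_lift assms EL(5) by auto

text \<open>A doubled word of \<open>E\<close> has weight 2 \<open>wt e\<close> with
  \<open>wt e\<close> even, so it belongs to the doubly-even subcode; the shadow is orthogonal to it
  just as the code is.\<close>

lemma base_S:
  assumes "lift_word h p \<in> S" "length h = 32" "length p = 32" shows "p \<in> E"
  unfolding ED(2) [of p]
proof (intro conjI ballI)
  fix e assume e: "e \<in> E"
  have "par (e @ e) (lift_word h p) = half_odd (e @ e)"
    using assms(1) double_in_C [OF e] by (auto simp: wcoset_def)
  then show "\<not> par e p" using half_odd_double [OF e] par_double_lift assms EL(5) [OF e] by auto
qed (rule assms)

lemma par_lift_enc:
  assumes "length h = 32" "p \<in> E" "a \<in> words 16"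
  shows "par (lift_word (enc 32 K a) (enc 32 G a)) (lift_word h p) = (par a (syn p) \<noteq> par (enc 32 G a) h)"
  using par_lift_word [OF length_encK length_encG assms(1) EL(5) [OF assms(2)]]
    ED(3) [OF encG_E [OF assms(3)] assms(2)] by (auto simp: par_encK)

text \<open>Orthogonality to the lifted words prescribes the inner products of \<open>h\<close> with
  all of \<open>E\<close>. This is the relation that the sieve exploits.\<close>

lemma key_C:
  assumes "lift_word h p \<in> C" "length h = 32" "length p = 32" "a \<in> words 16"
  shows "par a (syn p) = par (enc 32 G a) h"
  using CD(3) [OF lift_in_C assms(1)] par_lift_enc [OF assms(2) base_C [OF assms(1-3)] assms(4)]
  by auto

lemma key_S:
  assumes "lift_word h p \<in> S" "length h = 32" "length p = 32" "a \<in> words 16"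
  shows "(par a (syn p) \<noteq> par (enc 32 G a) h) = par a q"
proof -
  have "par (lift_word (enc 32 K a) (enc 32 G a)) (lift_word h p) = par a q"
    using assms(1) lift_in_C [of a] half_odd_lift [of a] by (auto simp: wcoset_def)
  then show ?thesis using par_lift_enc [OF assms(2) base_S [OF assms(1-3)] assms(4)] by simp
qed

lemma E_I: "length h = 32 \<Longrightarrow> (\<And>a. a \<in> words 16 \<Longrightarrow> \<not> par (enc 32 G a) h) \<Longrightarrow> h \<in> E"
  unfolding ED(2) [of h] using E_cases by metis

lemma syn_zero: "par a (syn (zero 32)) = False"
  by (simp add: par_encK [symmetric])

lemma C_fibre: "h @ h \<in> C \<Longrightarrow> length h = 32 \<Longrightarrow> h \<in> E"
  using E_I [of h] key_C [of h "zero 32"] by (auto simp: lift_word_zero syn_zero)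

text \<open>Converse of \<open>key_S\<close>: both sides of the shadow condition are additive on
  \<open>C\<close>, and every codeword is a lifted word plus a doubled word of \<open>E\<close>, so
  checking these two kinds of words is enough.\<close>

lemma S_I:
  assumes h: "length h = 32" and p: "p \<in> E"
    and s: "xr (syn p) (map (\<lambda>g. par g h) G) = q"
  shows "lift_word h p \<in> S"
proof -
  have lp: "length p = 32" using EL(5) p .
  have "par c (lift_word h p) = half_odd c" if c: "c \<in> C" for c
  proof -
    obtain h' p' where c': "c = lift_word h' p'" "length h' = 32" "length p' = 32"
      using lift_word_cases [of c 32] CL(5) [OF c] by auto
    then have "p' \<in> E" using base_C c by blast
    then obtain a where a: "a \<in> words 16" "p' = enc 32 G a" by (rule E_cases)
    let ?l = "lift_word (enc 32 K a) (enc 32 G a)" and ?d = "xr h' (enc 32 K a)"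
    \<comment> \<open>Subtracting the lifted word over the same base leaves a codeword over 0, that
      is, a doubled word.\<close>
    have "xr c ?l = lift_word ?d (zero 32)"
      using c' a(2) by (simp add: xr_lift_word length_encK length_encG)
    then have d: "xr c ?l = ?d @ ?d" "length ?d = 32"
      using c' by (simp_all add: lift_word_zero length_encK)
    have "?d @ ?d \<in> C" using CL(4) [OF c lift_in_C, of a] d(1) by simp
    then have dE: "?d \<in> E" using C_fibre d(2) by blast
    have l: "length c = 64" "length ?l = 64" using c CL(5) lift_in_C by blast+
    have "par (xr c ?l) (lift_word h p) = half_odd (xr c ?l)"
      unfolding d(1) using half_odd_double [OF dE] par_double_lift [OF d(2) h lp] ED(3) [OF dE p] by simp
    then have "(par c (lift_word h p) \<noteq> par ?l (lift_word h p)) = (half_odd c \<noteq> half_odd ?l)"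
      using par_xr_left [of c ?l] l additive_half_odd [OF C] c lift_in_C [of a]
      by (simp add: additive_on_def)
    moreover have "par ?l (lift_word h p) = half_odd ?l"
      unfolding par_lift_enc [OF h p a(1)] half_odd_lift s [symmetric]
      using par_enc [OF G(2), of a h] G(1) K(1) par_xr_right [of "syn p" "map (\<lambda>g. par g h) G" a]
      by (auto simp: length_syn)
    ultimately show ?thesis by blast
  qed
  moreover have "length (lift_word h p) = 64"
    using length_lift_word [OF h lp] by simp
  ultimately show ?thesis by (auto simp: wcoset_def words_def)
qed

section \<open>Excluding codewords of weight below 12\<close>

definition sep :: "bool list \<Rightarrow> bool list \<Rightarrow> bool list \<Rightarrow> bool" where
  "sep p a g \<longleftrightarrow> a \<in> words 16 \<and> g = enc 32 G a \<and> disj p g"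

lemma sep_par:
  assumes "sep p a g" "length p = 32" "length h = 32"
  shows "par (enc 32 G a) h = par g (off h p)" "length g = 32"
  using assms par_disj [of g p h] length_encG by (auto simp: sep_def)

lemma min_weight:
  assumes chk: "\<And>p. p \<in> E \<Longrightarrow> wt p = 8 \<Longrightarrow> \<exists>ags. (\<forall>(a, g)\<in>set ags. sep p a g) \<and>
      sieve (syn p) (replicate 32 True) ags"
    and c: "c \<in> C" "c \<noteq> zero 64"
  shows "12 \<le> wt c"
proof (rule ccontr)
  assume "\<not> 12 \<le> wt c"
  moreover have "even (wt c)" using CD(4) c(1) .
  ultimately have w: "wt c \<le> 10" by (auto elim!: evenE)
  obtain h p where hp: "c = lift_word h p" "length h = 32" "length p = 32"
    using lift_word_cases [of c 32] CL(5) [OF c(1)] by auto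
  have pE: "p \<in> E" using base_C c(1) hp by blast
  have wt: "wt c = wt p + 2 * wt (off h p)" using hp wt_lift_word by simp
  consider "wt p = 0" | "wt p = 8" using E_weights [OF pE] w wt by linarith
  then show False
  proof cases
    case 1
    then have p: "p = zero 32" using hp by (simp add: wt_eq_0_iff)
    then have hh: "c = h @ h" using hp by (simp add: lift_word_zero)
    then have "h \<in> E" using C_fibre c(1) hp by blast
    then have "wt h = 0" using E_weights [of h] w hh by auto
    then have "h = zero 32" using hp by (simp add: wt_eq_0_iff)
    then show False using hh c(2) by (simp add: replicate_add [symmetric])
  next
    case 2
    then obtain ags where ags: "\<And>a g. (a, g) \<in> set ags \<Longrightarrow> sep p a g"
      "sieve (syn p) (replicate 32 True) ags" using chk [OF pE] by blast
    \<comment> \<open>Both cases take the same form. If \<open>h\<close> has no entry outside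
      \<open>p\<close>, any position \<open>i\<close> in the support of \<open>p\<close> serves: a
      word disjoint from \<open>p\<close> is 0 there, as is its inner product with the empty part.
      Hence one sieve over all 32 positions covers both cases.\<close>
    have "\<exists>i<32. \<forall>g. length g = 32 \<and> disj p g \<longrightarrow> par g (off h p) = g ! i"
    proof (cases "wt (off h p) = 0")
      case True
      then have z: "off h p = zero 32" using hp by (simp add: wt_eq_0_iff)
      have "\<exists>i<32. p ! i"
      proof (rule ccontr)
        assume "\<not> (\<exists>i<32. p ! i)"
        then have "p = zero 32" using hp(3) by (auto intro!: nth_equalityI)
        then show False using 2 by simp
      qed
      then show ?thesis using z disj_nth [of p] hp(3) by auto
    next
      case False
      then have "wt (off h p) = 1" using w wt 2 by linarith
      then show ?thesis using par_singleton [of "off h p"] hp by auto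
    qed
    then obtain i where i: "i < 32" "\<And>g. length g = 32 \<Longrightarrow> disj p g \<Longrightarrow> par g (off h p) = g ! i"
      by blast
    have len: "i < length g" if "(a, g) \<in> set ags" for a g
      using sep_par(2) [OF ags(1) [OF that] hp(3,2)] i(1) by simp
    have "\<exists>(a, g)\<in>set ags. par a (syn p) \<noteq> g ! i"
      using sieve_sound [OF ags(2)] i(1) len by auto
    moreover have "par a (syn p) = g ! i" if ag: "(a, g) \<in> set ags" for a g
      using key_C [OF c(1) [unfolded hp(1)] hp(2,3)] sep_par [OF ags(1) [OF ag] hp(3,2)] i(2) ags(1) [OF ag]
      by (auto simp: sep_def)
    ultimately show False by auto
  qed
qed

section \<open>Light vectors of the shadow\<close>

lemma S_fibre_iff:
  assumes x: "length x = 32" and y: "length y = 32" "y @ y \<in> S"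
  shows "x @ x \<in> S \<longleftrightarrow> xr y x \<in> E"
proof
  assume "x @ x \<in> S"
  then have "par (enc 32 G a) x = par (enc 32 G a) y" if "a \<in> words 16" for a
    using key_S [of x "zero 32" a] key_S [of y "zero 32" a] x y that by (auto simp: lift_word_zero syn_zero)
  then show "xr y x \<in> E" using x y(1) by (intro E_I) (auto simp: par_xr_right)
next
  assume e: "xr y x \<in> E"
  have "x @ x = xr (y @ y) (xr y x @ xr y x)" using x y(1) by (simp add: xr_append)
  moreover have "par c (xr y x @ xr y x) = False" "length c = 64" if "c \<in> C" for c
    using CD(3) [OF that double_in_C [OF e]] CL(5) [OF that] by auto
  ultimately have "par c (x @ x) = par c (y @ y)" if "c \<in> C" for c
    using that x y(1) by (simp add: par_xr_right)
  then show "x @ x \<in> S" using y x by (auto simp: wcoset_def words_def)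
qed

text \<open>The word \<open>x1\<close> represents the shadow over 0; \<open>sh\<close> gives one
  upper word \<open>h\<close> inside \<open>p\<close> for each \<open>p\<close> of weight 8 that
  carries shadow vectors of weight 8. Every other \<open>p\<close> of weight 8 is refuted by
  \<open>kill\<close>: for \<open>h\<close> inside \<open>p\<close> and \<open>g\<close> disjoint
  from \<open>p\<close> the product of \<open>g\<close> and \<open>h\<close> is 0, so the shadow
  condition would force \<open>par a (syn p) = par a q\<close>.\<close>

context
  fixes x1 :: "bool list" and sh :: "(bool list \<times> bool list) list"
  assumes x1: "length x1 = 32" "map (\<lambda>g. par g x1) G = q" "wt x1 = 2 \<or> wt x1 = 4"
    and sh: "\<And>p h. (p, h) \<in> set sh \<Longrightarrow> p \<in> E \<and> wt p = 8 \<and> length h = 32 \<and> off h p = zero 32 \<and>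
      xr (syn p) (map (\<lambda>g. par g h) G) = q"
    and sh_distinct: "distinct (map fst sh)"
    and kill: "\<And>p. p \<in> E \<Longrightarrow> wt p = 8 \<Longrightarrow> p \<notin> fst ` set sh \<Longrightarrow>
      \<exists>a g. sep p a g \<and> par a (xr (syn p) q)"
begin

lemma x1_S: "x1 @ x1 \<in> S"
proof -
  have "syn (zero 32) = zero 16"
    unfolding syn_def by (rule nth_equalityI) (auto simp: K)
  then show ?thesis
    using S_I [OF x1(1), of "zero 32"] EL(3) x1(2) length_q by (simp add: lift_word_zero x1(1))
qed

text \<open>Two members of the coset differ by a word of \<open>E\<close>, here of weight at most 8,
  hence 0 or 8. Weight 8 requires both members to have weight 4 and disjoint supports.\<close>

lemma light_fibre:
  assumes x: "length x = 32" "x @ x \<in> S" "wt x \<le> 4"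
  shows "x = x1 \<or> wt x = 4 \<and> wt x1 = 4 \<and> wt (xr x1 x) = 8"
proof -
  have e: "xr x1 x \<in> E" using S_fibre_iff [OF x(1) x1(1) x1_S] x(2) by simp
  obtain m where m: "wt (xr x1 x) + 2 * m = wt x1 + wt x" using wt_xr_parity [of x1 x] x(1) x1(1) by auto
  have "wt (xr x1 x) = 0 \<or> wt (xr x1 x) = 8" using E_weights [OF e] m x(3) x1(3) by auto
  then show ?thesis
  proof
    assume "wt (xr x1 x) = 0"
    then have "x1 = x" using xr_eq_zero_iff [of x1 x] x(1) x1(1) by (simp add: wt_eq_0_iff)
    then show ?thesis by simp
  qed (use m x(3) x1(3) in auto)
qed

lemma light_S:
  assumes s: "s \<in> S" "wt s \<le> 8"
  obtains (fibre) x where "s = x @ x" "length x = 32" "wt s = 2 * wt x"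
  | (eight) p h where "s = lift_word h p" "p \<in> E" "wt p = 8" "length h = 32" "off h p = zero 32" "wt s = 8"
proof -
  have "length s = 64" using s(1) by (auto simp: wcoset_def words_def)
  then obtain h p where hp: "s = lift_word h p" "length h = 32" "length p = 32"
    using lift_word_cases [of s 32] by auto
  have pE: "p \<in> E" using base_S s(1) hp by blast
  have w: "wt s = wt p + 2 * wt (off h p)" using hp wt_lift_word by simp
  consider "wt p = 0" | "wt p = 8" "wt (off h p) = 0" using E_weights [OF pE] w s(2) by linarith
  then show thesis
  proof cases
    case 1
    then have "p = zero 32" using hp by (simp add: wt_eq_0_iff)
    then have "s = h @ h" using hp by (simp add: lift_word_zero)
    then show thesis using fibre hp by simp
  next
    case 2
    then have "off h p = zero 32" using hp by (simp add: wt_eq_0_iff)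
    then show thesis using eight hp pE 2 w by simp
  qed
qed

lemma shadow_small:
  assumes "k \<in> {0, 2, 6}" shows "wcount S k = 0"
proof -
  have "wt s \<noteq> k" if "s \<in> S" for s
  proof
    assume k: "wt s = k"
    with assms have "wt s \<le> 8" by auto
    from that this show False
    proof (cases rule: light_S)
      case (fibre x)
      then show False using light_fibre [of x] that k assms x1(3) by auto
    qed (use k assms in auto)
  qed
  then have "{s \<in> S. wt s = k} = {}" by blast
  then show ?thesis by (simp only: card.empty of_nat_0)
qed

lemma shadow_four: "wcount S 4 = (if wt x1 = 2 then 1 else 0)"
proof -
  have only: "s = x1 @ x1 \<and> wt x1 = 2" if "s \<in> S" "wt s = 4" for s
  proof -
    have "wt s \<le> 8" using that by simp
    from that(1) this show ?thesis
    proof (cases rule: light_S)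
      case (fibre x)
      then show ?thesis using light_fibre [of x] that by auto
    qed (use that in auto)
  qed
  show ?thesis
  proof (cases "wt x1 = 2")
    case True
    then have "x1 @ x1 \<in> {s \<in> S. wt s = 4}" using x1_S by simp
    then have "{s \<in> S. wt s = 4} = {x1 @ x1}" using only by blast
    then show ?thesis using True by simp
  next
    case False
    then have "{s \<in> S. wt s = 4} = {}" using only by blast
    then show ?thesis using False by (simp only: card.empty of_nat_0 if_False)
  qed
qed

text \<open>Over each listed \<open>p\<close> there are two vectors, (h, h + p) and (h + p, h),
  exchanged by swapping the halves.\<close>

definition pairs :: "bool list set" where
  "pairs = (\<lambda>((p, h), b). lift_word (if b then xr h p else h) p) ` (set sh \<times> UNIV)"

lemma card_pairs: "card pairs = 2 * length sh"
proof -
  have lp: "length p = 32" "length h = 32" "xr h p \<noteq> h" if "(p, h) \<in> set sh" for p h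
  proof -
    show l: "length p = 32" "length h = 32" using sh [OF that] EL(5) by auto
    show "xr h p \<noteq> h"
    proof
      assume "xr h p = h"
      then have "p = zero 32" using xr_cancel [of h p] l by simp
      then show False using sh [OF that] by simp
    qed
  qed
  have "inj_on (\<lambda>((p, h), b). lift_word (if b then xr h p else h) p) (set sh \<times> UNIV)"
  proof (rule inj_onI, clarsimp simp del: if_split)
    fix p h b p' h' b'
    assume 1: "(p, h) \<in> set sh" and 2: "(p', h') \<in> set sh"
      and eq: "lift_word (if b then xr h p else h) p = lift_word (if b' then xr h' p' else h') p'"
    have "(if b then xr h p else h) = (if b' then xr h' p' else h')" and p: "p = p'"
      using eq lp(1,2) [OF 1] lp(1,2) [OF 2] by (auto simp: lift_word_eq_iff [of _ 32])
    moreover have "h = h'" using sh_distinct 1 2 p by (metis eq_key_imp_eq_value)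
    ultimately show "p = p' \<and> h = h' \<and> b = b'" using lp(3) [OF 1] by (auto split: if_splits)
  qed
  then have "card pairs = card (set sh \<times> (UNIV :: bool set))"
    unfolding pairs_def by (rule card_image)
  also have "\<dots> = length sh * 2"
    using distinct_card [of sh] sh_distinct by (simp add: card_cartesian_product distinct_map)
  finally show ?thesis by simp
qed

lemma pairs_S:
  assumes "s \<in> pairs" obtains p h where "s = lift_word h p" "s \<in> S" "wt s = 8" "wt p = 8" "length h = 32" "length p = 32"
proof -
  obtain p h b where s: "(p, h) \<in> set sh" "s = lift_word (if b then xr h p else h) p"
    using assms by (auto simp: pairs_def)
  have p: "p \<in> E" "wt p = 8" "length h = 32" "off h p = zero 32" "length p = 32"
    "xr (syn p) (map (\<lambda>g. par g h) G) = q" using sh [OF s(1)] EL(5) by auto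
  let ?h = "if b then xr h p else h"
  have "par g (xr h p) = par g h" if "g \<in> set G" for g
    using ED(3) [OF subsetD [OF generators_in_wspan [OF G(2)] that] p(1)] p(3,5)
    by (simp add: par_xr_right)
  then have eq: "map (\<lambda>g. par g ?h) G = map (\<lambda>g. par g h) G" by auto
  have h: "length ?h = 32" using p by simp
  have "s \<in> S"
    unfolding s(2) by (rule S_I [OF h p(1)]) (unfold eq, rule p(6))
  moreover have "off ?h p = zero 32"
    using p off_zero_xr [of h 32 p p] off_self [of p] by auto
  then have "wt s = 8" using wt_lift_word [of ?h p] h p s(2) by simp
  ultimately show thesis using that [of ?h p] s(2) p h by blast
qed

text \<open>A shadow vector of weight 8 is a double of a coset vector of weight 4, or lies over a
  word of weight 8 with upper word inside it. The second kind is exactly \<open>pairs\<close>; the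
  first kind exists only if \<open>x1\<close> has weight 4.\<close>

lemma shadow_eight:
  "wcount S 8 = (if wt x1 = 2 then 0 else 1 + int (card {e \<in> E. wt e = 8 \<and> off x1 e = zero 32})) + 2 * int (length sh)"
proof -
  let ?X = "{x. length x = 32 \<and> x @ x \<in> S \<and> wt x = 4}" and ?dbl = "\<lambda>x :: bool list. x @ x"
  let ?F = "{e \<in> E. wt e = 8 \<and> off x1 e = zero 32}"
  have "{s \<in> S. wt s = 8} = ?dbl ` ?X \<union> pairs"
  proof (intro equalityI subsetI)
    fix s assume "s \<in> {s \<in> S. wt s = 8}"
    then have s: "s \<in> S" "wt s = 8" "wt s \<le> 8" by auto
    from s(1,3) show "s \<in> ?dbl ` ?X \<union> pairs"
    proof (cases rule: light_S)
      case (fibre x)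
      then show ?thesis using s by auto
    next
      case (eight p h)
      have lp: "length p = 32" using EL(5) eight(2) .
      have par0: "par (enc 32 G a) h = False" if "sep p a g" for a g
        using sep_par [OF that lp eight(4)] eight(5) by simp
      have "p \<in> fst ` set sh"
      proof (rule ccontr)
        assume "p \<notin> fst ` set sh"
        then obtain a g where ag: "sep p a g" "par a (xr (syn p) q)" using kill eight(2,3) by blast
        then have "a \<in> words 16" by (simp add: sep_def)
        from key_S [OF s(1) [unfolded eight(1)] eight(4) lp this] par0 [OF ag(1)] ag(2)
        show False by (simp add: par_xr_right length_q length_syn)
      qed
      then obtain h0 where h0: "(p, h0) \<in> set sh" by auto
      have sh0: "length h0 = 32" "off h0 p = zero 32" "lift_word h0 p \<in> S"
        using sh [OF h0] S_I [of h0 p] by auto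
      let ?d = "xr h0 h"
      have "par (enc 32 G a) h = par (enc 32 G a) h0" if "a \<in> words 16" for a
        using key_S [OF s(1) [unfolded eight(1)] eight(4) lp that] key_S [OF sh0(3,1) lp that] by auto
      then have dE: "?d \<in> E" using sh0(1) eight(4) by (intro E_I) (auto simp: par_xr_right)
      have "off ?d p = zero 32" using off_zero_xr sh0 eight(4,5) lp by blast
      \<comment> \<open>The difference \<open>?d\<close> is a word of \<open>E\<close> inside
        \<open>p\<close>, so it shares the weight 8 with its complement in \<open>p\<close>; as
        \<open>E\<close> has no nonzero word of weight below 8, it is 0 or \<open>p\<close>.\<close>
      then have d: "wt ?d + wt (xr ?d p) = 8" using wt_off [of ?d p] sh0(1) eight(3,4) lp by simp
      have "h = h0 \<or> h = xr h0 p"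
      proof -
        consider "wt ?d = 0" | "wt (xr ?d p) = 0" using E_weights [OF dE] d by linarith
        then show ?thesis
        proof cases
          case 1
          then show ?thesis using xr_eq_zero_iff [of h0 h] sh0(1) eight(4) by (simp add: wt_eq_0_iff)
        next
          case 2
          then have "?d = p" using xr_eq_zero_iff [of ?d p] sh0(1) eight(4) lp by (simp add: wt_eq_0_iff)
          then show ?thesis using xr_cancel [of h0 h] sh0(1) eight(4) by auto
        qed
      qed
      then have "s = lift_word (if h \<noteq> h0 then xr h0 p else h0) p" using eight(1) by auto
      then have "s \<in> pairs" unfolding pairs_def using h0 by (intro image_eqI [of _ _ "((p, h0), h \<noteq> h0)"]) auto
      then show ?thesis by blast
    qed
  next
    fix s assume "s \<in> ?dbl ` ?X \<union> pairs"
    then show "s \<in> {s \<in> S. wt s = 8}" using pairs_S by auto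
  qed
  moreover have "?dbl ` ?X \<inter> pairs = {}"
  proof -
    have "x @ x \<notin> pairs" if "length x = 32" for x
    proof
      assume "x @ x \<in> pairs"
      then obtain p h where "x @ x = lift_word h p" "wt p = 8" "length h = 32" "length p = 32"
        by (rule pairs_S)
      moreover from this have "p = zero 32"
        using that lift_word_eq_iff [of x 32 "zero 32" h p] by (simp add: lift_word_zero)
      ultimately show False by simp
    qed
    then show ?thesis by auto
  qed
  moreover have fin: "finite ?X"
    by (rule finite_subset [OF _ finite_words [of 32]]) (auto simp: words_def)
  moreover have "finite pairs" by (simp add: pairs_def)
  ultimately have "card {s \<in> S. wt s = 8} = card (?dbl ` ?X) + 2 * length sh"
    using card_Un_disjoint [of "?dbl ` ?X" pairs] by (simp add: card_pairs)
  moreover have "card (?dbl ` ?X) = card ?X"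
    by (rule card_image) (auto simp: inj_on_def)
  moreover have "card ?X = (if wt x1 = 2 then 0 else 1 + card ?F)"
  proof (cases "wt x1 = 2")
    case True
    then have "?X = {}" using light_fibre by auto
    then show ?thesis using True by (simp only: card.empty refl if_True)
  next
    case False
    then have w1: "wt x1 = 4" using x1(3) by simp
    \<comment> \<open>The other coset vectors of weight 4 are \<open>x1\<close> plus a word
      \<open>e\<close> of weight 8 that covers the support of \<open>x1\<close>.\<close>
    have "?X = insert x1 (xr x1 ` ?F)"
    proof (intro equalityI subsetI)
      fix x assume "x \<in> ?X"
      then have x: "length x = 32" "x @ x \<in> S" "wt x = 4" by auto
      show "x \<in> insert x1 (xr x1 ` ?F)"
      proof (cases "x = x1")
        case False
        then have w: "wt (xr x1 x) = 8" using light_fibre [OF x(1,2)] x(3) by simp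
        have xx: "xr x1 (xr x1 x) = x" using x(1) x1(1) by simp
        have "wt (off x1 (xr x1 x)) = 0" using wt_off [of x1 "xr x1 x"] x x1(1) w w1 by simp
        then have "off x1 (xr x1 x) = zero 32" using x(1) x1(1) by (simp add: wt_eq_0_iff)
        then have "xr x1 x \<in> ?F" using S_fibre_iff [OF x(1) x1(1) x1_S] x(2) w by simp
        then have "xr x1 (xr x1 x) \<in> xr x1 ` ?F" by (rule imageI)
        then show ?thesis unfolding xx by (rule insertI2)
      qed simp
    next
      fix x assume "x \<in> insert x1 (xr x1 ` ?F)"
      then consider "x = x1" | e where "x = xr x1 e" "e \<in> E" "wt e = 8" "off x1 e = zero 32" by auto
      then show "x \<in> ?X"
      proof cases
        case 2
        have le: "length e = 32" using EL(5) 2(2) .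
        have "wt x = 4" using wt_off [of x1 e] 2 le x1(1) w1 by simp
        then show ?thesis using 2 S_fibre_iff [of x x1] x1(1) x1_S le by simp
      qed (use x1 x1_S w1 in auto)
    qed
    moreover have "x1 \<notin> xr x1 ` ?F"
    proof
      assume "x1 \<in> xr x1 ` ?F"
      then obtain e where e: "x1 = xr x1 e" "e \<in> E" "wt e = 8" by auto
      have "e = zero 32" using xr_cancel [of x1 e] e EL(5) x1(1) by simp
      then show False using e(3) by simp
    qed
    moreover have "finite ?F" using EL(2) by simp
    moreover have "inj_on (xr x1) ?F"
      by (rule inj_on_inverseI [of _ "xr x1"]) (use EL(5) x1(1) in auto)
    ultimately show ?thesis using False by (simp add: card_image)
  qed
  ultimately show ?thesis by auto
qed

end

end

section \<open>Words as bit vectors\<close>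

definition bl :: "bit vec \<Rightarrow> bool list" where
  "bl v = map (\<lambda>i. v $ i \<noteq> 0) [0..<dim_vec v]"

lemma length_bl [simp]: "length (bl v) = dim_vec v"
  by (simp add: bl_def)

lemma bl_nth [simp]: "i < dim_vec v \<Longrightarrow> bl v ! i = (v $ i \<noteq> 0)"
  by (simp add: bl_def)

lemma bl_words: "v \<in> carrier_vec n \<Longrightarrow> bl v \<in> words n"
  by (auto simp: words_def)

lemma bit_add_neq_0 [simp]: "(x + y \<noteq> (0::bit)) = ((x \<noteq> 0) \<noteq> (y \<noteq> 0))"
  by (cases x; cases y) auto

lemma bl_add: "dim_vec v = dim_vec w \<Longrightarrow> bl (v + w) = xr (bl v) (bl w)"
  by (rule nth_equalityI) (simp_all add: xr_nth)

lemma bl_zero [simp]: "bl (0\<^sub>v n) = zero n"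
  by (rule nth_equalityI) auto

lemma bl_append: "bl (v @\<^sub>v w) = bl v @ bl w"
  by (rule nth_equalityI) (auto simp: nth_append)

lemma bl_inject: "dim_vec v = dim_vec w \<Longrightarrow> bl v = bl w \<longleftrightarrow> v = w"
proof
  assume d: "dim_vec v = dim_vec w" and e: "bl v = bl w"
  show "v = w"
  proof (rule eq_vecI)
    fix i assume "i < dim_vec w"
    with d e have "(v $ i \<noteq> 0) = (w $ i \<noteq> 0)" by (metis bl_nth)
    then show "v $ i = w $ i" by (cases "v $ i"; cases "w $ i") auto
  qed (rule d)
qed simp

lemma bl_surj: "length xs = n \<Longrightarrow> \<exists>v\<in>carrier_vec n. bl v = xs"
  by (rule bexI [of _ "vec n (\<lambda>i. of_bool (xs ! i))"]) (auto intro!: nth_equalityI)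

lemma weight_bl: "weight v = wt (bl v)"
proof -
  have "wt xs = card {i. i < length xs \<and> xs ! i}" for xs
  proof (induction xs)
    case (Cons x xs)
    have "{i. i < length (x # xs) \<and> (x # xs) ! i} = (if x then {0} else {}) \<union> Suc ` {i. i < length xs \<and> xs ! i}"
      by (auto simp: nth_Cons' image_iff split: if_splits) (metis Suc_pred less_Suc_eq_0_disj not_less_eq)+
    moreover have "card ((if x then {0} else {}) \<union> Suc ` {i. i < length xs \<and> xs ! i})
        = (if x then 1 else 0) + card {i. i < length xs \<and> xs ! i}"
      by (subst card_Un_disjoint) (auto simp: card_image)
    ultimately show ?case using Cons by simp
  qed simp
  then show ?thesis
    unfolding weight_def by (metis (mono_tags, lifting) bl_nth length_bl Collect_cong)
qed

lemma scalar_prod_bl: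
  assumes "dim_vec v = dim_vec w" shows "v \<bullet> w = of_bool (par (bl v) (bl w))"
proof -
  have "(\<Sum>i<length xs. of_bool (xs ! i) * of_bool (ys ! i)) = (of_bool (par xs ys) :: bit)"
    if "length xs = length ys" for xs ys
    using that
  proof (induction xs ys rule: list_induct2)
    case (Cons x xs y ys)
    then show ?case by (simp add: sum.lessThan_Suc_shift del: sum.lessThan_Suc)
  qed simp
  from this [of "bl v" "bl w"] assms
  have "(\<Sum>i<dim_vec w. of_bool (bl v ! i) * of_bool (bl w ! i)) = (of_bool (par (bl v) (bl w)) :: bit)"
    by simp
  moreover have "(\<Sum>i<dim_vec w. of_bool (bl v ! i) * of_bool (bl w ! i)) = (\<Sum>i<dim_vec w. v $ i * w $ i)"
    using assms by (intro sum.cong) (auto simp del: bit_not_zero_iff intro: bit.exhaust)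
  ultimately show ?thesis by (simp add: scalar_prod_def lessThan_atLeast0)
qed

lemma hamming_dist_weight:
  assumes "dim_vec x = dim_vec y" shows "hamming_dist x y = weight (x + y)"
proof -
  have "(x $ i \<noteq> y $ i) = ((x + y) $ i \<noteq> 0)" if "i < dim_vec x" for i
    using that assms by (cases "x $ i"; cases "y $ i") auto
  then have "{i. i < dim_vec x \<and> x $ i \<noteq> y $ i} = {i. i < dim_vec (x + y) \<and> (x + y) $ i \<noteq> 0}"
    using assms by auto
  then show ?thesis by (simp only: hamming_dist_def weight_def)
qed

text \<open>Orthogonality gives one inclusion; the two sizes multiply to 2^(2m), so a code with at
  least 2^m words fills its dual.\<close>

lemma wself_dualI:
  assumes C: "wlinear (2 * m) C" and orth: "\<And>x y. x \<in> C \<Longrightarrow> y \<in> C \<Longrightarrow> \<not> par x y"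
    and card: "2 ^ m \<le> card C"
  shows "wself_dual (2 * m) C"
proof -
  have sub: "C \<subseteq> wdual (2 * m) C"
    using wlinearD(1) [OF C] orth by (auto simp: wdual_def wcoset_def)
  have fin: "finite (wdual (2 * m) C)"
    by (rule finite_subset [OF _ finite_words [of "2 * m"]]) (auto simp: wdual_def wcoset_def)
  have "2 ^ m * card (wdual (2 * m) C) \<le> card C * card (wdual (2 * m) C)"
    using card by simp
  also have "\<dots> = 2 ^ m * 2 ^ m" using card_wdual [OF C] by (simp add: mult_2 power_add)
  finally have "card (wdual (2 * m) C) \<le> card C" using card by simp
  then have "C = wdual (2 * m) C" using card_seteq [OF fin sub] by simp
  then show ?thesis using C by (simp add: wself_dual_def)
qed

section \<open>Duality, distance, weight counts and dimension for bit vectors\<close>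

lemma self_dual_bl:
  assumes V: "V \<subseteq> carrier_vec n" and C: "wself_dual n (bl ` V)"
  shows "self_dual n V"
proof -
  note D = wself_dualD [OF C] and L = wlinearD [OF wself_dualD(1) [OF C]]
  have mem: "x \<in> V \<longleftrightarrow> bl x \<in> bl ` V" if "x \<in> carrier_vec n" for x
    using that V bl_inject by fastforce
  have add: "x + y \<in> V" if "x \<in> V" "y \<in> V" for x y
  proof -
    have xy: "x \<in> carrier_vec n" "y \<in> carrier_vec n" using that V by auto
    then have "bl (x + y) \<in> bl ` V" using L(4) that by (simp add: bl_add)
    then show ?thesis using mem [of "x + y"] xy by simp
  qed
  have zero: "0\<^sub>v n \<in> V" using L(3) mem [of "0\<^sub>v n"] by simp
  have "linear_code n V"
    unfolding linear_code_iff
  proof (intro conjI allI ballI)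
    fix a :: bit and x assume x: "x \<in> V"
    then have xc: "x \<in> carrier_vec n" using V by auto
    have "a = 0 \<or> a = 1" by (cases a) auto
    then show "a \<cdot>\<^sub>v x \<in> V"
    proof
      assume "a = 0"
      then have "a \<cdot>\<^sub>v x = 0\<^sub>v n" using xc by (intro eq_vecI) auto
      then show ?thesis using zero by simp
    qed (use x xc in simp)
  qed (use V add zero in auto)
  moreover have "x \<in> V \<longleftrightarrow> x \<in> dual_code n V" for x
  proof (cases "x \<in> carrier_vec n")
    case True
    have "x \<in> V \<longleftrightarrow> (\<forall>y\<in>V. \<not> par (bl y) (bl x))"
      using mem [OF True] D(2) [of "bl x"] True by auto
    also have "\<dots> \<longleftrightarrow> (\<forall>y\<in>V. x \<bullet> y = 0)"
    proof (rule ball_cong)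
      fix y assume "y \<in> V"
      then have "x \<bullet> y = of_bool (par (bl y) (bl x))"
        using scalar_prod_bl [of x y] V True by (auto simp: par_commute)
      then show "(\<not> par (bl y) (bl x)) = (x \<bullet> y = 0)" by simp
    qed simp
    finally show ?thesis using True by (simp add: dual_code_def)
  qed (use V in \<open>auto simp: dual_code_def\<close>)
  ultimately show ?thesis unfolding self_dual_def by blast
qed

lemma min_distance_bl:
  assumes V: "V \<subseteq> carrier_vec n" and C: "wlinear n (bl ` V)"
    and c: "c \<in> bl ` V" "wt c = d" "0 < d"
    and min: "\<And>c. c \<in> bl ` V \<Longrightarrow> c \<noteq> zero n \<Longrightarrow> d \<le> wt c"
  shows "min_distance V = d"
proof -
  note L = wlinearD [OF C]
  let ?H = "{hamming_dist x y | x y. x \<in> V \<and> y \<in> V \<and> x \<noteq> y}"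
  have H: "hamming_dist x y = wt (xr (bl x) (bl y))" if "x \<in> V" "y \<in> V" for x y
  proof -
    have "dim_vec x = dim_vec y" using that V by (metis carrier_vecD subsetD)
    then show ?thesis by (simp add: hamming_dist_weight weight_bl bl_add)
  qed
  have "?H \<subseteq> {..n}"
  proof
    fix k assume "k \<in> ?H"
    then obtain x y where xy: "x \<in> V" "y \<in> V" "k = hamming_dist x y" by blast
    then have "length (xr (bl x) (bl y)) = n" using L(4,5) by blast
    then show "k \<in> {..n}" using wt_le [of "xr (bl x) (bl y)"] H xy by simp
  qed
  then have "finite ?H" by (rule finite_subset) simp
  moreover have "d \<in> ?H"
  proof -
    obtain x where x: "x \<in> V" "c = bl x" using c(1) by auto
    obtain y where y: "y \<in> V" "zero n = bl y" using L(3) by auto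
    have "hamming_dist x y = wt (xr c (zero n))"
      by (simp only: H [OF x(1) y(1)] x(2) y(2))
    also have "\<dots> = d" using L(5) [OF c(1)] c(2) by simp
    finally have "hamming_dist x y = d" .
    moreover have "x \<noteq> y"
    proof
      assume "x = y"
      then have "c = zero n" using x(2) y(2) by simp
      then show False using c(2,3) by simp
    qed
    ultimately show ?thesis using x(1) y(1) by blast
  qed
  moreover have "d \<le> k" if k: "k \<in> ?H" for k
  proof -
    obtain x y where xy: "x \<in> V" "y \<in> V" "x \<noteq> y" "k = hamming_dist x y" using k by blast
    have len: "length (bl x) = n" "length (bl y) = n" by (rule L(5), use xy in blast)+
    have "xr (bl x) (bl y) \<noteq> zero n"
      using xr_eq_zero_iff [of "bl x" "bl y"] len bl_inject [of x y] xy(3) by auto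
    then show ?thesis using min L(4) H xy by auto
  qed
  ultimately show ?thesis unfolding min_distance_def by (intro Min_eqI) auto
qed

lemma weight_enumerator_bl:
  assumes V: "V \<subseteq> carrier_vec n" and "k \<le> n"
  shows "coeff (weight_enumerator n V) k = wcount (bl ` V) k"
proof -
  have "inj_on bl V"
    by (intro inj_onI) (metis V bl_inject carrier_vecD subsetD)
  then have "card (bl ` {x \<in> V. weight x = k}) = card {x \<in> V. weight x = k}"
    by (intro card_image) (auto intro: inj_on_subset)
  moreover have "bl ` {x \<in> V. weight x = k} = {c \<in> bl ` V. wt c = k}"
    by (auto simp: weight_bl)
  ultimately show ?thesis
    using assms(2) by (simp add: weight_enumerator_def coeff_sum)
qed

text \<open>Coordinates with respect to a basis give a bijection with functions from the basis to
  the field. This lets the dimension of a binary code be read off from its size.\<close>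

lemma (in vectorspace) card_carrier_dim:
  assumes fin: "finite (carrier V)" shows "card (carrier V) = card (carrier K) ^ dim"
proof -
  have "gen_set (carrier V)"
    using in_own_span [of "carrier V"] span_is_subset2 [of "carrier V"] by auto
  then have "fin_dim" unfolding fin_dim_def using fin by blast
  then obtain B where B: "finite B" "basis B" using finite_basis_exists by blast
  have BC: "B \<subseteq> carrier V" using B(2) by (simp add: basis_def)
  let ?F = "B \<rightarrow>\<^sub>E carrier K"
  have ex1: "\<exists>!a. a \<in> ?F \<and> lincomb a B = v" if "v \<in> carrier V" for v
    using basis_criterion [OF B(1) BC] B(2) that by blast
  have closed: "lincomb a B \<in> carrier V" if "a \<in> ?F" for a
    using that by (intro lincomb_closed [OF BC]) auto
  have "bij_betw (\<lambda>a. lincomb a B) ?F (carrier V)"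
    unfolding bij_betw_def
  proof (intro conjI inj_onI equalityI subsetI)
    fix a b assume "a \<in> ?F" "b \<in> ?F" "lincomb a B = lincomb b B"
    then show "a = b" using ex1 [OF closed] by metis
  next
    fix v assume "v \<in> carrier V"
    then show "v \<in> (\<lambda>a. lincomb a B) ` ?F" using ex1 by blast
  qed (use closed in auto)
  then have "card (carrier V) = card ?F" by (simp add: bij_betw_same_card)
  also have "\<dots> = card (carrier K) ^ card B" using B(1) by (simp add: card_funcsetE)
  finally show ?thesis using dim_basis [OF B] by simp
qed

lemma dim_bl:
  assumes lin: "linear_code n (V :: bit vec set)" and card: "card V = 2 ^ k"
  shows "vectorspace.dim class_ring (module_vec TYPE(bit) n\<lparr>carrier := V\<rparr>) = k"
proof -
  interpret vs: vec_space "TYPE(bit)" n .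
  have sub: "subspace class_ring V (module_vec TYPE(bit) n)"
    using lin vs.vectorspace_axioms by (simp add: linear_code_def subspace_def)
  interpret W: vectorspace class_ring "module_vec TYPE(bit) n\<lparr>carrier := V\<rparr>"
    using vs.subspace_is_vs [OF sub] by simp
  have "finite V" using card by (metis card.infinite power_eq_0_iff zero_neq_numeral)
  moreover have "card (carrier (class_ring :: bit ring)) = 2"
  proof -
    have U: "(UNIV :: bit set) = {0, 1}" by (auto intro: bit.exhaust)
    have "card (UNIV :: bit set) = 2" unfolding U by simp
    then show ?thesis by (simp add: class_ring_simps)
  qed
  ultimately have "(2::nat) ^ W.dim = 2 ^ k" using W.card_carrier_dim card by simp
  then show ?thesis by simp
qed

section \<open>Codes with a generator matrix\<close>

lemma generated_code_subset:
  assumes "M \<in> carrier_mat k n" shows "generated_code M \<subseteq> carrier_vec n"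
  using assms by (auto simp: generated_code_def)

lemma linear_generated_code:
  assumes M: "M \<in> carrier_mat k n" shows "linear_code n (generated_code M)"
proof -
  have MT: "M\<^sup>T \<in> carrier_mat n k" using M by simp
  have mem: "M\<^sup>T *\<^sub>v y \<in> generated_code M" if "y \<in> carrier_vec k" for y
    using that M unfolding generated_code_def by auto
  show ?thesis
    unfolding linear_code_iff
  proof (intro conjI allI ballI)
    have "M\<^sup>T *\<^sub>v 0\<^sub>v k = 0\<^sub>v n" using MT by (intro eq_vecI) auto
    then show "0\<^sub>v n \<in> generated_code M" using mem [of "0\<^sub>v k"] by simp
  next
    fix x y assume "x \<in> generated_code M" "y \<in> generated_code M"
    then obtain a b where "x = M\<^sup>T *\<^sub>v a" "y = M\<^sup>T *\<^sub>v b" "a \<in> carrier_vec k" "b \<in> carrier_vec k"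
      using M by (auto simp: generated_code_def)
    then show "x + y \<in> generated_code M"
      using mem [of "a + b"] mult_add_distrib_mat_vec [OF MT, of a b] by simp
  next
    fix r x assume "x \<in> generated_code M"
    then obtain a where "x = M\<^sup>T *\<^sub>v a" "a \<in> carrier_vec k"
      using M by (auto simp: generated_code_def)
    moreover from this have "M\<^sup>T *\<^sub>v (r \<cdot>\<^sub>v a) = r \<cdot>\<^sub>v (M\<^sup>T *\<^sub>v a)"
      using MT by (intro eq_vecI) auto
    ultimately show "r \<cdot>\<^sub>v x \<in> generated_code M"
      using mem [of "r \<cdot>\<^sub>v a"] by simp
  qed (use generated_code_subset [OF M] in auto)
qed

lemma row_in_generated_code:
  assumes M: "M \<in> carrier_mat k n" and i: "i < k" shows "row M i \<in> generated_code M"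
proof -
  have "M\<^sup>T *\<^sub>v unit_vec k i = row M i"
    using M i by (intro eq_vecI) auto
  moreover have "M\<^sup>T *\<^sub>v unit_vec k i \<in> generated_code M"
    using M by (auto simp: generated_code_def)
  ultimately show ?thesis by simp
qed

lemma generated_code_orth:
  assumes M: "M \<in> carrier_mat k n" and z: "M * M\<^sup>T = 0\<^sub>m k k"
    and x: "x \<in> generated_code M" and y: "y \<in> generated_code M"
  shows "x \<bullet> y = 0"
proof -
  obtain a b where ab: "x = M\<^sup>T *\<^sub>v a" "y = M\<^sup>T *\<^sub>v b" "a \<in> carrier_vec k" "b \<in> carrier_vec k"
    using x y M by (auto simp: generated_code_def)
  have "x \<bullet> y = a \<bullet> (M *\<^sub>v (M\<^sup>T *\<^sub>v b))"
    using transpose_vec_mult_scalar [OF M, of y a] ab M by simp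
  also have "M *\<^sub>v (M\<^sup>T *\<^sub>v b) = (M * M\<^sup>T) *\<^sub>v b"
    using assoc_mult_mat_vec [of M k n "M\<^sup>T" k b] M ab(4) by simp
  also have "\<dots> = 0\<^sub>v k" unfolding z using ab(4) by (intro eq_vecI) auto
  finally show ?thesis using ab(3) by simp
qed

section \<open>The Gray map\<close>

definition mkR2 :: "bit \<Rightarrow> bit \<Rightarrow> bit \<Rightarrow> bit \<Rightarrow> R2" where
  "mkR2 a b c d = R2_of_bit a + R2_u * R2_of_bit b + R2_v * R2_of_bit c + R2_u * R2_v * R2_of_bit d"

lemma cf_mkR2 [simp]:
  "cf_1 (mkR2 a b c d) = a" "cf_u (mkR2 a b c d) = b"
  "cf_v (mkR2 a b c d) = c" "cf_uv (mkR2 a b c d) = d"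
  using R2_decomp_iff [of "mkR2 a b c d" a b c d] by (simp_all add: mkR2_def)

lemma cf_zero [simp]: "cf_1 0 = 0" "cf_u 0 = 0" "cf_v 0 = 0" "cf_uv 0 = 0"
  by (transfer; simp)+

lemma cf_one [simp]: "cf_1 1 = 1" "cf_u 1 = 0" "cf_v 1 = 0" "cf_uv 1 = 0"
  by (transfer; simp add: one_pCons)+

lemma cf_sum:
  "cf_1 (sum f A) = (\<Sum>i\<in>A. cf_1 (f i))" "cf_u (sum f A) = (\<Sum>i\<in>A. cf_u (f i))"
  "cf_v (sum f A) = (\<Sum>i\<in>A. cf_v (f i))" "cf_uv (sum f A) = (\<Sum>i\<in>A. cf_uv (f i))"
  by (induction A rule: infinite_finite_induct; simp add: cf_add)+

lemma map_scalar_prod: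
  fixes f g :: "'a \<Rightarrow> 'b :: semiring_0"
  assumes "dim_vec x = dim_vec y"
  shows "map_vec f x \<bullet> map_vec g y = (\<Sum>i\<in>{0..<dim_vec y}. f (x $ i) * g (y $ i))"
  using assms by (auto simp: scalar_prod_def intro!: sum.cong)

lemma cf_scalar_prod:
  assumes "dim_vec x = dim_vec y"
  shows "cf_1 (x \<bullet> y) = map_vec cf_1 x \<bullet> map_vec cf_1 y"
    "cf_u (x \<bullet> y) = map_vec cf_1 x \<bullet> map_vec cf_u y + map_vec cf_u x \<bullet> map_vec cf_1 y"
    "cf_v (x \<bullet> y) = map_vec cf_1 x \<bullet> map_vec cf_v y + map_vec cf_v x \<bullet> map_vec cf_1 y"
    "cf_uv (x \<bullet> y) = map_vec cf_1 x \<bullet> map_vec cf_uv y + map_vec cf_u x \<bullet> map_vec cf_v y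
       + map_vec cf_v x \<bullet> map_vec cf_u y + map_vec cf_uv x \<bullet> map_vec cf_1 y"
  by (simp_all only: map_scalar_prod [OF assms] scalar_prod_def [of x y] cf_sum cf_mult sum.distrib)

lemma gray_carrier [simp]: "x \<in> carrier_vec n \<Longrightarrow> gray x \<in> carrier_vec (4 * n)"
  by (rule carrier_vecI) (simp add: gray_def Let_def)

lemma gray_add_aux:
  fixes a b c d a' b' c' d' :: "'b :: comm_ring_1 vec"
  assumes car: "a \<in> carrier_vec n" "b \<in> carrier_vec n" "c \<in> carrier_vec n" "d \<in> carrier_vec n"
      "a' \<in> carrier_vec n" "b' \<in> carrier_vec n" "c' \<in> carrier_vec n" "d' \<in> carrier_vec n"
  shows "(d + d') @\<^sub>v ((c + c') + (d + d')) @\<^sub>v ((b + b') + (d + d')) @\<^sub>v ((a + a') + (b + b') + (c + c') + (d + d'))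
    = (d @\<^sub>v (c + d) @\<^sub>v (b + d) @\<^sub>v (a + b + c + d)) + (d' @\<^sub>v (c' + d') @\<^sub>v (b' + d') @\<^sub>v (a' + b' + c' + d'))"
proof -
  have app: "(p @\<^sub>v r) + (p' @\<^sub>v r') = (p + p') @\<^sub>v (r + r')"
    if "dim_vec p = dim_vec p'" "dim_vec r = dim_vec r'" for p r p' r' :: "'b vec"
    using that by (intro eq_vecI) auto
  have comm: "p + r = r + p" and lcomm: "p + (r + s) = r + (p + s)"
    if "p \<in> carrier_vec n" "r \<in> carrier_vec n" "s \<in> carrier_vec n" for p r s :: "'b vec"
    using that by (intro eq_vecI; simp add: add.commute add.left_commute)+
  show ?thesis
    using car by (simp add: app) (simp add: comm [where s = "0\<^sub>v n"] lcomm)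
qed

lemma gray_add:
  assumes x: "x \<in> carrier_vec n" and y: "y \<in> carrier_vec n" shows "gray (x + y) = gray x + gray y"
proof -
  have "map_vec cf_1 (x + y) = map_vec cf_1 x + map_vec cf_1 y"
    "map_vec cf_u (x + y) = map_vec cf_u x + map_vec cf_u y"
    "map_vec cf_v (x + y) = map_vec cf_v x + map_vec cf_v y"
    "map_vec cf_uv (x + y) = map_vec cf_uv x + map_vec cf_uv y"
    using x y by (simp_all add: vec_eq_iff cf_add)
  then show ?thesis
    using x y by (simp only: gray_def Let_def gray_add_aux [where n = n] map_carrier_vec)
qed

lemma bl_gray:
  fixes x :: "R2 vec"
  defines "a \<equiv> bl (map_vec cf_1 x)" and "b \<equiv> bl (map_vec cf_u x)"
    and "c \<equiv> bl (map_vec cf_v x)" and "d \<equiv> bl (map_vec cf_uv x)"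
  shows "bl (gray x) = d @ xr c d @ xr b d @ xr (xr (xr a b) c) d"
  unfolding gray_def Let_def a_def b_def c_def d_def
  by (simp add: bl_append bl_add)

lemma gray_zero: "gray (0\<^sub>v n) = 0\<^sub>v (4 * n)"
  unfolding gray_def Let_def
  by (intro eq_vecI) (auto simp: append_vec_def Let_def)

text \<open>On expansion d d' occurs four times and b b', c c', b d', d b', c d', d c' twice each;
  characteristic 2 removes them.\<close>

lemma gray_scalar_prod_aux:
  fixes a b c d a' b' c' d' :: "'b :: comm_ring_1 vec"
  assumes char2: "\<And>z :: 'b. z + z = 0"
    and car: "a \<in> carrier_vec n" "b \<in> carrier_vec n" "c \<in> carrier_vec n" "d \<in> carrier_vec n"
      "a' \<in> carrier_vec n" "b' \<in> carrier_vec n" "c' \<in> carrier_vec n" "d' \<in> carrier_vec n"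
  shows "(d @\<^sub>v (c + d) @\<^sub>v (b + d) @\<^sub>v (a + b + c + d)) \<bullet>
      (d' @\<^sub>v (c' + d') @\<^sub>v (b' + d') @\<^sub>v (a' + b' + c' + d'))
    = a \<bullet> a' + (a \<bullet> b' + b \<bullet> a') + (a \<bullet> c' + c \<bullet> a')
      + (a \<bullet> d' + b \<bullet> c' + c \<bullet> b' + d \<bullet> a')"
proof -
  have self: "z + (z + w) = w" for z w :: 'b
    by (simp add: char2 add.assoc [symmetric])
  have app: "(p @\<^sub>v r) \<bullet> (p' @\<^sub>v r') = p \<bullet> p' + r \<bullet> r'"
    if "dim_vec p = dim_vec p'" "dim_vec r = dim_vec r'" for p r p' r' :: "'b vec"
    by (rule scalar_prod_append [OF carrier_vec_dim_vec carrier_vec_dim_vec]; rule carrier_vecI; simp add: that)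
  have dist: "(p + p') \<bullet> r = p \<bullet> r + p' \<bullet> r" "r \<bullet> (p + p') = r \<bullet> p + r \<bullet> p'"
    if "p \<in> carrier_vec n" "p' \<in> carrier_vec n" "r \<in> carrier_vec n" for p p' r :: "'b vec"
    using that by (auto simp: add_scalar_prod_distrib scalar_prod_add_distrib)
  have two: "(2 :: 'b) = 0" using char2 [of 1] by simp
  have "(4 :: 'b) = 2 * 2" by simp
  then have four: "(4 :: 'b) = 0" by (simp only: two mult_zero_left)
  show ?thesis
    using car by (simp add: app dist) (simp add: ac_simps self char2 two four)
qed

text \<open>The right-hand side is an additive functional of \<open>x \<bullet> y\<close>, so
  orthogonality over the ring carries over to the Gray images.\<close>

lemma gray_scalar_prod:
  assumes x: "x \<in> carrier_vec n" and y: "y \<in> carrier_vec n"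
  shows "gray x \<bullet> gray y = cf_1 (x \<bullet> y) + cf_u (x \<bullet> y) + cf_v (x \<bullet> y) + cf_uv (x \<bullet> y)"
proof -
  have "z + z = 0" for z :: bit by (cases z) auto
  from gray_scalar_prod_aux [OF this, where n = n]
  have "gray x \<bullet> gray y = map_vec cf_1 x \<bullet> map_vec cf_1 y
      + (map_vec cf_1 x \<bullet> map_vec cf_u y + map_vec cf_u x \<bullet> map_vec cf_1 y)
      + (map_vec cf_1 x \<bullet> map_vec cf_v y + map_vec cf_v x \<bullet> map_vec cf_1 y)
      + (map_vec cf_1 x \<bullet> map_vec cf_uv y + map_vec cf_u x \<bullet> map_vec cf_v y
         + map_vec cf_v x \<bullet> map_vec cf_u y + map_vec cf_uv x \<bullet> map_vec cf_1 y)"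
    using x y by (simp only: gray_def Let_def map_carrier_vec)
  then show ?thesis
    using x y by (simp only: cf_scalar_prod carrier_vecD)
qed

lemma wlinear_gray:
  assumes L: "linear_code n L" shows "wlinear (4 * n) (bl ` gray ` L)"
proof -
  have sub: "L \<subseteq> carrier_vec n" and zero: "0\<^sub>v n \<in> L" and add: "\<And>x y. x \<in> L \<Longrightarrow> y \<in> L \<Longrightarrow> x + y \<in> L"
    using L by (auto simp: linear_code_iff)
  have "xr (bl (gray x)) (bl (gray y)) \<in> bl ` gray ` L" if "x \<in> L" "y \<in> L" for x y
  proof -
    have xy: "x \<in> carrier_vec n" "y \<in> carrier_vec n" using that sub by auto
    have "xr (bl (gray x)) (bl (gray y)) = bl (gray (x + y))"
      using xy gray_carrier [OF xy(1)] gray_carrier [OF xy(2)]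
      by (metis bl_add carrier_vecD gray_add)
    then show ?thesis using add that by blast
  qed
  moreover have "zero (4 * n) \<in> bl ` gray ` L"
    using zero gray_zero [of n] bl_zero [of "4 * n"] by (metis image_eqI)
  moreover have "bl ` gray ` L \<subseteq> words (4 * n)"
    using sub bl_words [OF gray_carrier] by blast
  ultimately show ?thesis by (auto simp: wlinear_def)
qed

lemma gray_orth:
  assumes "x \<in> carrier_vec n" "y \<in> carrier_vec n" "x \<bullet> y = 0"
  shows "\<not> par (bl (gray x)) (bl (gray y))"
proof -
  have "gray x \<bullet> gray y = 0" using gray_scalar_prod [OF assms(1,2)] assms(3) by simp
  moreover have "dim_vec (gray x) = dim_vec (gray y)"
    using gray_carrier assms(1,2) by (metis carrier_vecD)
  ultimately show ?thesis using scalar_prod_bl [of "gray x" "gray y"] by auto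
qed

section \<open>Fifteen explicit codes\<close>

fun bits_num :: "nat \<Rightarrow> num \<Rightarrow> bool list" where
  "bits_num 0 m = []"
| "bits_num (Suc n) num.One = True # zero n"
| "bits_num (Suc n) (num.Bit0 m) = False # bits_num n m"
| "bits_num (Suc n) (num.Bit1 m) = True # bits_num n m"

text \<open>The least significant digit comes first. The digits are read off the binary numeral, as
  arithmetic on \<^typ>\<open>nat\<close> would be evaluated in unary.\<close>

definition bits :: "nat \<Rightarrow> int \<Rightarrow> bool list" where
  "bits n x = (if x \<le> 0 then zero n else bits_num n (num_of_nat (nat x)))"

lemma bits_code [code]:
  "bits n 0 = zero n" "bits n (Int.Pos m) = bits_num n m"
  by (simp_all add: bits_def num_of_nat_numeral_eq)

lemma length_bits [simp]: "length (bits n x) = n"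
proof -
  have "length (bits_num n m) = n" for m
    by (induction n m rule: bits_num.induct) auto
  then show ?thesis by (simp add: bits_def)
qed

text \<open>The code equations below make \<open>code_simp\<close> spend one rewrite step per bit. For the same reason
  the functions evaluated later avoid lambda abstractions and case distinctions: these make the
  simplifier traverse their (large) arguments again.\<close>

lemma xr_code [code]:
  "xr (True # xs) (y # ys) = (\<not> y) # xr xs ys"
  "xr (False # xs) (y # ys) = y # xr xs ys"
  "xr [] ys = []" "xr (x # xs) [] = []"
  by auto

lemma par_code [code]:
  "par (False # xs) (y # ys) = par xs ys"
  "par (True # xs) (False # ys) = par xs ys"
  "par (True # xs) (True # ys) = (\<not> par xs ys)"
  "par [] ys = False" "par (x # xs) [] = False"
  by auto

lemma wt_code [code]:
  "wt [] = 0" "wt (True # xs) = Suc (wt xs)" "wt (False # xs) = wt xs"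
  by auto

lemma enc_code [code]:
  "enc n (g # G) (True # a) = xr g (enc n G a)"
  "enc n (g # G) (False # a) = enc n G a"
  "enc n [] a = zero n" "enc n (g # G) [] = zero n"
  by auto

lemma disj_code [code]:
  "disj (False # xs) (y # ys) = disj xs ys"
  "disj (True # xs) (False # ys) = disj xs ys"
  "disj (True # xs) (True # ys) = False"
  "disj [] ys = True" "disj (x # xs) [] = True"
  by auto

lemma narrow_code [code]:
  "narrow b (False # m) (y # g) = False # narrow b m g"
  "narrow True (True # m) (y # g) = y # narrow True m g"
  "narrow False (True # m) (y # g) = (\<not> y) # narrow False m g"
  "narrow b [] g = []" "narrow b (x # m) [] = []"
  by auto

fun dead :: "bool list \<Rightarrow> bool" where
  "dead [] = True"
| "dead (False # m) = dead m"
| "dead (True # m) = False"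

lemma dead_iff: "dead m \<longleftrightarrow> True \<notin> set m"
  by (induction m rule: dead.induct) auto

definition sieve_step where
  "sieve_step b r m a g ags = (b \<or> sieve r (narrow (par a r) m g) ags)"

lemma sieve_code [code]:
  "sieve r m [] = dead m"
  "sieve r m ((a, g) # ags) = sieve_step (dead m) r m a g ags"
  "sieve_step True r m a g ags = True"
  "sieve_step False r m a g ags = sieve r (narrow (par a r) m g) ags"
  by (simp_all add: sieve_step_def dead_iff)

definition hits_step where
  "hits_step b r ags = (b \<or> hits r ags)"

lemma hits_code [code]:
  "hits r [] = False"
  "hits r ((a, g) # ags) = hits_step (par a r) r ags"
  "hits_step True r ags = True"
  "hits_step False r ags = hits r ags"
  by (auto simp: hits_def hits_step_def)

fun cons_all :: "bool list \<Rightarrow> bool list list \<Rightarrow> bool list list" where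
  "cons_all (x # xs) (c # cs) = (x # c) # cons_all xs cs"
| "cons_all _ _ = []"

lemma columns_code [code]:
  "columns n [] = replicate n []"
  "columns n (g # G) = cons_all g (columns n G)"
proof -
  have "map2 (#) g cs = cons_all g cs" for g and cs :: "bool list list"
    by (induction g cs rule: cons_all.induct) auto
  then show "columns n (g # G) = cons_all g (columns n G)" by simp
qed simp

fun odd_half :: "nat \<Rightarrow> bool" where
  "odd_half (Suc (Suc n)) = (\<not> odd_half n)"
| "odd_half _ = False"

lemma half_odd_code [code]: "half_odd c = odd_half (wt c)"
proof -
  have "odd_half n = odd (n div 2)" for n
    by (induction n rule: odd_half.induct) auto
  then show ?thesis by (simp add: half_odd_def)
qed

definition swap :: "bool list \<Rightarrow> bool list" where
  "swap w = drop 16 w @ take 16 w"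

text \<open>The Gray image over F_2 + u F_2 sends x + u y to (y, x + y), and multiplication by 1 + u
  swaps the two blocks. The same construction applied to the coefficients of 1 and u gives
  \<open>GG\<close>, applied to those of v and uv it gives the upper words
  \<open>K_rows\<close>.\<close>

definition gens :: "bool list list \<Rightarrow> bool list list \<Rightarrow> bool list list" where
  "gens X Y = map2 (\<lambda>x y. y @ xr x y) X Y @ map swap (map2 (\<lambda>x y. y @ xr x y) X Y)"

definition byte_rows :: "int list \<Rightarrow> bool list list" where
  "byte_rows xs = map (\<lambda>x. zero 8 @ bits 8 x) xs"

text \<open>The rows of \<open>A\<^sub>2\<close>, and the coefficients of \<open>u\<close> in the rows of \<open>L\<close>, which are common to all codes.\<close>

definition A_data :: "int list" where
  "A_data = [121, 122, 124, 200, 208, 224, 191, 199]"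

definition B_data :: "int list" where
  "B_data = [93, 25, 200, 145, 226, 62, 61, 211]"

definition A_rows :: "bool list list" where
  "A_rows = map2 (\<lambda>i x. bits 8 i @ bits 8 x) [1, 2, 4, 8, 16, 32, 64, 128] A_data"

definition GG :: "bool list list" where
  "GG = gens A_rows (byte_rows B_data)"

subsection \<open>The common code of length 32\<close>

text \<open>The information digits of the words of weight 8, in the order of \<open>lessw\<close> below.\<close>

definition E8_data :: "int list" where
  "E8_data =
    [32768, 16384, 24576, 57344, 4096, 36864, 53248, 2048, 34816, 26624, 59392, 1024, 33792, 50176,
    5120, 21504, 54272, 13312, 15360, 512, 16896, 37376, 2560, 6656, 34304, 3584, 256, 33024, 16640,
    37120, 20736, 53504, 12544, 14592, 1280, 34048, 17664, 21760, 3328, 768, 35584, 20224, 128,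
    16512, 8320, 2176, 18560, 43136, 13440, 640, 17024, 21120, 53888, 45696, 14976, 1664, 34432,
    14720, 1408, 3456, 896, 33664, 1920, 64, 32832, 24640, 4160, 2112, 34880, 26688, 38976, 1088,
    35904, 23616, 33344, 8768, 25152, 2624, 7744, 33088, 20800, 2368, 4928, 10048, 8384, 12480,
    9408, 10944, 41408, 26048, 32800, 49184, 8224, 4128, 20512, 12320, 1056, 17440, 9248, 33312,
    25120, 2592, 35360, 46624, 24096, 288, 33056, 24864, 4384, 2336, 2848, 36640, 12448, 34976,
    22688, 1184, 25760, 3232, 36000, 33440, 2464, 96, 16480, 43104, 608, 352, 37216, 864, 224, 1248,
    16, 16400, 8208, 4112, 36880, 61456, 6160, 33808, 50192, 9232, 5136, 528, 16912, 10768, 34320,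
    5648, 16656, 49424, 8464, 41232, 51472, 10512, 5392, 144, 4240, 50320, 11408, 17040, 8848,
    33168, 5008, 8272, 2128, 18512, 38992, 7248, 1616, 41296, 18768, 208, 49200, 8240, 41008, 12336,
    18480, 1072, 17968, 2352, 19248, 29360, 22640, 17008, 6000, 4336, 8, 32776, 16392, 20488, 2056,
    43016, 59400, 14344, 1032, 33800, 37896, 3080, 27656, 520, 4616, 1544, 264, 53512, 14600, 1288,
    17160, 8968, 136, 16520, 41096, 648, 392, 37256, 904, 32840, 20552, 12360, 1096, 33864, 25672,
    3144, 35400, 328, 33480, 2504, 10280, 8744, 12840, 26408, 32936, 24744, 2216, 104, 16488, 1384,
    232, 2280, 744, 4120, 6168, 11288, 536, 33304, 4632, 8472, 16536, 20632, 33944, 408, 5528,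
    41048, 28760, 9560, 2104, 4, 16388, 8196, 40964, 57348, 12292, 2052, 18436, 9220, 13316, 16900,
    41476, 18948, 10756, 41220, 12548, 28932, 1284, 25860, 3332, 132, 4228, 2180, 18564, 39044,
    2692, 17796, 8260, 16964, 49732, 8772, 10820, 5700, 4932, 196, 4292, 37060, 50372, 5316, 16836,
    49188, 8228, 4132, 1060, 5156, 33316, 16676, 8484, 420, 41060, 18532, 40036, 20, 4116, 50196,
    9236, 2580, 33044, 35604, 2196, 35988, 84, 852, 212, 52, 32820, 1076, 308, 948, 40972, 2060,
    18444, 4620, 17932, 9740, 2316, 39180, 16524, 41100, 38028, 332, 36908, 6188, 556, 5676, 8876,
    2156, 20508, 25756, 16476, 348, 60, 2, 32770, 24578, 4098, 2050, 34818, 59394, 6146, 11266,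
    8706, 4610, 61954, 6658, 9730, 8450, 8962, 25346, 42754, 16514, 8322, 41090, 51330, 6274, 9346,
    23170, 8578, 5506, 66, 32834, 4162, 36930, 28738, 1090, 17474, 322, 16706, 17602, 49858, 1730,
    18882, 16418, 36898, 10274, 17442, 44066, 546, 290, 4386, 1186, 16482, 8290, 4450, 2066, 6162,
    3090, 530, 1554, 8466, 18706, 146, 402, 32850, 1618, 32978, 10290, 32946, 4530, 45170, 754, 10,
    16394, 8202, 33802, 5130, 6666, 8970, 51978, 8330, 18570, 6538, 1098, 49194, 4138, 1066, 17450,
    16682, 38186, 26, 538, 2586, 33370, 32826, 32774, 20486, 2054, 49670, 4614, 20998, 1542, 1286,
    36102, 33542, 134, 32902, 4230, 12358, 3142, 326, 3110, 550, 422, 4118, 17430, 11286, 8374, 14,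
    33038, 2382, 16414, 8286, 1, 8193, 24577, 2049, 34817, 18433, 38913, 41985, 13313, 19457, 23553,
    16897, 8705, 37377, 17921, 42497, 2305, 6401, 3329, 769, 4865, 129, 16513, 8321, 36993, 5249,
    3713, 16769, 41345, 65, 4161, 50241, 9281, 16961, 10817, 33089, 4929, 4289, 49601, 10689, 4129,
    6177, 9249, 545, 33313, 4641, 10529, 49313, 4257, 20641, 1185, 33185, 8289, 42337, 8209, 8721,
    25105, 45585, 145, 24721, 34961, 81, 16465, 1361, 209, 2257, 49, 1073, 1137, 16393, 8201, 40969,
    12297, 51209, 3081, 19977, 265, 17161, 20553, 49737, 4681, 4297, 4137, 49449, 8489, 35353, 281,
    3225, 57, 32825, 2105, 1337, 5, 32773, 2053, 26629, 1029, 1541, 20741, 14597, 1285, 133, 901,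
    69, 33861, 22565, 24997, 49253, 1125, 4117, 38933, 33301, 4885, 10901, 85, 13, 32781, 1037, 269,
    1677, 3, 32771, 24579, 34819, 21507, 46083, 259, 34051, 771, 32899, 1667, 2115, 2371, 2083, 547,
    2595, 611, 16403, 36883, 17427, 275, 16659, 5395, 8203, 139, 5259, 12363, 2763, 32775, 16423,
    679, 10343, 28695, 8335, 79]"

text \<open>A random selection of these words, so that each of them eliminates about half of the positions
  left in a sieve; the division into short lists only keeps the terms small.\<close>

definition cand_data :: "int list list" where
  "cand_data =
    [[57, 79, 20486, 32826, 17921, 32773, 26, 2560, 4138, 13, 3332, 1288],
     [6162, 679, 8289, 17602, 2066, 34816, 41232, 16488, 1337, 17427, 8962, 33089],
     [16393, 139, 6168, 4132, 35604, 4885, 212, 16896, 904, 328, 12320, 896],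
     [40036, 10512, 4932, 1184, 45696, 51330, 12292, 2115, 9740, 41100, 9346, 33542],
     [20224, 22688, 17040, 2592, 259, 6274, 33301, 4096, 16388, 4118, 33044, 49424],
     [1072, 18560, 6160, 50241, 39044, 1032, 32800, 392, 34817, 24096, 12358, 24864],
     [5700, 38913, 84, 23553, 34432, 1285, 1248, 33168, 18436, 41476, 17008, 16],
     [32832, 133, 20488, 57348, 16897, 9249, 2595, 8876, 36883, 25756, 14976, 4865],
     [33808, 24578, 41220, 2, 3713, 9560, 16465, 43104, 265, 59400, 59394, 34051],
     [2504, 32902, 14597, 32770, 5120, 38976, 20632, 41345, 39180, 5648, 16659, 49737],
     [8768, 61954, 1618, 8464, 36864]]"

section \<open>Certificates for the words of weight 8 and the absence of weight 4\<close>

fun lessw :: "bool list \<Rightarrow> bool list \<Rightarrow> bool" where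
  "lessw (x # xs) (y # ys) = (if x = y then lessw xs ys else y)"
| "lessw _ _ = False"

lemma lessw_code [code]:
  "lessw (True # xs) (True # ys) = lessw xs ys"
  "lessw (True # xs) (False # ys) = False"
  "lessw (False # xs) (True # ys) = True"
  "lessw (False # xs) (False # ys) = lessw xs ys"
  "lessw [] ys = False" "lessw (x # xs) [] = False"
  by auto

text \<open>Strict increase proves distinctness in a single pass, without comparing all pairs of
  words.\<close>

fun chain :: "bool list list \<Rightarrow> bool list \<Rightarrow> int list \<Rightarrow> bool" where
  "chain G a [] = True"
| "chain G a (x # xs) =
     (lessw a (bits 16 x) \<and> wt (enc 32 G (bits 16 x)) = 8 \<and> chain G (bits 16 x) xs)"

text \<open>Branches over the sums of \<open>acc\<close> with at most \<open>m\<close> of the rows;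
  a row is dropped or used at the cost of one unit of \<open>m\<close>.\<close>

fun lightw :: "nat \<Rightarrow> nat \<Rightarrow> bool list list \<Rightarrow> bool list \<Rightarrow> bool" where
  "lightw k m [] acc = (wt acc \<noteq> k)"
| "lightw k 0 (g # G) acc = lightw k 0 G acc"
| "lightw k (Suc m) (g # G) acc = (lightw k (Suc m) G acc \<and> lightw k m G (xr g acc))"

fun orth :: "bool list list \<Rightarrow> bool list list \<Rightarrow> bool" where
  "orth [] H = True"
| "orth (g # G) H = (list_all (\<lambda>h. \<not> par g h) H \<and> orth G H)"

text \<open>The first eight rows of \<open>GG\<close> are (y, x + y) with y starting with eight
  zeros and x with a unit vector, so their identity block begins at position 16; in the swapped rows
  it begins at position 0.\<close>

definition info_pos :: "nat \<Rightarrow> nat" where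
  "info_pos j = (if j < 8 then 16 + j else j - 8)"

lemma GG_checks:
  "length GG = 16" "list_all (\<lambda>g. length g = 32) GG"
  "orth GG GG" "list_all (\<lambda>g. \<not> half_odd g) GG"
  "map (\<lambda>j. map (\<lambda>g. g ! info_pos j) GG) [0..<16] = map (\<lambda>j. map (\<lambda>i. i = j) [0..<16]) [0..<16]"
  by code_simp+

lemma A_rows_checks:
  "length A_rows = 8" "list_all (\<lambda>a. length a = 16) A_rows" "length (byte_rows B_data) = 8"
  "map (take 8) A_rows = map (\<lambda>i. map (\<lambda>j. i = j) [0..<8]) [0..<8]"
  "map (drop 8) A_rows = map (bits 8) A_data"
  by code_simp+

lemma GG_light: "lightw 4 4 GG (zero 32)"
  by code_simp

lemma E8_checks: "length E8_data = 620" "chain GG (zero 16) E8_data"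
  by code_simp+

subsection \<open>Sieving\<close>

fun keep :: "bool \<Rightarrow> 'a \<Rightarrow> 'a list \<Rightarrow> 'a list" where
  "keep True x xs = x # xs"
| "keep False x xs = xs"

fun cand :: "bool list \<Rightarrow> (bool list \<times> bool list) list \<Rightarrow> (bool list \<times> bool list) list" where
  "cand e [] = []"
| "cand e ((a, g) # ags) = keep (disj e g) (a, g) (cand e ags)"

fun cands :: "bool list \<Rightarrow> (bool list \<times> bool list) list list \<Rightarrow> (bool list \<times> bool list) list" where
  "cands e [] = []"
| "cands e (ags # agss) = cand e ags @ cands e agss"

definition tag :: "bool list list \<Rightarrow> int list \<Rightarrow> (bool list \<times> bool list) list" where
  "tag G xs = map (\<lambda>x. (bits 16 x, enc 32 G (bits 16 x))) xs"

fun memw :: "bool list \<Rightarrow> bool list list \<Rightarrow> bool" where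
  "memw a [] = False"
| "memw a (b # bs) = (a = b \<or> memw a bs)"

fun eqw :: "bool list \<Rightarrow> bool list \<Rightarrow> bool" where
  "eqw (x # xs) (y # ys) = (x = y \<and> eqw xs ys)"
| "eqw [] [] = True"
| "eqw _ _ = False"

lemma eqw_iff: "eqw xs ys \<longleftrightarrow> xs = ys"
  by (induction xs ys rule: eqw.induct) auto

lemma eqw_code [code]:
  "eqw (True # xs) (True # ys) = eqw xs ys" "eqw (False # xs) (False # ys) = eqw xs ys"
  "eqw (True # xs) (False # ys) = False" "eqw (False # xs) (True # ys) = False"
  "eqw [] [] = True" "eqw [] (y # ys) = False" "eqw (x # xs) [] = False"
  by auto

lemma memw_code [code]:
  "memw a [] = False" "memw a (b # bs) = (eqw a b \<or> memw a bs)"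
  by (auto simp: eqw_iff)

text \<open>The sieve serves the minimum distance. The second conjunct serves the shadow: either
  \<open>p\<close> is listed, or a disjoint word refutes shadow vectors of weight 8 over it.\<close>

definition verdict where
  "verdict a ags r q sh = (sieve r (replicate 32 True) ags \<and> (memw a sh \<or> hits (xr r q) ags))"

fun tests :: "bool list \<Rightarrow> bool list \<Rightarrow> (bool list \<times> bool list) list \<Rightarrow>
    (bool list list \<times> bool list \<times> bool list list) list \<Rightarrow> bool" where
  "tests a e ags [] = True"
| "tests a e ags ((KT, q, sh) # ts) = (verdict a ags (enc 16 KT e) q sh \<and> tests a e ags ts)"

text \<open>The word \<open>e\<close> and the candidates disjoint from it are the same for all
  codes, so they are shared by the tests of a whole family.\<close>

definition tests_word where
  "tests_word agss ts a e = tests a e (cands e agss) ts"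

fun sweep where
  "sweep G agss ts [] = True"
| "sweep G agss ts (x # xs) =
     (tests_word agss ts (bits 16 x) (enc 32 G (bits 16 x)) \<and> sweep G agss ts xs)"

subsection \<open>The data of the codes\<close>

text \<open>A tuple \<open>(c, d, x, sh)\<close> holds the coefficients of \<open>v\<close> and \<open>uv\<close> in the rows of \<open>L\<close>, a word \<open>x\<close> of
  weight 2 or 4 such that \<open>(x, x)\<close> is in the shadow, and for each word \<open>p\<close> of weight 8 with shadow
  vectors \<open>(h, h + p)\<close> of weight 8 over it the information digits of \<open>p\<close> and one such \<open>h\<close>.
  The codes were found by a random search among the matrices
  \<open>L = (I + uS + vT + uv(ST + N)) A\<^sub>2\<close> with \<open>S\<close>, \<open>T\<close>, \<open>N\<close> symmetric over \<open>F\<^sub>2\<close>; they satisfy \<open>L L\<^sup>T = I\<close>.\<close>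

type_synonym code_data = "int list \<times> int list \<times> int \<times> (int \<times> int) list"

fun K_rows :: "code_data \<Rightarrow> bool list list" where
  "K_rows (c, d, x, sh) = gens (byte_rows c) (byte_rows d)"

fun x1_word :: "code_data \<Rightarrow> bool list" where
  "x1_word (c, d, x, sh) = bits 32 x"

fun sh_words :: "code_data \<Rightarrow> (bool list \<times> bool list) list" where
  "sh_words (c, d, x, sh) = map (\<lambda>(a, h). (bits 16 a, bits 32 h)) sh"

definition q_word :: "code_data \<Rightarrow> bool list" where
  "q_word t = map half_odd (map2 (\<lambda>k g. k @ xr k g) (K_rows t) GG)"

definition prepare :: "code_data \<Rightarrow> bool list list \<times> bool list \<times> bool list list" where
  "prepare t = (columns 32 (K_rows t), q_word t, map fst (sh_words t))"

text \<open>The coordinates at 1, u, v and uv of the ring inner product of a + ub + vc + uvd with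
  its primed counterpart all vanish.\<close>

fun orth4 :: "bool list \<Rightarrow> bool list \<Rightarrow> bool list \<Rightarrow> bool list \<Rightarrow>
    bool list \<Rightarrow> bool list \<Rightarrow> bool list \<Rightarrow> bool list \<Rightarrow> bool" where
  "orth4 a b c d a' b' c' d' \<longleftrightarrow> \<not> par a a' \<and> par a b' = par b a' \<and> par a c' = par c a' \<and>
     ((par a d' \<noteq> par d a') = (par b c' \<noteq> par c b'))"

definition rows4 :: "code_data \<Rightarrow> (bool list \<times> bool list \<times> bool list \<times> bool list) list" where
  "rows4 t = (case t of (c, d, _) \<Rightarrow> zip A_rows (zip (byte_rows B_data) (zip (byte_rows c) (byte_rows d))))"

definition self_orth :: "code_data \<Rightarrow> bool" where
  "self_orth t = list_all (\<lambda>(a, b, c, d). list_all (\<lambda>(a', b', c', d'). orth4 a b c d a' b' c' d') (rows4 t)) (rows4 t)"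

definition sh_ok :: "bool list list \<Rightarrow> bool list list \<Rightarrow> bool list \<Rightarrow> bool list \<Rightarrow> bool list \<Rightarrow> bool" where
  "sh_ok KT GT q h p \<longleftrightarrow> off h p = zero 32 \<and> wt p = 8 \<and> xr (enc 16 KT p) (enc 16 GT h) = q"

definition data_ok :: "code_data \<Rightarrow> bool" where
  "data_ok t \<longleftrightarrow> (case t of (c, d, _) \<Rightarrow> length c = 8 \<and> length d = 8) \<and>
     list_all (\<lambda>(a, h). sh_ok (columns 32 (K_rows t)) (columns 32 GG) (q_word t) h (enc 32 GG a)) (sh_words t) \<and>
     distinct (map fst (sh_words t)) \<and> enc 16 (columns 32 GG) (x1_word t) = q_word t"

fun count_sup :: "bool list list \<Rightarrow> bool list \<Rightarrow> int list \<Rightarrow> nat" where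
  "count_sup G x [] = 0"
| "count_sup G x (y # ys) =
     (if wt (off x (enc 32 G (bits 16 y))) = 0 then Suc (count_sup G x ys) else count_sup G x ys)"

definition tail_count :: "code_data \<Rightarrow> nat" where
  "tail_count t = count_sup GG (x1_word t) E8_data"

definition codes_1 :: "(int \<times> code_data) list" where
  "codes_1 = [
    (16, [24, 0, 23, 225, 173, 80, 248, 132], [154, 34, 65, 159, 41, 162, 34, 226], 262148,
      [(49858, 0)]),
    (20, [187, 191, 5, 120, 224, 168, 237, 150], [222, 171, 182, 220, 225, 34, 62, 59], 131074,
      [(50372, 12845252), (20641, 278921280), (41296, 1057025)]),
    (24, [78, 203, 146, 54, 118, 234, 125, 49], [124, 37, 15, 230, 101, 186, 45, 247], 1073758208,
      [(6168, 0), (24721, 8462336), (37216, 274727184), (12336, 12336), (49858, 8388736)]),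
    (26, [216, 142, 238, 106, 148, 17, 162, 154], [159, 222, 179, 61, 195, 227, 6, 94], 134219776,
      [(2066, 1089536), (1337, 3768320), (14597, 328704), (16392, 524288), (2112, 8), (4616,
      34127874)]),
    (28, [84, 4, 55, 222, 252, 213, 30, 214], [109, 196, 0, 218, 228, 250, 192, 100], 8388736,
      [(84, 4462080), (19977, 65536), (21504, 16778256), (2056, 1074300928), (4098, 16787728),
      (2382, 1), (528, 33587202)]),
    (30, [37, 41, 119, 214, 248, 108, 88, 197], [73, 140, 254, 219, 173, 252, 111, 224], 8388736,
      [(2115, 268574728), (1285, 1285), (8772, 21252128), (16900, 262146), (2056, 1208516608),
      (17160, 17473), (17442, 135168), (1090, 131076)]),
    (34, [199, 91, 50, 48, 84, 217, 124, 88], [91, 222, 217, 25, 176, 81, 72, 204], 8388736,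
      [(17427, 163844), (6168, 1054728), (4932, 272662545), (2592, 10), (2, 553779200), (8224,
      536920096), (4928, 4196355), (512, 8450), (8202, 655360), (16403, 134414400)]),
    (38, [108, 3, 187, 71, 222, 80, 129, 156], [34, 161, 191, 236, 247, 228, 2, 190], 1073758208,
      [(1125, 4194816), (17161, 66), (28695, 327680), (20512, 2130000), (25860, 33554496), (16682,
      69865536), (43016, 67633152), (2216, 1032), (6000, 5), (8272, 234881280), (2371, 4325376),
      (10817, 98304)])]"

definition codes_2 :: "(int \<times> code_data) list" where
  "codes_2 = [
    (3, [201, 6, 86, 45, 168, 235, 53, 18], [246, 114, 219, 183, 187, 201, 76, 52], 138414144,
      [(771, 16843009)]),
    (7, [127, 101, 184, 178, 197, 120, 74, 230], [74, 222, 102, 123, 218, 106, 203, 147], 33685761,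
      [(49858, 12714496)]),
    (11, [253, 91, 255, 157, 106, 232, 59, 206], [8, 117, 83, 80, 179, 84, 162, 85], 29360129,
      [(1618, 4198656), (16640, 65), (65, 4259840), (20998, 393746)]),
    (15, [182, 97, 1, 220, 69, 247, 125, 66], [55, 50, 201, 217, 77, 190, 97, 55], 150997248,
      [(212, 8699904), (12548, 83886080), (8224, 539017216), (3144, 524300), (18444, 786440),
      (54272, 67113040), (1073, 1280)]),
    (26, [232, 227, 186, 14, 111, 36, 218, 152], [245, 168, 25, 99, 82, 40, 65, 122], 12583169,
      [(35604, 1319043), (36864, 16786960), (144, 8400896), (5259, 557056), (23616, 4194332), (134,
      42336768), (269, 786432), (16476, 1835072), (8706, 9216), (3329, 12), (546, 603979776),
      (34304, 49408)]),
    (27, [76, 163, 148, 86, 36, 29, 180, 98], [147, 19, 12, 250, 147, 175, 44, 196], 2181071360,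
      [(24096, 18874442), (1248, 10486788), (57348, 67371168), (20632, 546836560), (1361, 5247489),
      (32820, 134217856), (8286, 1327104), (11286, 33947656), (13440, 33588), (38992, 32768), (5676,
      524806), (49858, 706), (20741, 262401)]),
    (35, [84, 239, 169, 131, 163, 203, 200, 165], [170, 63, 236, 223, 66, 203, 50, 208], 2147647490,
      [(23170, 147528), (2580, 68157450), (36640, 32775), (4681, 98322), (96, 768), (12448,
      100663296), (1, 67129344), (18706, 536872008), (8335, 8917024), (256, 218112001), (5130,
      656400), (41008, 1536), (49858, 12583104), (14720, 536), (24576, 23648), (33370, 1187968),
      (32825, 35127296)])]"

definition all_codes :: "code_data list" where
  "all_codes = map snd codes_1 @ map snd codes_2"

lemma codes_ok: "list_all data_ok all_codes" "list_all self_orth all_codes"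
  by code_simp+

text \<open>Here (x1, x1) is the only shadow vector of weight 4 and contributes 14; the vectors of
  weight 8 come in pairs over the listed words.\<close>

fun beta_1 :: "int \<times> code_data \<Rightarrow> bool" where
  "beta_1 (b, t) \<longleftrightarrow> wt (x1_word t) = 2 \<and> b = 14 + 2 * int (length (sh_words t))"

text \<open>No shadow vector has weight 4. Those of weight 8 are the double of \<open>x1\<close>,
  the doubles of the other coset vectors of weight 4, counted by \<open>tail_count\<close>, and the
  pairs.\<close>

fun beta_2 :: "int \<times> code_data \<Rightarrow> bool" where
  "beta_2 (b, t) \<longleftrightarrow> wt (x1_word t) = 4 \<and> b = 1 + int (tail_count t) + 2 * int (length (sh_words t))"

lemma betas: "list_all beta_1 codes_1" "list_all beta_2 codes_2"
  by code_simp+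

lemma sweep_1: "sweep GG (map (tag GG) cand_data) (map prepare (map snd codes_1)) E8_data"
  by code_simp

lemma sweep_2: "sweep GG (map (tag GG) cand_data) (map prepare (map snd codes_2)) E8_data"
  by code_simp

section \<open>Soundness of the computations\<close>

lemma orth_iff: "orth G H \<longleftrightarrow> (\<forall>g\<in>set G. \<forall>h\<in>set H. \<not> par g h)"
  by (induction G) (auto simp: list_all_iff)

lemma enc_nth:
  assumes "set G \<subseteq> words n" "i < n" shows "enc n G a ! i = par a (map (\<lambda>g. g ! i) G)"
proof (rule enc_additive [OF wlinear_words assms(1)])
  show "additive_on (words n) (\<lambda>g. g ! i)"
    using assms(2) by (auto simp: additive_on_def words_def xr_nth)
qed

lemma par_unit: "length a = n \<Longrightarrow> j < n \<Longrightarrow> par a (map (\<lambda>i. i = j) [0..<n]) = a ! j"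
proof (induction a arbitrary: n j)
  case (Cons x a)
  then obtain m where n: "n = Suc m" "length a = m" by auto
  have z: "par a (map (\<lambda>i. False) [0..<m]) = False"
    by (simp add: map_replicate_const)
  show ?case
  proof (cases j)
    case 0
    then show ?thesis using n z by (simp add: map_upt_Suc del: upt_Suc)
  next
    case (Suc k)
    then show ?thesis using Cons.IH [of m k] Cons.prems n by (simp add: map_upt_Suc del: upt_Suc)
  qed
qed simp

lemma wspan_orth:
  assumes "set G \<subseteq> words n" "orth G G" "x \<in> wspan n G" "y \<in> wspan n G" shows "\<not> par x y"
proof -
  obtain a b where ab: "x = enc n G a" "y = enc n G b" using assms(3,4) by (auto simp: wspan_def)
  have "par g (enc n G b) = False" if "g \<in> set G" for g
  proof -
    have "map (\<lambda>h. par h g) G = zero (length G)"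
      using assms(2) that by (intro nth_equalityI) (auto simp: orth_iff)
    then show ?thesis using par_enc [OF assms(1), of b g] by (simp add: par_commute)
  qed
  then have "map (\<lambda>g. par g (enc n G b)) G = zero (length G)"
    by (intro nth_equalityI) auto
  then show ?thesis unfolding ab par_enc [OF assms(1)] by simp
qed

text \<open>The positions \<open>ps j\<close> carry the information digits unchanged, so a word of
  the span determines its coefficients.\<close>

lemma card_systematic_wspan:
  assumes G: "set G \<subseteq> words n" and ps: "\<And>j. j < length G \<Longrightarrow> ps j < n"
    and unit: "\<And>j. j < length G \<Longrightarrow> map (\<lambda>g. g ! ps j) G = map (\<lambda>i. i = j) [0..<length G]"
  shows "a \<in> words (length G) \<Longrightarrow> j < length G \<Longrightarrow> enc n G a ! ps j = a ! j"
    and "inj_on (enc n G) (words (length G))" and "card (wspan n G) = 2 ^ length G"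
proof -
  show nth: "enc n G a ! ps j = a ! j" if "a \<in> words (length G)" "j < length G" for a j
    using enc_nth [OF G ps [OF that(2)], of a] unit [OF that(2)] par_unit [of a "length G" j] that
    by (simp add: words_def)
  show "inj_on (enc n G) (words (length G))"
  proof (rule inj_onI)
    fix a b assume ab: "a \<in> words (length G)" "b \<in> words (length G)" "enc n G a = enc n G b"
    show "a = b"
    proof (rule nth_equalityI)
      fix i assume "i < length a"
      then show "a ! i = b ! i"
        using nth [OF ab(1), of i] nth [OF ab(2), of i] ab by (simp add: words_def)
    qed (use ab in \<open>simp add: words_def\<close>)
  qed
  then show "card (wspan n G) = 2 ^ length G"
    by (simp add: wspan_def card_image card_words)
qed

lemma lightw_sound:
  "lightw k m G acc \<Longrightarrow> set G \<subseteq> words n \<Longrightarrow> length acc = n \<Longrightarrow> length a = length G \<Longrightarrow> wt a \<le> m \<Longrightarrow>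
     wt (xr (enc n G a) acc) \<noteq> k"
proof (induction k m G acc arbitrary: a rule: lightw.induct)
  case (2 k g G acc)
  then obtain b where b: "a = False # b" "length b = length G" "wt b \<le> 0"
    by (cases a) (auto split: if_splits)
  then show ?case using 2 by auto
next
  case (3 k m g G acc)
  then obtain x b where b: "a = x # b" "length b = length G" by (cases a) auto
  show ?case
  proof (cases x)
    case True
    have "wt (xr (enc n G b) (xr g acc)) \<noteq> k"
      using 3 b True by (intro 3(2)) (auto simp: words_def)
    moreover have "xr (xr g (enc n G b)) acc = xr (enc n G b) (xr g acc)"
      by (metis xr_assoc xr_commute)
    ultimately show ?thesis using b True by simp
  qed (use 3 b in auto)
qed simp

lemma lessw_irrefl: "\<not> lessw a a"
  by (induction a) auto

lemma lessw_trans: "lessw a b \<Longrightarrow> lessw b c \<Longrightarrow> lessw a c"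
proof (induction a b arbitrary: c rule: lessw.induct)
  case (1 x xs y ys)
  then show ?case by (cases c) (auto split: if_splits)
qed auto

lemma chain_sound:
  "chain G a xs \<Longrightarrow> (\<forall>x\<in>set xs. lessw a (bits 16 x) \<and> wt (enc 32 G (bits 16 x)) = 8) \<and>
     distinct (map (bits 16) xs)"
proof (induction G a xs rule: chain.induct)
  case (2 G a x xs)
  then have h: "lessw a (bits 16 x)" "wt (enc 32 G (bits 16 x)) = 8"
    "\<forall>y\<in>set xs. lessw (bits 16 x) (bits 16 y) \<and> wt (enc 32 G (bits 16 y)) = 8"
    "distinct (map (bits 16) xs)" by auto
  then show ?case using lessw_trans [of a "bits 16 x"] lessw_irrefl by fastforce
qed simp

lemma memw_iff: "memw a bs \<longleftrightarrow> a \<in> set bs"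
  by (induction bs) auto

lemma set_cand: "set (cand e ags) = {(a, g) \<in> set ags. disj e g}"
proof (induction ags)
  case (Cons p ags)
  obtain a g where "p = (a, g)" by fastforce
  then show ?case using Cons by (cases "disj e g") auto
qed simp

lemma set_cands: "set (cands e agss) = {(a, g) \<in> \<Union> (set ` set agss). disj e g}"
  by (induction agss) (auto simp: set_cand)

lemma tests_iff: "tests a e ags ts \<longleftrightarrow> (\<forall>(KT, q, sh)\<in>set ts. verdict a ags (enc 16 KT e) q sh)"
  by (induction ts) auto

lemma sweep_iff:
  "sweep G agss ts xs \<longleftrightarrow>
     (\<forall>x\<in>set xs. tests (bits 16 x) (enc 32 G (bits 16 x)) (cands (enc 32 G (bits 16 x)) agss) ts)"
  by (induction xs) (auto simp: tests_word_def)

section \<open>The code of length 32\<close>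

lemma GG: "length GG = 16" "set GG \<subseteq> words 32"
  using GG_checks(1,2) by (auto simp: list_all_iff words_def)

lemma info_pos:
  assumes "j < 16"
  shows "info_pos j < 32" "map (\<lambda>g. g ! info_pos j) GG = map (\<lambda>i. i = j) [0..<16]"
proof -
  have "j \<in> set [0..<16]" unfolding set_upt using assms by simp
  then show "map (\<lambda>g. g ! info_pos j) GG = map (\<lambda>i. i = j) [0..<16]"
    by (rule GG_checks(5) [unfolded map_eq_conv, rule_format])
qed (use assms in \<open>auto simp: info_pos_def\<close>)

lemmas GG_systematic = card_systematic_wspan [OF GG(2), unfolded GG(1), of info_pos, OF info_pos]

lemma E_self_dual: "wself_dual 32 (wspan 32 GG)"
  using wself_dualI [of 16 "wspan 32 GG"] wlinear_wspan [OF GG(2)] wspan_orth [OF GG(2) GG_checks(3)]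
    GG_systematic(3) by simp

text \<open>As \<open>half_odd\<close> is additive on a self-dual code, its vanishing on the
  generators is enough.\<close>

lemma E_doubly_even:
  assumes "e \<in> wspan 32 GG" shows "4 dvd wt e"
proof -
  obtain a where a: "e = enc 32 GG a" using assms by (auto simp: wspan_def)
  have "half_odd e = par a (map half_odd GG)"
    unfolding a
    by (rule enc_additive [OF wself_dualD(1) [OF E_self_dual] generators_in_wspan [OF GG(2)]
          additive_half_odd [OF E_self_dual]])
  also have "map half_odd GG = zero 16"
    using GG_checks(4) GG(1) by (intro nth_equalityI) (auto simp: list_all_iff)
  finally have "even (wt e div 2)" by (simp add: half_odd_def)
  moreover have "even (wt e)" using wself_dualD(4) [OF E_self_dual assms] .
  ultimately show ?thesis by presburger
qed

lemma wt_take: "wt (take k x) \<le> wt x"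
  using wt_append [of "take k x" "drop k x"] by simp

text \<open>The information digits are among the entries of the word, so a word of weight 4 combines
  at most four generators. This leaves the few sums already inspected in
  \<open>GG_light\<close>.\<close>

lemma E_no_four:
  assumes "e \<in> wspan 32 GG" shows "wt e \<noteq> 4"
proof
  assume w: "wt e = 4"
  obtain a where a: "a \<in> words 16" "e = enc 32 GG a" using assms GG(1) by (auto simp: wspan_def)
  have len: "length e = 32" using a(2) length_enc [OF GG(2)] by simp
  have "a = take 8 (drop 16 e) @ take 8 e"
  proof (rule nth_equalityI)
    fix j assume "j < length a"
    then have j: "j < 16" using a(1) by (simp add: words_def)
    have "a ! j = e ! info_pos j" using GG_systematic(1) [OF _ _ a(1) j] a(2) by simp
    also have "\<dots> = (take 8 (drop 16 e) @ take 8 e) ! j"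
      using j len by (auto simp: info_pos_def nth_append)
    finally show "a ! j = (take 8 (drop 16 e) @ take 8 e) ! j" .
  qed (use a(1) len in \<open>simp add: words_def\<close>)
  then have "wt a = wt (take 8 (drop 16 e)) + wt (take 8 (take 16 e))" by simp
  also have "\<dots> \<le> wt (drop 16 e) + wt (take 16 e)" by (intro add_mono wt_take)
  also have "\<dots> = wt e" using wt_append [of "take 16 e" "drop 16 e"] by simp
  finally have "wt (xr (enc 32 GG a) (zero 32)) \<noteq> 4"
    using lightw_sound [OF GG_light GG(2), of a] a(1) GG(1) w by (simp add: words_def)
  then show False using w a(2) len by simp
qed

definition E8_words :: "bool list list" where
  "E8_words = map (\<lambda>x. enc 32 GG (bits 16 x)) E8_data"

lemma bits_words [simp]: "bits n x \<in> words n"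
  by (simp add: words_def)

text \<open>Completeness comes from counting: the listed words are 620 distinct elements of a set
  that has exactly 620 by \<open>weights_32\<close>.\<close>

lemma E8_words: "distinct E8_words" "set E8_words = {e \<in> wspan 32 GG. wt e = 8}"
proof -
  note ch = chain_sound [OF E8_checks(2)]
  have inj: "inj_on (enc 32 GG) (set (map (bits 16) E8_data))"
    using GG_systematic(2) by (rule inj_on_subset) auto
  have E8: "E8_words = map (enc 32 GG) (map (bits 16) E8_data)"
    by (simp add: E8_words_def)
  show dis: "distinct E8_words"
    unfolding E8 distinct_map using ch inj by (simp add: distinct_map)
  have "set E8_words \<subseteq> {e \<in> wspan 32 GG. wt e = 8}"
    using ch by (auto simp: E8_words_def wspan_def GG(1))
  moreover have "card {e \<in> wspan 32 GG. wt e = 8} = 620"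
    using weights_32 [OF E_self_dual E_doubly_even E_no_four] by simp
  moreover have "card (set E8_words) = 620"
    using distinct_card [OF dis] E8_checks(1) by (simp add: E8_words_def)
  moreover have "finite {e \<in> wspan 32 GG. wt e = 8}"
    using wlinearD(2) [OF wself_dualD(1) [OF E_self_dual]] by simp
  ultimately show "set E8_words = {e \<in> wspan 32 GG. wt e = 8}"
    by (intro card_seteq) auto
qed

lemma count_sup:
  assumes "length x = 32"
  shows "count_sup GG x ys = length (filter (\<lambda>e. off x e = zero 32) (map (\<lambda>y. enc 32 GG (bits 16 y)) ys))"
proof -
  have "wt (off x (enc 32 GG a)) = 0 \<longleftrightarrow> off x (enc 32 GG a) = zero 32" for a
    using length_enc [OF GG(2), of a] assms by (simp add: wt_eq_0_iff)
  then show ?thesis by (induction ys) auto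
qed

lemma tail_count:
  "tail_count t = card {e \<in> wspan 32 GG. wt e = 8 \<and> off (x1_word t) e = zero 32}"
proof -
  have "length (x1_word t) = 32" by (cases t) auto
  then have "tail_count t = length (filter (\<lambda>e. off (x1_word t) e = zero 32) E8_words)"
    by (simp add: tail_count_def count_sup E8_words_def)
  also have "\<dots> = card (set (filter (\<lambda>e. off (x1_word t) e = zero 32) E8_words))"
    using E8_words(1) by (intro distinct_card [symmetric]) simp
  also have "set (filter (\<lambda>e. off (x1_word t) e = zero 32) E8_words)
      = {e \<in> wspan 32 GG. wt e = 8 \<and> off (x1_word t) e = zero 32}"
    using E8_words(2) by auto
  finally show ?thesis .
qed

section \<open>The codes over the ring\<close>

definition entry :: "bool list list \<Rightarrow> nat \<Rightarrow> nat \<Rightarrow> bit" where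
  "entry X i j = of_bool (X ! i ! j)"

definition B_rows :: "bool list list" where "B_rows = byte_rows B_data"

fun C_rows D_rows :: "code_data \<Rightarrow> bool list list" where
  "C_rows (c, d, _) = byte_rows c"
| "D_rows (c, d, _) = byte_rows d"

definition code_mat :: "code_data \<Rightarrow> R2 mat" where
  "code_mat t = mat 8 16 (\<lambda>(i, j).
     mkR2 (entry A_rows i j) (entry B_rows i j) (entry (C_rows t) i j) (entry (D_rows t) i j))"

definition L_mat :: "code_data \<Rightarrow> R2 mat" where
  "L_mat t = mat 8 8 (\<lambda>(i, j). code_mat t $$ (i, j + 8))"

lemma byte_rows_nth:
  "i < length c \<Longrightarrow> length (byte_rows c ! i) = 16"
  "i < length c \<Longrightarrow> j < 8 \<Longrightarrow> \<not> byte_rows c ! i ! j"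
  by (auto simp: byte_rows_def nth_append)

lemma length_byte_rows [simp]: "length (byte_rows c) = length c"
  by (simp add: byte_rows_def)

lemma A_rows_nth:
  assumes "i < 8" shows "length (A_rows ! i) = 16" "j < 8 \<Longrightarrow> A_rows ! i ! j \<longleftrightarrow> i = j"
proof -
  show "length (A_rows ! i) = 16"
    using A_rows_checks(1,2) assms by (simp add: list_all_iff)
  assume j: "j < 8"
  have "map (take 8) A_rows ! i ! j = map (\<lambda>i. map (\<lambda>j. i = j) [0..<8]) [0..<8] ! i ! j"
    by (simp only: A_rows_checks(4))
  also have "\<dots> \<longleftrightarrow> i = j"
    using assms j by (simp only: nth_map length_map length_upt nth_upt) simp
  finally show "A_rows ! i ! j \<longleftrightarrow> i = j" using assms j A_rows_checks(1) by simp
qed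

lemma B_rows: "length B_rows = 8"
  using A_rows_checks(3) by (simp add: B_rows_def)

lemma data_okD:
  assumes "data_ok t"
  shows "length (C_rows t) = 8" "length (D_rows t) = 8"
  using assms by (cases t; auto simp: data_ok_def)+

lemma append_cols_index:
  assumes "A \<in> carrier_mat m k" "B \<in> carrier_mat m l"
  shows "append_cols A B \<in> carrier_mat m (k + l)"
    "i < m \<Longrightarrow> j < k + l \<Longrightarrow> append_cols A B $$ (i, j) = (if j < k then A $$ (i, j) else B $$ (i, j - k))"
  using assms by (auto simp: append_cols_def)

lemma append_cols_code_mat:
  assumes "data_ok t" shows "append_cols (1\<^sub>m 8) (L_mat t) = code_mat t"
proof (rule eq_matI)
  have L: "L_mat t \<in> carrier_mat 8 8" by (simp add: L_mat_def)
  note ac = append_cols_index [OF one_carrier_mat L]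
  show "dim_row (append_cols (1\<^sub>m 8) (L_mat t)) = dim_row (code_mat t)"
    "dim_col (append_cols (1\<^sub>m 8) (L_mat t)) = dim_col (code_mat t)"
    using ac(1) by (auto simp: code_mat_def)
  fix i j assume "i < dim_row (code_mat t)" "j < dim_col (code_mat t)"
  then have ij: "i < 8" "j < 16" by (auto simp: code_mat_def)
  show "append_cols (1\<^sub>m 8) (L_mat t) $$ (i, j) = code_mat t $$ (i, j)"
  proof (cases "j < 8")
    case True
    have "entry B_rows i j = 0" "entry (C_rows t) i j = 0" "entry (D_rows t) i j = 0"
      using byte_rows_nth(2) [of i _ j] ij True data_okD [OF assms] B_rows
      by (cases t; auto simp: entry_def B_rows_def)+
    then have "code_mat t $$ (i, j) = mkR2 (of_bool (i = j)) 0 0 0"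
      using ij True A_rows_nth(2) [of i j] by (simp add: code_mat_def entry_def)
    also have "\<dots> = (1\<^sub>m 8 :: R2 mat) $$ (i, j)"
      using ij True by (simp add: R2_eq_iff)
    finally show ?thesis using ac(2) ij True by simp
  next
    case False
    then show ?thesis using ac(2) [of i j] ij by (simp add: L_mat_def)
  qed
qed

definition rowv :: "bool list list \<Rightarrow> nat \<Rightarrow> bit vec" where
  "rowv X i = vec 16 (\<lambda>j. entry X i j)"

lemma bl_rowv: "length (X ! i) = 16 \<Longrightarrow> bl (rowv X i) = X ! i"
  by (rule nth_equalityI) (auto simp: rowv_def entry_def)

lemma code_row:
  assumes "i < 8"
  shows "map_vec cf_1 (row (code_mat t) i) = rowv A_rows i"
    "map_vec cf_u (row (code_mat t) i) = rowv B_rows i"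
    "map_vec cf_v (row (code_mat t) i) = rowv (C_rows t) i"
    "map_vec cf_uv (row (code_mat t) i) = rowv (D_rows t) i"
  using assms by (auto simp: code_mat_def rowv_def)

lemma row_lengths:
  assumes "data_ok t" "i < 8"
  shows "length (A_rows ! i) = 16" "length (B_rows ! i) = 16"
    "length (C_rows t ! i) = 16" "length (D_rows t ! i) = 16"
  using A_rows_nth(1) byte_rows_nth(1) [of i] data_okD [OF assms(1)] B_rows assms(2)
  by (cases t; auto simp: B_rows_def)+

lemma rows4_nth:
  assumes "data_ok t" "i < 8"
  shows "(A_rows ! i, B_rows ! i, C_rows t ! i, D_rows t ! i) \<in> set (rows4 t)"
proof -
  have len: "length A_rows = 8" "length B_rows = 8" "length (C_rows t) = 8" "length (D_rows t) = 8"
    using A_rows_checks(1) B_rows data_okD [OF assms(1)] by auto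
  have r: "rows4 t = zip A_rows (zip B_rows (zip (C_rows t) (D_rows t)))"
    by (cases t) (simp add: rows4_def B_rows_def)
  have "rows4 t ! i = (A_rows ! i, B_rows ! i, C_rows t ! i, D_rows t ! i)" "i < length (rows4 t)"
    using len assms(2) by (simp_all add: r)
  then show ?thesis by (metis nth_mem)
qed

lemma code_mat_orth:
  assumes ok: "data_ok t" and orth: "self_orth t" shows "code_mat t * (code_mat t)\<^sup>T = 0\<^sub>m 8 8"
proof (rule eq_matI)
  fix i j assume "i < dim_row (0\<^sub>m 8 8 :: R2 mat)" "j < dim_col (0\<^sub>m 8 8 :: R2 mat)"
  then have ij: "i < 8" "j < 8" by auto
  let ?x = "row (code_mat t) i" and ?y = "row (code_mat t) j"
  have dim: "dim_vec ?x = dim_vec ?y" by (simp add: code_mat_def)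
  have o: "orth4 (A_rows ! i) (B_rows ! i) (C_rows t ! i) (D_rows t ! i)
      (A_rows ! j) (B_rows ! j) (C_rows t ! j) (D_rows t ! j)"
    using orth rows4_nth [OF ok ij(1)] rows4_nth [OF ok ij(2)]
    unfolding self_orth_def list_all_iff by fastforce
  have sp: "rowv X i \<bullet> rowv Y j = of_bool (par (X ! i) (Y ! j))"
    if "length (X ! i) = 16" "length (Y ! j) = 16" for X Y
    using that scalar_prod_bl [of "rowv X i" "rowv Y j"] by (simp add: bl_rowv) (simp add: rowv_def)
  note len = row_lengths [OF ok ij(1)] row_lengths [OF ok ij(2)]
  have "?x \<bullet> ?y = 0"
    unfolding R2_eq_iff cf_scalar_prod [OF dim] code_row [OF ij(1)] code_row [OF ij(2)] cf_zero
    using o len by (simp add: sp) (auto simp: of_bool_def)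
  then show "(code_mat t * (code_mat t)\<^sup>T) $$ (i, j) = 0\<^sub>m 8 8 $$ (i, j)"
    using ij by (simp add: code_mat_def)
qed (simp_all add: code_mat_def)

abbreviation ring_code :: "code_data \<Rightarrow> R2 vec set" where
  "ring_code t \<equiv> generated_code (code_mat t)"

abbreviation bin_code :: "code_data \<Rightarrow> bool list set" where
  "bin_code t \<equiv> bl ` gray ` ring_code t"

lemma code_mat_carrier: "code_mat t \<in> carrier_mat 8 16"
  by (simp add: code_mat_def)

lemma cf_gens:
  "cf_1 R2_u = 0" "cf_u R2_u = 1" "cf_v R2_u = 0" "cf_uv R2_u = 0"
  "cf_1 R2_v = 0" "cf_u R2_v = 0" "cf_v R2_v = 1" "cf_uv R2_v = 0"
  by (transfer; simp add: poly_u_def poly_v_def)+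

text \<open>The first two Gray blocks (d, c + d) form the upper word; adding them to the last two,
  (b + d, a + b + c + d), leaves (b, a + b).\<close>

lemma bl_gray_lift:
  assumes "bl (map_vec cf_1 x) = a" "bl (map_vec cf_u x) = b"
    "bl (map_vec cf_v x) = c" "bl (map_vec cf_uv x) = d"
    "length a = n" "length b = n" "length c = n" "length d = n"
  shows "bl (gray x) = lift_word (d @ xr c d) (b @ xr a b)"
proof -
  have "xr (xr c d) (xr a b) = xr (xr (xr a b) c) d" by (metis xr_assoc xr_commute)
  then show ?thesis
    unfolding bl_gray assms(1-4) lift_word_def
    using assms(5-8) by (simp add: xr_append xr_commute [of d b])
qed

lemma swap_append: "length x = 16 \<Longrightarrow> swap (x @ y) = y @ x"
  by (simp add: swap_def)

text \<open>Multiplication by \<open>1 + u\<close> exchanges the halves of both words of a lifted word, and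
  multiplication by \<open>v\<close> doubles the word at the bottom.\<close>

lemma code_rows_in_bin_code:
  assumes ok: "data_ok t" and i: "i < 8"
  defines "k \<equiv> D_rows t ! i @ xr (C_rows t ! i) (D_rows t ! i)"
    and "g \<equiv> B_rows ! i @ xr (A_rows ! i) (B_rows ! i)"
  shows "lift_word k g \<in> bin_code t" "lift_word (swap k) (swap g) \<in> bin_code t"
    "g @ g \<in> bin_code t" "swap g @ swap g \<in> bin_code t"
proof -
  let ?x = "row (code_mat t) i" and ?a = "A_rows ! i" and ?b = "B_rows ! i"
    and ?c = "C_rows t ! i" and ?d = "D_rows t ! i"
  note len = row_lengths [OF ok i]
  have x: "?x \<in> ring_code t" using row_in_generated_code [OF code_mat_carrier i] .
  have dim: "dim_vec ?x = 16" by (simp add: code_mat_def)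
  have smult: "r \<cdot>\<^sub>v ?x \<in> ring_code t" for r
    using linear_generated_code [OF code_mat_carrier, of t] x by (simp add: linear_code_iff)
  have e: "?x $ j = mkR2 (of_bool (?a ! j)) (of_bool (?b ! j)) (of_bool (?c ! j)) (of_bool (?d ! j))"
    if "j < 16" for j
    using that i by (simp add: code_mat_def entry_def)
  have nz: "(of_bool P + of_bool Q \<noteq> (0 :: bit)) = (P \<noteq> Q)" for P Q by simp
  have xrs: "xr ?a ?b ! j = (?a ! j \<noteq> ?b ! j)" "xr ?c ?d ! j = (?c ! j \<noteq> ?d ! j)" if "j < 16" for j
    using that len by (simp_all add: xr_nth)
  note simps = cf_mult cf_add cf_gens
  have 1: "bl (gray ?x) = lift_word k g"
    unfolding k_def g_def using len i
    by (intro bl_gray_lift) (simp_all add: code_row bl_rowv)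
  have 2: "bl (gray ((1 + R2_u) \<cdot>\<^sub>v ?x)) = lift_word (xr ?c ?d @ xr ?c (xr ?c ?d)) (xr ?a ?b @ xr ?a (xr ?a ?b))"
    by (rule bl_gray_lift [where n = 16]; (rule nth_equalityI)?)
      (use dim len e xrs in \<open>auto simp: simps\<close>)
  have 3: "bl (gray (R2_v \<cdot>\<^sub>v ?x)) = lift_word (?b @ xr ?a ?b) (zero 16 @ xr (zero 16) (zero 16))"
    by (rule bl_gray_lift [where n = 16]; (rule nth_equalityI)?)
      (use dim len e in \<open>auto simp: simps\<close>)
  have 4: "bl (gray ((R2_v * (1 + R2_u)) \<cdot>\<^sub>v ?x))
      = lift_word (xr ?a ?b @ xr ?a (xr ?a ?b)) (zero 16 @ xr (zero 16) (zero 16))"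
    by (rule bl_gray_lift [where n = 16]; (rule nth_equalityI)?)
      (use dim len e xrs in \<open>auto simp: simps\<close>)
  have z: "zero 16 @ xr (zero 16) (zero 16) = zero 32"
    by (simp add: replicate_add [symmetric])
  have sw: "swap k = xr ?c ?d @ ?d" "swap g = xr ?a ?b @ ?b"
    using len by (simp_all add: k_def g_def swap_append)
  have canc: "xr ?c (xr ?c ?d) = ?d" "xr ?a (xr ?a ?b) = ?b" using len by simp_all
  have "lift_word g (zero 32) = g @ g" "lift_word (swap g) (zero 32) = swap g @ swap g"
    by (rule lift_word_zero; use len sw g_def in simp)+
  moreover have "bl (gray y) \<in> bin_code t" if "y \<in> ring_code t" for y using that by blast
  ultimately show "lift_word k g \<in> bin_code t" "lift_word (swap k) (swap g) \<in> bin_code t"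
    "g @ g \<in> bin_code t" "swap g @ swap g \<in> bin_code t"
    using 1 2 3 4 x smult unfolding z canc sw [symmetric] g_def [symmetric] by metis+
qed

lemma gens_nth:
  "set (gens X Y) = (\<lambda>i. Y ! i @ xr (X ! i) (Y ! i)) ` {i. i < min (length X) (length Y)}
     \<union> (\<lambda>i. swap (Y ! i @ xr (X ! i) (Y ! i))) ` {i. i < min (length X) (length Y)}"
proof -
  have "set (map2 (\<lambda>x y. y @ xr x y) X Y)
      = (\<lambda>i. Y ! i @ xr (X ! i) (Y ! i)) ` {i. i < min (length X) (length Y)}"
    by (force simp: set_zip image_iff)
  then show ?thesis unfolding gens_def set_append set_map by (simp only: image_image)
qed

lemma generators_in_bin_code:
  assumes ok: "data_ok t"
  shows "set (map2 lift_word (K_rows t) GG) \<subseteq> bin_code t" "g \<in> set GG \<Longrightarrow> g @ g \<in> bin_code t"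
    "length (K_rows t) = 16" "set (K_rows t) \<subseteq> words 32"
proof -
  have K: "K_rows t = gens (C_rows t) (D_rows t)" by (cases t) simp
  have G: "GG = gens A_rows B_rows" by (simp add: GG_def B_rows_def)
  have len: "length A_rows = 8" "length B_rows = 8" "length (C_rows t) = 8" "length (D_rows t) = 8"
    using A_rows_checks(1) B_rows data_okD [OF ok] by auto
  show "length (K_rows t) = 16" unfolding K gens_def using len by simp
  show "set (K_rows t) \<subseteq> words 32"
    using row_lengths [OF ok] len by (auto simp: K gens_nth words_def swap_def)
  show "g @ g \<in> bin_code t" if "g \<in> set GG"
    using that code_rows_in_bin_code(3,4) [OF ok] len by (auto simp: G gens_nth)
  let ?f = "\<lambda>x y. y @ xr x y"
  have "map2 lift_word (K_rows t) GG =
      map2 lift_word (map2 ?f (C_rows t) (D_rows t)) (map2 ?f A_rows B_rows)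
      @ map2 lift_word (map swap (map2 ?f (C_rows t) (D_rows t))) (map swap (map2 ?f A_rows B_rows))"
    unfolding K G gens_def using len by (simp add: zip_append)
  then show "set (map2 lift_word (K_rows t) GG) \<subseteq> bin_code t"
    using code_rows_in_bin_code(1,2) [OF ok] len by (auto simp: set_zip)
qed

lemma lifted_code_bin_code:
  assumes ok: "data_ok t" and orth: "self_orth t"
  shows "lifted_code GG (K_rows t) (bin_code t)"
proof -
  note gen = generators_in_bin_code [OF ok]
  have sub: "ring_code t \<subseteq> carrier_vec 16"
    using generated_code_subset [OF code_mat_carrier] .
  have lin: "wlinear 64 (bin_code t)"
    using wlinear_gray [OF linear_generated_code [OF code_mat_carrier, of t]] by simp
  have par0: "\<not> par x y" if xy: "x \<in> bin_code t" "y \<in> bin_code t" for x y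
  proof -
    obtain x' y' where "x = bl (gray x')" "y = bl (gray y')" "x' \<in> ring_code t" "y' \<in> ring_code t"
      using xy by blast
    then show ?thesis
      using gray_orth [of x' 16 y'] generated_code_orth [OF code_mat_carrier code_mat_orth [OF ok orth]] sub
      by blast
  qed
  \<comment> \<open>A lower bound for the size: 16 digits \<open>a\<close> choose the base word and
    16 digits \<open>b\<close> a doubled word to add, which gives 2^32 codewords. Injectivity
    follows from that of \<open>enc 32 GG\<close>, first for the base, then for the
    remainder.\<close>
  let ?f = "\<lambda>(a, b). lift_word (xr (enc 32 (K_rows t) a) (enc 32 GG b)) (enc 32 GG a)"
  have lenK: "length (enc 32 (K_rows t) a) = 32" for a using length_enc [OF gen(4)] .
  have lenG: "length (enc 32 GG a) = 32" for a using length_enc [OF GG(2)] .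
  have "?f ` (words 16 \<times> words 16) \<subseteq> bin_code t"
  proof clarify
    fix a b :: "bool list" assume "a \<in> words 16" "b \<in> words 16"
    have "lift_word (enc 32 (K_rows t) a) (enc 32 GG a) \<in> bin_code t"
      using enc_in [OF lin gen(1), of a] enc_lift_word [of "K_rows t" GG 32 a] gen(3,4) GG by simp
    moreover have "enc 32 GG b @ enc 32 GG b \<in> bin_code t"
    proof -
      have "set (map (\<lambda>g. g @ g) GG) \<subseteq> bin_code t"
        using gen(2) unfolding set_map by blast
      then have "enc 64 (map (\<lambda>g. g @ g) GG) b \<in> bin_code t"
        using enc_in [OF lin] by blast
      then show ?thesis using enc_double [OF GG(2), of b] by simp
    qed
    ultimately have "xr (lift_word (enc 32 (K_rows t) a) (enc 32 GG a)) (enc 32 GG b @ enc 32 GG b) \<in> bin_code t"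
      by (rule wlinearD(4) [OF lin])
    also have "enc 32 GG b @ enc 32 GG b = lift_word (enc 32 GG b) (zero 32)"
      using lift_word_zero [OF lenG] by simp
    finally show "lift_word (xr (enc 32 (K_rows t) a) (enc 32 GG b)) (enc 32 GG a) \<in> bin_code t"
      using xr_lift_word [OF lenK lenG lenG, of "zero 32" a a b] lenG by simp
  qed
  moreover have "inj_on ?f (words 16 \<times> words 16)"
  proof (rule inj_onI, clarify)
    fix a b a' b' assume w: "a \<in> words 16" "b \<in> words 16" "a' \<in> words 16" "b' \<in> words 16"
      and eq: "lift_word (xr (enc 32 (K_rows t) a) (enc 32 GG b)) (enc 32 GG a)
        = lift_word (xr (enc 32 (K_rows t) a') (enc 32 GG b')) (enc 32 GG a')"
    have h: "xr (enc 32 (K_rows t) a) (enc 32 GG b) = xr (enc 32 (K_rows t) a') (enc 32 GG b')"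
      "enc 32 GG a = enc 32 GG a'"
      using eq lift_word_eq_iff [of _ 32] lenK lenG by auto
    then have a: "a = a'" using GG_systematic(2) w by (auto dest: inj_onD)
    then have "enc 32 GG b = enc 32 GG b'"
      using h(1) xr_cancel [of "enc 32 (K_rows t) a" "enc 32 GG b"]
        xr_cancel [of "enc 32 (K_rows t) a" "enc 32 GG b'"] lenK lenG by metis
    then show "a = a' \<and> b = b'" using a GG_systematic(2) w by (auto dest: inj_onD)
  qed
  ultimately have "card (words 16 \<times> words 16) \<le> card (bin_code t)"
    using wlinearD(2) [OF lin] by (intro card_inj_on_le)
  then have "2 ^ 32 \<le> card (bin_code t)" by (simp add: card_cartesian_product card_words)
  then have "wself_dual 64 (bin_code t)"
    using wself_dualI [of 32 "bin_code t"] lin par0 by simp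
  then show ?thesis
    unfolding lifted_code_def
    using GG gen E_self_dual E_doubly_even E_no_four by blast
qed

section \<open>Weight enumerators\<close>

lemma codes_cases:
  assumes "t \<in> set all_codes"
  shows "data_ok t" "self_orth t" "x \<in> set E8_data \<Longrightarrow>
    verdict (bits 16 x) (cands (enc 32 GG (bits 16 x)) (map (tag GG) cand_data))
      (enc 16 (columns 32 (K_rows t)) (enc 32 GG (bits 16 x))) (q_word t) (map fst (sh_words t))"
proof -
  show "data_ok t" "self_orth t" using codes_ok assms by (auto simp: list_all_iff)
  assume x: "x \<in> set E8_data"
  have "prepare t \<in> set (map prepare (map snd codes_1)) \<or> prepare t \<in> set (map prepare (map snd codes_2))"
    using assms by (auto simp: all_codes_def)
  then show "verdict (bits 16 x) (cands (enc 32 GG (bits 16 x)) (map (tag GG) cand_data))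
      (enc 16 (columns 32 (K_rows t)) (enc 32 GG (bits 16 x))) (q_word t) (map fst (sh_words t))"
    using sweep_1 sweep_2 x unfolding sweep_iff tests_iff prepare_def by fastforce
qed

text \<open>The evaluated certificates are translated into the hypotheses of the abstract setting;
  \<open>s\<close> and \<open>u\<close> become the numbers of shadow vectors of weight 8 and
  4.\<close>

lemma bin_code_weights:
  assumes t: "t \<in> set all_codes" and x1: "wt (x1_word t) = 2 \<or> wt (x1_word t) = 4"
  defines "s \<equiv> (if wt (x1_word t) = 2 then 0 else 1 + int (tail_count t)) + 2 * int (length (sh_words t))"
    and "u \<equiv> (if wt (x1_word t) = 2 then 1 else 0)"
  shows "wself_dual 64 (bin_code t)" "\<And>c. c \<in> bin_code t \<Longrightarrow> c \<noteq> zero 64 \<Longrightarrow> 12 \<le> wt c"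
    "wcount (bin_code t) 12 = 1312 + 16 * (s + 14 * u)"
    "wcount (bin_code t) 14 = 23040 - 64 * (s + 14 * u) - 1024 * u"
proof -
  note ok = codes_cases(1) [OF t]
  interpret lifted_code GG "K_rows t" "bin_code t"
    by (rule lifted_code_bin_code [OF ok codes_cases(2) [OF t]])
  have q: "q = q_word t"
    by (simp add: q_def q_word_def lift_word_def)
  have synd: "enc 16 (columns 32 (K_rows t)) p = syn p" if "length p = 32" for p
    using enc_columns [OF K(2) that] by (simp add: K(1) syn_def)
  have synG: "enc 16 (columns 32 GG) h = map (\<lambda>g. par g h) GG" if "length h = 32" for h
    using enc_columns [OF G(2) that] by (simp add: G(1))
  let ?sh = "map (\<lambda>(a, h). (enc 32 GG a, h)) (sh_words t)"
  let ?cands = "\<lambda>p. cands p (map (tag GG) cand_data)"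
  have sep: "sep p a g" if "(a, g) \<in> set (?cands p)" for p a g
    using that by (auto simp: set_cands tag_def sep_def words_def)
  have ver: "sieve (syn p) (replicate 32 True) (?cands p)"
    "p \<notin> fst ` set ?sh \<Longrightarrow> hits (xr (syn p) q) (?cands p)" if p: "p \<in> E" "wt p = 8" for p
  proof -
    obtain x where x: "x \<in> set E8_data" "p = enc 32 GG (bits 16 x)"
      using E8_words(2) p by (auto simp: E8_words_def)
    have v: "verdict (bits 16 x) (?cands p) (syn p) q (map fst (sh_words t))"
      using codes_cases(3) [OF t x(1)] synd [OF EL(5) [OF p(1)]] by (simp add: x(2) [symmetric] q)
    then show "sieve (syn p) (replicate 32 True) (?cands p)" by (simp add: verdict_def)
    assume "p \<notin> fst ` set ?sh"
    then have "bits 16 x \<notin> set (map fst (sh_words t))" using x(2) by (force simp: image_iff)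
    then show "hits (xr (syn p) q) (?cands p)" using v by (simp add: verdict_def memw_iff)
  qed
  have min: "12 \<le> wt c" if "c \<in> bin_code t" "c \<noteq> zero 64" for c
  proof (rule min_weight [OF _ that])
    fix p assume p: "p \<in> E" "wt p = 8"
    show "\<exists>ags. (\<forall>(a, g)\<in>set ags. sep p a g) \<and> sieve (syn p) (replicate 32 True) ags"
      using ver(1) [OF p] sep by blast
  qed
  have sh_len: "a \<in> words 16 \<and> length h = 32" if "(a, h) \<in> set (sh_words t)" for a h
    using that by (cases t) (auto simp: words_def)
  have X: "length (x1_word t) = 32" by (cases t) simp
  have X2: "map (\<lambda>g. par g (x1_word t)) GG = q"
    using ok synG [OF X] by (simp add: data_ok_def q)
  have sh: "p \<in> E \<and> wt p = 8 \<and> length h = 32 \<and> off h p = zero 32 \<and> xr (syn p) (map (\<lambda>g. par g h) GG) = q"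
    if ph: "(p, h) \<in> set ?sh" for p h
  proof -
    obtain a where a: "(a, h) \<in> set (sh_words t)" "p = enc 32 GG a" using ph by auto
    then have "sh_ok (columns 32 (K_rows t)) (columns 32 GG) (q_word t) h p"
      using ok unfolding data_ok_def list_all_iff by blast
    then show ?thesis
      using a sh_len [OF a(1)] synd [of p] synG [of h] encG_E [of a] length_encG [of a]
      by (simp add: sh_ok_def q)
  qed
  have dis: "distinct (map fst ?sh)"
  proof -
    have "inj_on (enc 32 GG) (set (map fst (sh_words t)))"
      using GG_systematic(2) by (rule inj_on_subset) (use sh_len in auto)
    moreover have "distinct (map fst (sh_words t))" using ok by (simp add: data_ok_def)
    ultimately have "distinct (map (enc 32 GG) (map fst (sh_words t)))" by (simp only: distinct_map)
    then show ?thesis by (simp add: comp_def case_prod_unfold)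
  qed
  have kill: "\<exists>a g. sep p a g \<and> par a (xr (syn p) q)"
    if "p \<in> E" "wt p = 8" "p \<notin> fst ` set ?sh" for p
    using ver(2) [OF that] sep unfolding hits_def by blast
  have S0: "wcount S k = 0" if "k \<in> {0, 2, 6}" for k
    by (rule shadow_small [OF X X2 x1 _ dis _ that]) (fact sh kill)+
  have S4: "wcount S 4 = u"
    unfolding u_def by (rule shadow_four [OF X X2 x1 _ dis]) (fact sh kill)+
  have "wcount S 8 = (if wt (x1_word t) = 2 then 0 else 1 + int (tail_count t)) + 2 * int (length ?sh)"
    unfolding tail_count by (rule shadow_eight [OF X X2 x1 _ dis]) (fact sh kill)+
  then have S8: "wcount S 8 = s" by (simp add: s_def)
  show "wself_dual 64 (bin_code t)" by (rule C)
  show "\<And>c. c \<in> bin_code t \<Longrightarrow> c \<noteq> zero 64 \<Longrightarrow> 12 \<le> wt c" by (rule min)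
  show "wcount (bin_code t) 12 = 1312 + 16 * (s + 14 * u)"
    "wcount (bin_code t) 14 = 23040 - 64 * (s + 14 * u) - 1024 * u"
    using weights_64 [OF C min S0] unfolding S8 S4 by blast+
qed

section \<open>The binary code of length 16\<close>

definition D_mat :: "bit mat" where
  "D_mat = mat 8 16 (\<lambda>(i, j). entry A_rows i j)"

lemma append_cols_D_mat: "append_cols (1\<^sub>m 8) A2 = D_mat"
proof (rule eq_matI)
  have A2: "A2 \<in> carrier_mat 8 8" by (rule carrier_matI) (simp_all add: A2_def mat_of_rows_list_def)
  note ac = append_cols_index [OF one_carrier_mat A2]
  show "dim_row (append_cols (1\<^sub>m 8) A2) = dim_row D_mat" "dim_col (append_cols (1\<^sub>m 8) A2) = dim_col D_mat"
    using ac(1) by (auto simp: D_mat_def)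
  fix i j assume "i < dim_row D_mat" "j < dim_col D_mat"
  then have ij: "i < 8" "j < 16" by (auto simp: D_mat_def)
  show "append_cols (1\<^sub>m 8) A2 $$ (i, j) = D_mat $$ (i, j)"
  proof (cases "j < 8")
    case True
    then show ?thesis using ac(2) ij A_rows_nth(2) [of i j] by (auto simp: D_mat_def entry_def)
  next
    case False
    then have j: "j - 8 < 8" using ij by simp
    have d: "A_rows ! i ! j = bits 8 (A_data ! i) ! (j - 8)"
    proof -
      have "map (drop 8) A_rows ! i ! (j - 8) = map (bits 8) A_data ! i ! (j - 8)"
        by (simp only: A_rows_checks(5))
      moreover have "length A_data = 8" by (simp add: A_data_def)
      ultimately show ?thesis using ij False A_rows_checks(1) A_rows_nth(1) [of i] by simp
    qed
    have "map (\<lambda>x. map of_bool (bits 8 x)) A_data =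
       [[1,0,0,1,1,1,1,0], [0,1,0,1,1,1,1,0], [0,0,1,1,1,1,1,0], [0,0,0,1,0,0,1,1],
        [0,0,0,0,1,0,1,1], [0,0,0,0,0,1,1,1], [1,1,1,1,1,1,0,1], [1,1,1,0,0,0,1,1::bit]]"
      by code_simp
    then have eq: "A2 = mat_of_rows_list 8 (map (\<lambda>x. map of_bool (bits 8 x)) A_data)"
      by (simp only: A2_def)
    have "length A_data = 8" by (simp add: A_data_def)
    then have "A2 $$ (i, j - 8) = of_bool (bits 8 (A_data ! i) ! (j - 8))"
      unfolding eq using ij(1) j by (simp add: mat_of_rows_list_def)
    then show ?thesis using ac(2) [of i j] ij False d by (simp add: D_mat_def entry_def)
  qed
qed

lemma D_code_eq: "D_code = generated_code D_mat"
  by (simp add: D_code_def append_cols_D_mat)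

lemma D_mat_carrier: "D_mat \<in> carrier_mat 8 16"
  by (simp add: D_mat_def)

lemma A_rows_words: "set A_rows \<subseteq> words 16"
  using A_rows_checks(2) by (auto simp: list_all_iff words_def)

lemma D_checks: "orth A_rows A_rows" "lightw 2 8 A_rows (zero 16)"
  by code_simp+

lemma bl_carrier_vec: "bl ` carrier_vec n = words n"
proof (intro equalityI subsetI)
  fix xs assume "xs \<in> words n"
  then show "xs \<in> bl ` carrier_vec n" using bl_surj [of xs n] by (auto simp: words_def)
qed (use bl_words in auto)

lemma bl_D_code: "bl ` D_code = wspan 16 A_rows"
proof -
  have "bl (D_mat\<^sup>T *\<^sub>v y) = enc 16 A_rows (bl y)" if y: "y \<in> carrier_vec 8" for y
  proof (rule nth_equalityI)
    have l: "length (enc 16 A_rows (bl y)) = 16" by (rule length_enc [OF A_rows_words])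
    show "length (bl (D_mat\<^sup>T *\<^sub>v y)) = length (enc 16 A_rows (bl y))"
      using l D_mat_carrier by simp
    fix j assume "j < length (bl (D_mat\<^sup>T *\<^sub>v y))"
    then have j: "j < 16" using D_mat_carrier by simp
    have b: "bl (col D_mat j) = map (\<lambda>a. a ! j) A_rows"
      using j A_rows_checks(1) by (intro nth_equalityI) (auto simp: D_mat_def entry_def)
    have "dim_vec (col D_mat j) = dim_vec y" using y D_mat_carrier by simp
    then have "(D_mat\<^sup>T *\<^sub>v y) $ j = of_bool (par (bl y) (map (\<lambda>a. a ! j) A_rows))"
      using j y D_mat_carrier scalar_prod_bl [of "col D_mat j" y] by (simp add: b par_commute)
    then show "bl (D_mat\<^sup>T *\<^sub>v y) ! j = enc 16 A_rows (bl y) ! j"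
      using j D_mat_carrier enc_nth [OF A_rows_words j, of "bl y"] by simp
  qed
  note enc = this
  have "bl ` D_code = (\<lambda>y. bl (D_mat\<^sup>T *\<^sub>v y)) ` carrier_vec 8"
    using carrier_matD [OF D_mat_carrier] by (auto simp: D_code_eq generated_code_def)
  also have "\<dots> = (\<lambda>y. enc 16 A_rows (bl y)) ` carrier_vec 8"
    by (rule image_cong [OF refl enc])
  also have "\<dots> = enc 16 A_rows ` bl ` carrier_vec 8" by (simp only: image_image)
  also have "\<dots> = wspan 16 A_rows"
    by (simp only: bl_carrier_vec wspan_def A_rows_checks(1))
  finally show ?thesis .
qed

theorem D_code_properties: "self_dual 16 D_code" "binary_code 16 8 4 D_code"
proof -
  have sub: "D_code \<subseteq> carrier_vec 16"
    using generated_code_subset [OF D_mat_carrier] by (simp add: D_code_eq)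
  have unit: "map (\<lambda>a. a ! j) A_rows = map (\<lambda>i. i = j) [0..<length A_rows]" if "j < length A_rows" for j
    using that A_rows_nth(2) A_rows_checks(1) by (intro nth_equalityI) auto
  have "card (wspan 16 A_rows) = 2 ^ 8"
    using card_systematic_wspan(3) [OF A_rows_words, of "\<lambda>j. j"] unit A_rows_checks(1) by simp
  then have C: "wself_dual 16 (bl ` D_code)"
    unfolding bl_D_code
    using wself_dualI [of 8 "wspan 16 A_rows"] wlinear_wspan [OF A_rows_words]
      wspan_orth [OF A_rows_words D_checks(1)] by simp
  show sd: "self_dual 16 D_code" using self_dual_bl [OF sub C] .
  have inj: "inj_on bl D_code"
    by (intro inj_onI) (metis sub bl_inject carrier_vecD subsetD)
  have "card D_code = 2 ^ 8"
    using card_wself_dual [of 8 "bl ` D_code"] C card_image [OF inj] by simp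
  then have "vectorspace.dim class_ring (module_vec TYPE(bit) 16\<lparr>carrier := D_code\<rparr>) = 8"
    using dim_bl sd by (simp add: self_dual_def)
  moreover have "min_distance D_code = 4"
  proof (rule min_distance_bl [OF sub wself_dualD(1) [OF C]])
    \<comment> \<open>A row of weight 4: one digit of the identity block and three of
      \<open>A2\<close>.\<close>
    have "A_rows ! 3 \<in> set A_rows" using A_rows_checks(1) by simp
    then show "A_rows ! 3 \<in> bl ` D_code"
      using generators_in_wspan [OF A_rows_words] by (auto simp: bl_D_code)
    show "wt (A_rows ! 3) = 4" by code_simp
    fix c assume c: "c \<in> bl ` D_code" "c \<noteq> zero 16"
    have len: "length c = 16" using wlinearD(5) [OF wself_dualD(1) [OF C] c(1)] .
    obtain a where a: "length a = 8" "c = enc 16 A_rows a"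
      using c(1) A_rows_checks(1) by (auto simp: bl_D_code wspan_def words_def)
    \<comment> \<open>The budget of 8 rows admits all 2^8 combinations, so weight 2 is excluded
      outright; weights 1 and 3 are excluded by parity.\<close>
    have "wt (xr c (zero 16)) \<noteq> 2"
      unfolding a(2) using wt_le [of a] a(1) A_rows_checks(1)
      by (intro lightw_sound [OF D_checks(2) A_rows_words]) auto
    then have "wt c \<noteq> 2" using len by simp
    moreover have "wt c \<noteq> 0" using c(2) len by (simp add: wt_eq_0_iff)
    moreover have "even (wt c)" using wself_dualD(4) [OF C c(1)] .
    ultimately show "4 \<le> wt c" by presburger
  qed simp
  ultimately show "binary_code 16 8 4 D_code"
    using sd by (simp add: binary_code_def self_dual_def)
qed

text \<open>The coordinate \<open>cf_1\<close> is a ring homomorphism onto F_2, so it commutes with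
  encoding and every binary message has a preimage.\<close>

lemma proj_ring_code:
  assumes "data_ok t" shows "proj ` ring_code t = D_code"
proof -
  have M: "map_mat cf_1 (code_mat t) = D_mat"
    by (rule eq_matI) (auto simp: code_mat_def D_mat_def)
  have p: "proj ((code_mat t)\<^sup>T *\<^sub>v y) = D_mat\<^sup>T *\<^sub>v map_vec cf_1 y" if y: "y \<in> carrier_vec 8" for y
  proof (rule eq_vecI)
    fix j assume "j < dim_vec (D_mat\<^sup>T *\<^sub>v map_vec cf_1 y)"
    then have j: "j < 16" using D_mat_carrier by simp
    have "map_vec cf_1 (col (code_mat t) j) = col D_mat j"
      using j by (auto simp: code_mat_def D_mat_def)
    moreover have "dim_vec (col (code_mat t) j) = dim_vec y"
      using y by (simp add: code_mat_def)
    ultimately show "proj ((code_mat t)\<^sup>T *\<^sub>v y) $ j = (D_mat\<^sup>T *\<^sub>v map_vec cf_1 y) $ j"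
      using j code_mat_carrier D_mat_carrier cf_scalar_prod(1) [of "col (code_mat t) j" y]
      by (simp add: proj_def carrier_matD [OF code_mat_carrier])
  qed (simp add: proj_def carrier_matD [OF code_mat_carrier] carrier_matD [OF D_mat_carrier])
  have "map_vec cf_1 ` carrier_vec 8 = (carrier_vec 8 :: bit vec set)"
  proof (intro equalityI subsetI)
    fix z :: "bit vec" assume z: "z \<in> carrier_vec 8"
    have "z = map_vec cf_1 (map_vec (\<lambda>a. mkR2 a 0 0 0) z)" by (intro eq_vecI) auto
    then show "z \<in> map_vec cf_1 ` carrier_vec 8" using z by (intro image_eqI) auto
  qed auto
  then have "D_code = (\<lambda>y. D_mat\<^sup>T *\<^sub>v y) ` map_vec cf_1 ` carrier_vec 8"
    using carrier_matD [OF D_mat_carrier] by (auto simp: D_code_eq generated_code_def)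
  also have "\<dots> = proj ` ring_code t"
    using p carrier_matD [OF code_mat_carrier, of t]
    by (force simp: generated_code_def image_iff)
  finally show ?thesis by simp
qed

lemma code_properties:
  assumes t: "t \<in> set all_codes" and x1: "wt (x1_word t) = 2 \<or> wt (x1_word t) = 4"
    and A12: "0 < wcount (bin_code t) 12" and A14: "0 < wcount (bin_code t) 14"
  shows "L_mat t \<in> carrier_mat 8 8 \<and> ring_code t = generated_code (append_cols (1\<^sub>m 8) (L_mat t)) \<and>
       linear_code 16 (ring_code t) \<and> is_lift 16 (ring_code t) D_code \<and>
       binary_code 64 32 12 (gray ` ring_code t) \<and> self_dual 64 (gray ` ring_code t) \<and>
       type_I 64 (gray ` ring_code t) \<and> extremal 64 (gray ` ring_code t)"
proof -
  note ok = codes_cases(1) [OF t]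
  note W = bin_code_weights(1,2) [OF t x1]
  let ?V = "gray ` ring_code t"
  have sub: "?V \<subseteq> carrier_vec 64"
    using generated_code_subset [OF code_mat_carrier, of t] gray_carrier [of _ 16] by auto
  have sd: "self_dual 64 ?V" using self_dual_bl [OF sub W(1)] .
  have lin: "linear_code 16 (ring_code t)" using linear_generated_code [OF code_mat_carrier] .
  have ex: "\<exists>c\<in>bin_code t. wt c = k" if "0 < wcount (bin_code t) k" for k
  proof -
    have "{c \<in> bin_code t. wt c = k} \<noteq> {}" using that by (metis card.empty of_nat_0 less_irrefl)
    then show ?thesis by blast
  qed
  obtain c where c: "c \<in> bin_code t" "wt c = 12" using ex A12 by blast
  have min: "min_distance ?V = 12"
    by (rule min_distance_bl [OF sub wself_dualD(1) [OF W(1)] c]) (use W(2) in auto)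
  have inj: "inj_on bl ?V"
    by (intro inj_onI) (metis sub bl_inject carrier_vecD subsetD)
  have "card ?V = 2 ^ 32"
    using card_wself_dual [of 32 "bin_code t"] W(1) card_image [OF inj] by simp
  then have dim: "vectorspace.dim class_ring (module_vec TYPE(bit) 64\<lparr>carrier := ?V\<rparr>) = 32"
    using dim_bl sd by (simp add: self_dual_def)
  \<comment> \<open>A codeword of weight 14, which is not divisible by 4, rules out Type II.\<close>
  obtain d where d: "d \<in> ?V" "wt (bl d) = 14" using ex A14 by blast
  then have "weight d = 14" by (simp add: weight_bl)
  then have "\<not> type_II 64 ?V" using d(1) unfolding type_II_def by force
  then show ?thesis
    using sd min dim lin D_code_properties(1) proj_ring_code [OF ok] append_cols_code_mat [OF ok]
    by (auto simp: L_mat_def is_lift_def binary_code_def self_dual_def type_I_def extremal_def extremal_bound_def)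
qed

lemma coeff_bin_code:
  "k \<le> 64 \<Longrightarrow> coeff (weight_enumerator 64 (gray ` ring_code t)) k = wcount (bin_code t) k"
  using generated_code_subset [OF code_mat_carrier, of t] gray_carrier [of _ 16]
  by (intro weight_enumerator_bl) auto

lemma codes_1_weights:
  assumes "(b, t) \<in> set codes_1"
  shows "t \<in> set all_codes" "wt (x1_word t) = 2"
    "wcount (bin_code t) 12 = 1312 + 16 * b" "wcount (bin_code t) 14 = 22016 - 64 * b"
proof -
  show t: "t \<in> set all_codes" using assms by (force simp: all_codes_def)
  have "beta_1 (b, t)" using betas(1) assms by (auto simp: list_all_iff)
  then have b: "wt (x1_word t) = 2" "b = 14 + 2 * int (length (sh_words t))" by auto
  show "wt (x1_word t) = 2" by (rule b)
  show "wcount (bin_code t) 12 = 1312 + 16 * b" "wcount (bin_code t) 14 = 22016 - 64 * b"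
    using bin_code_weights(3,4) [OF t] b by simp_all
qed

lemma codes_2_weights:
  assumes "(b, t) \<in> set codes_2"
  shows "t \<in> set all_codes" "wt (x1_word t) = 4"
    "wcount (bin_code t) 12 = 1312 + 16 * b" "wcount (bin_code t) 14 = 23040 - 64 * b"
proof -
  show t: "t \<in> set all_codes" using assms by (force simp: all_codes_def)
  have "beta_2 (b, t)" using betas(2) assms by (auto simp: list_all_iff)
  then have b: "wt (x1_word t) = 4" "b = 1 + int (tail_count t) + 2 * int (length (sh_words t))" by auto
  show "wt (x1_word t) = 4" by (rule b)
  show "wcount (bin_code t) 12 = 1312 + 16 * b" "wcount (bin_code t) 14 = 23040 - 64 * b"
    using bin_code_weights(3,4) [OF t] b by simp_all
qed

theorem mainTheorem1:
  shows "(self_dual 16 D_code \<and> binary_code 16 8 4 D_code) \<and>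
    (\<forall>\<beta> \<in> {16, 20, 24, 26, 28, 30, 34, 38}. \<exists>(\<L> :: R2 vec set) L.
       L \<in> carrier_mat 8 8 \<and> \<L> = generated_code (append_cols (1\<^sub>m 8) L) \<and>
       linear_code 16 \<L> \<and> is_lift 16 \<L> D_code \<and>
       binary_code 64 32 12 (gray ` \<L>) \<and> self_dual 64 (gray ` \<L>) \<and>
       type_I 64 (gray ` \<L>) \<and> extremal 64 (gray ` \<L>) \<and>
       has_W64_1 \<beta> (gray ` \<L>)) \<and>
    (\<forall>\<beta> \<in> {3, 7, 11, 15, 26, 27, 35}. \<exists>(\<L> :: R2 vec set) L.
       L \<in> carrier_mat 8 8 \<and> \<L> = generated_code (append_cols (1\<^sub>m 8) L) \<and>
       linear_code 16 \<L> \<and> is_lift 16 \<L> D_code \<and>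
       binary_code 64 32 12 (gray ` \<L>) \<and> self_dual 64 (gray ` \<L>) \<and>
       type_I 64 (gray ` \<L>) \<and> extremal 64 (gray ` \<L>) \<and>
       has_W64_2 \<beta> (gray ` \<L>))"
proof (intro conjI ballI)
  show "self_dual 16 D_code" "binary_code 16 8 4 D_code" by (rule D_code_properties)+
next
  fix \<beta> :: int assume b: "\<beta> \<in> {16, 20, 24, 26, 28, 30, 34, 38}"
  also have "\<dots> = fst ` set codes_1" by (simp add: codes_1_def)
  finally obtain t where t: "(\<beta>, t) \<in> set codes_1" by auto
  note w = codes_1_weights [OF t]
  \<comment> \<open>The upper bound keeps 22016 - 64 \<beta> positive, so codewords of weight 14
    exist.\<close>
  have range: "14 \<le> \<beta>" "\<beta> \<le> 38" using b by auto
  then have "has_W64_1 \<beta> (gray ` ring_code t)"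
    by (simp add: has_W64_1_def coeff_bin_code w(3,4))
  moreover have pos: "0 < wcount (bin_code t) 12" "0 < wcount (bin_code t) 14"
    unfolding w(3,4) using range by auto
  ultimately show "\<exists>\<L> L. L \<in> carrier_mat 8 8 \<and> \<L> = generated_code (append_cols (1\<^sub>m 8) L) \<and>
       linear_code 16 \<L> \<and> is_lift 16 \<L> D_code \<and>
       binary_code 64 32 12 (gray ` \<L>) \<and> self_dual 64 (gray ` \<L>) \<and>
       type_I 64 (gray ` \<L>) \<and> extremal 64 (gray ` \<L>) \<and> has_W64_1 \<beta> (gray ` \<L>)"
    using code_properties [OF w(1) disjI1 [OF w(2)] pos] by blast
next
  fix \<beta> :: int assume b: "\<beta> \<in> {3, 7, 11, 15, 26, 27, 35}"
  also have "\<dots> = fst ` set codes_2" by (simp add: codes_2_def)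
  finally obtain t where t: "(\<beta>, t) \<in> set codes_2" by auto
  note w = codes_2_weights [OF t]
  have range: "0 \<le> \<beta>" "\<beta> \<le> 35" using b by auto
  then have "has_W64_2 \<beta> (gray ` ring_code t)"
    by (simp add: has_W64_2_def coeff_bin_code w(3,4))
  moreover have pos: "0 < wcount (bin_code t) 12" "0 < wcount (bin_code t) 14"
    unfolding w(3,4) using range by auto
  ultimately show "\<exists>\<L> L. L \<in> carrier_mat 8 8 \<and> \<L> = generated_code (append_cols (1\<^sub>m 8) L) \<and>
       linear_code 16 \<L> \<and> is_lift 16 \<L> D_code \<and>
       binary_code 64 32 12 (gray ` \<L>) \<and> self_dual 64 (gray ` \<L>) \<and>
       type_I 64 (gray ` \<L>) \<and> extremal 64 (gray ` \<L>) \<and> has_W64_2 \<beta> (gray ` \<L>)"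
    using code_properties [OF w(1) disjI2 [OF w(2)] pos] by blast
qed

end
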